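(* (1) Let $\pi$ be a representation of $\mathcal A_\infty$ on a Hilbert space $H$ which is orthogonal to every $\rho_m$, $m\ge0$ (equivalently, orthogonal to $\rho_\infty=\bigoplus_m\rho_m$). Then $\pi$ is faithful and extends to a representation $\overline\pi$ of $\mathrm{UHF}(3^\infty)$ on $H$, with $\pi(\mathcal A_\infty)''=\overline\pi(\mathrm{UHF}(3^\infty))''$. (2) If $\pi$ is a representation of $\mathrm{UHF}(3^\infty)$ such that $\pi|_{\mathcal A_\infty}$ is orthogonal to $\bigoplus_m\rho_m$, then $\pi(\mathcal A_\infty)''=\pi(\mathrm{UHF}(3^\infty))''$.
   Context: Indices $j\in\{1,2,3\}$ are taken mod $3$. $M_3(\mathbb C)$ has matrix units $e_{ij}$. $\mathrm{UHF}(3^\infty)$ is the $C^*$-inductive limit of $M_3(\mathbb C)^{\otimes n}$ under $x\mapsto x\otimes I_3$; each $M_3(\mathbb C)^{\otimes n}$ is regarded as a unital subalgebra of it. For $n\ge0$ put $\alpha^n_j=e_{jj}\otimes e_{22}^{\otimes n}\in M_3(\mathbb C)^{\otimes(n+1)}$, and for $k\ge1$ put $\beta^k_j=(e_{jj}\otimes e_{11}+e_{j+2,j+2}\otimes e_{33})\otimes e_{22}^{\otimes(k-1)}\in M_3(\mathbb C)^{\otimes(k+1)}$. The finite-dimensional $*$-algebra $\mathcal A_n\subset M_3(\mathbb C)^{\otimes(n+1)}$ is the linear span of the $\alpha^n_j$ and of the $x\otimes\beta^k_j$ with $j=1,2,3$, $k=1,\dots,n$, $x\in M_3(\mathbb C)^{\otimes(n-k)}$.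 $\mathcal A_\infty$ is the $C^*$-subalgebra of $\mathrm{UHF}(3^\infty)$ of all norm limits $\lim_n a_n$ with $a_n\in\mathcal A_n$. The slice map $\rho_m:\mathrm{UHF}(3^\infty)\to M_3(\mathbb C)^{\otimes(m+1)}$, identity on the first $m+1$ tensor factors and applying the state $x\mapsto x_{22}$ to each of the others, restricts to a $*$-homomorphism $\rho_m:\mathcal A_\infty\to\mathcal A_m\subset M_3(\mathbb C)^{\otimes(m+1)}=\mathcal B((\mathbb C^3)^{\otimes(m+1)})$, viewed as a finite-dimensional representation of $\mathcal A_\infty$; $\rho_\infty=\bigoplus_{m\ge0}\rho_m$. Representations are $*$-representations on nonzero Hilbert spaces and are nondegenerate. Two representations are orthogonal if there is no nonzero bounded intertwining operator between them. Double primes denote bicommutants. *)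

theory Defs
  imports
    "HOL-Analysis.Infinite_Sum"
    "HOL-Analysis.L2_Norm"
    "Jordan_Normal_Form.Schur_Decomposition"
begin

section \<open>Complex vector spaces, Hilbert spaces and unital C*-algebras\<close>

class complex_vector = real_vector +
  fixes scaleC :: "complex \<Rightarrow> 'a \<Rightarrow> 'a" (infixr \<open>*\<^sub>C\<close> 75)
  assumes scaleC_add_right: "c *\<^sub>C (x + y) = c *\<^sub>C x + c *\<^sub>C y"
    and scaleC_add_left: "(c + d) *\<^sub>C x = c *\<^sub>C x + d *\<^sub>C x"
    and scaleC_scaleC: "c *\<^sub>C d *\<^sub>C x = (c * d) *\<^sub>C x"
    and scaleC_of_real: "complex_of_real r *\<^sub>C x = r *\<^sub>R x"

global_interpretation complex_vector: vector_space "scaleC :: complex \<Rightarrow> 'a \<Rightarrow> 'a::complex_vector"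
  defines cspan = complex_vector.span
proof
  fix x :: 'a
  show "1 *\<^sub>C x = x"
    using scaleC_of_real[of 1 x] by simp
qed (simp_all add: scaleC_add_right scaleC_add_left scaleC_scaleC)

class complex_normed_vector = complex_vector + real_normed_vector +
  assumes norm_scaleC: "norm (c *\<^sub>C x) = cmod c * norm x"

text \<open>The inner product is linear in the second argument.\<close>

class chilbert_space = complex_normed_vector + complete_space +
  fixes cinner :: "'a \<Rightarrow> 'a \<Rightarrow> complex"
  assumes cinner_commute: "cinner x y = cnj (cinner y x)"
    and cinner_add_right: "cinner x (y + z) = cinner x y + cinner x z"
    and cinner_scaleC_right: "cinner x (c *\<^sub>C y) = c * cinner x y"
    and cinner_self: "cinner x x = complex_of_real ((norm x)\<^sup>2)"

text \<open>The base class \<open>real_normed_algebra_1\<close> makes the algebra unital with \<open>norm 1 = 1\<close>,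
  in particular nonzero.\<close>

class cstar_algebra = complex_normed_vector + real_normed_algebra_1 + complete_space +
  fixes star :: "'a \<Rightarrow> 'a"
  assumes mult_scaleC_left: "(c *\<^sub>C x) * y = c *\<^sub>C (x * y)"
    and mult_scaleC_right: "x * (c *\<^sub>C y) = c *\<^sub>C (x * y)"
    and star_add: "star (x + y) = star x + star y"
    and star_scaleC: "star (c *\<^sub>C x) = cnj c *\<^sub>C star x"
    and star_mult: "star (x * y) = star y * star x"
    and star_star: "star (star x) = x"
    and norm_star_mult_self: "norm (star x * x) = (norm x)\<^sup>2"

definition bounded_clinear ::
    "('a::complex_normed_vector \<Rightarrow> 'b::complex_normed_vector) \<Rightarrow> bool" where
  "bounded_clinear T \<longleftrightarrow> bounded_linear T \<and> (\<forall>c x. T (c *\<^sub>C x) = c *\<^sub>C T x)"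

definition commutant :: "('h::chilbert_space \<Rightarrow> 'h) set \<Rightarrow> ('h \<Rightarrow> 'h) set" where
  "commutant S = {T. bounded_clinear T \<and> (\<forall>s\<in>S. T \<circ> s = s \<circ> T)}"

definition bicommutant :: "('h::chilbert_space \<Rightarrow> 'h) set \<Rightarrow> ('h \<Rightarrow> 'h) set" where
  "bicommutant S = commutant (commutant S)"


section \<open>Representations\<close>

text \<open>Nondegenerate *-representations of a *-subalgebra \<open>A\<close> on the nonzero Hilbert space \<open>'h\<close>.
  The values of \<open>\<pi>\<close> outside \<open>A\<close> are irrelevant.\<close>

definition star_rep ::
    "'a::cstar_algebra set \<Rightarrow> ('a \<Rightarrow> 'h::chilbert_space \<Rightarrow> 'h) \<Rightarrow> bool" where
  "star_rep A \<pi> \<longleftrightarrow>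
     (\<exists>x::'h. x \<noteq> 0) \<and>
     (\<forall>a\<in>A. bounded_clinear (\<pi> a)) \<and>
     (\<forall>a\<in>A. \<forall>b\<in>A. \<forall>x. \<pi> (a + b) x = \<pi> a x + \<pi> b x) \<and>
     (\<forall>a\<in>A. \<forall>c x. \<pi> (c *\<^sub>C a) x = c *\<^sub>C \<pi> a x) \<and>
     (\<forall>a\<in>A. \<forall>b\<in>A. \<forall>x. \<pi> (a * b) x = \<pi> a (\<pi> b x)) \<and>
     (\<forall>a\<in>A. \<forall>x y. cinner (\<pi> (star a) x) y = cinner x (\<pi> a y)) \<and>
     closure (cspan {\<pi> a x | a x. a \<in> A}) = UNIV"

text \<open>Here \<open>\<sigma>\<close> acts on a closed subspace \<open>K\<close> of the Hilbert space \<open>'k\<close>; its values off \<open>K\<close> are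
  irrelevant. Only intertwiners from \<open>\<pi>\<close> to \<open>\<sigma>\<close> are mentioned; the adjoints of those are the
  intertwiners from \<open>\<sigma>\<close> to \<open>\<pi>\<close>.\<close>

definition orthogonal_reps ::
    "'a::cstar_algebra set \<Rightarrow> ('a \<Rightarrow> 'h::chilbert_space \<Rightarrow> 'h) \<Rightarrow>
     'k::chilbert_space set \<Rightarrow> ('a \<Rightarrow> 'k \<Rightarrow> 'k) \<Rightarrow> bool" where
  "orthogonal_reps A \<pi> K \<sigma> \<longleftrightarrow>
     (\<forall>T. bounded_clinear T \<and> range T \<subseteq> K \<and> (\<forall>a\<in>A. \<forall>x. T (\<pi> a x) = \<sigma> a (T x))
        \<longrightarrow> T = (\<lambda>_. 0))"


section \<open>The Hilbert space of square-summable functions\<close>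

typedef 'i ell2 = "{f :: 'i \<Rightarrow> complex. (\<lambda>i. (cmod (f i))\<^sup>2) summable_on UNIV}"
  by (intro exI[of _ "\<lambda>_. 0"]) simp

setup_lifting type_definition_ell2

lemma ell2_iff_L2_set_bounded:
  fixes f :: "'i \<Rightarrow> complex"
  shows "(\<lambda>i. (cmod (f i))\<^sup>2) summable_on UNIV \<longleftrightarrow>
           (\<exists>C. \<forall>F. finite F \<longrightarrow> L2_set (\<lambda>i. cmod (f i)) F \<le> C)"
proof
  assume s: "(\<lambda>i. (cmod (f i))\<^sup>2) summable_on UNIV"
  show "\<exists>C. \<forall>F. finite F \<longrightarrow> L2_set (\<lambda>i. cmod (f i)) F \<le> C"
    unfolding L2_set_def
    by (rule exI[of _ "sqrt (\<Sum>\<^sub>\<infinity>i. (cmod (f i))\<^sup>2)"])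
       (auto intro!: finite_sum_le_infsum s)
next
  assume "\<exists>C. \<forall>F. finite F \<longrightarrow> L2_set (\<lambda>i. cmod (f i)) F \<le> C"
  then obtain C where C: "\<And>F. finite F \<Longrightarrow> sqrt (\<Sum>i\<in>F. (cmod (f i))\<^sup>2) \<le> C"
    unfolding L2_set_def by auto
  have "(\<Sum>i\<in>F. (cmod (f i))\<^sup>2) \<le> C\<^sup>2" if "finite F" for F
    using C[OF that] by (simp add: sqrt_le_D)
  then show "(\<lambda>i. (cmod (f i))\<^sup>2) summable_on UNIV"
    by (intro nonneg_bdd_above_summable_on bdd_aboveI[of _ "C\<^sup>2"]) auto
qed

lemma L2_set_cmod_add_le:
  "L2_set (\<lambda>i. cmod (f i + g i)) F \<le> L2_set (\<lambda>i. cmod (f i)) F + L2_set (\<lambda>i. cmod (g i)) F"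
  by (rule order_trans[OF L2_set_mono L2_set_triangle_ineq]) (auto intro: norm_triangle_ineq)

lemma ell2_summable_add:
  assumes "(\<lambda>i. (cmod (f i))\<^sup>2) summable_on UNIV" "(\<lambda>i. (cmod (g i))\<^sup>2) summable_on UNIV"
  shows "(\<lambda>i. (cmod (f i + g i))\<^sup>2) summable_on UNIV"
proof -
  obtain C D where "\<And>F. finite F \<Longrightarrow> L2_set (\<lambda>i. cmod (f i)) F \<le> C"
    "\<And>F. finite F \<Longrightarrow> L2_set (\<lambda>i. cmod (g i)) F \<le> D"
    using assms unfolding ell2_iff_L2_set_bounded by blast
  then show ?thesis
    unfolding ell2_iff_L2_set_bounded
    by (intro exI[of _ "C + D"] allI impI order_trans[OF L2_set_cmod_add_le] add_mono) auto
qed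

lemma ell2_summable_mult:
  assumes "(\<lambda>i. (cmod (f i))\<^sup>2) summable_on UNIV"
  shows "(\<lambda>i. (cmod (c * f i))\<^sup>2) summable_on UNIV"
  using assms by (simp add: norm_mult power_mult_distrib summable_on_cmult_right)

lemma ell2_summable_inner:
  assumes "(\<lambda>i. (cmod (f i))\<^sup>2) summable_on UNIV" "(\<lambda>i. (cmod (g i))\<^sup>2) summable_on UNIV"
  shows "(\<lambda>i. cnj (f i) * g i) summable_on UNIV"
proof (rule abs_summable_summable, rule abs_summable_on_comparison_test)
  have "(\<lambda>i. (cmod (f i))\<^sup>2 + (cmod (g i))\<^sup>2) summable_on UNIV"
    by (intro summable_on_add assms)
  then show "(\<lambda>i. norm ((cmod (f i))\<^sup>2 + (cmod (g i))\<^sup>2)) summable_on UNIV"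
    by simp
  show "norm (cnj (f i) * g i) \<le> norm ((cmod (f i))\<^sup>2 + (cmod (g i))\<^sup>2)" for i
  proof -
    have "2 * (cmod (f i) * cmod (g i)) \<le> (cmod (f i))\<^sup>2 + (cmod (g i))\<^sup>2"
      using sum_squares_bound[of "cmod (f i)" "cmod (g i)"] by (simp add: mult.assoc)
    moreover have "0 \<le> cmod (f i) * cmod (g i)" by simp
    ultimately have "cmod (f i) * cmod (g i) \<le> (cmod (f i))\<^sup>2 + (cmod (g i))\<^sup>2" by linarith
    then show ?thesis by (simp add: norm_mult)
  qed
qed

instantiation ell2 :: (type) complex_vector
begin

lift_definition zero_ell2 :: "'i ell2" is "\<lambda>_. 0" by simp

lift_definition plus_ell2 :: "'i ell2 \<Rightarrow> 'i ell2 \<Rightarrow> 'i ell2" is "\<lambda>f g i. f i + g i"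
  by (rule ell2_summable_add)

lift_definition uminus_ell2 :: "'i ell2 \<Rightarrow> 'i ell2" is "\<lambda>f i. - f i" by simp

lift_definition minus_ell2 :: "'i ell2 \<Rightarrow> 'i ell2 \<Rightarrow> 'i ell2" is "\<lambda>f g i. f i - g i"
  subgoal for f g using ell2_summable_add[of f "\<lambda>i. - g i"] by simp
  done

lift_definition scaleR_ell2 :: "real \<Rightarrow> 'i ell2 \<Rightarrow> 'i ell2" is "\<lambda>r f i. complex_of_real r * f i"
  by (rule ell2_summable_mult)

lift_definition scaleC_ell2 :: "complex \<Rightarrow> 'i ell2 \<Rightarrow> 'i ell2" is "\<lambda>c f i. c * f i"
  by (rule ell2_summable_mult)

instance
  by standard (transfer; auto simp: algebra_simps)+

end

instantiation ell2 :: (type) complex_normed_vector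
begin

lift_definition norm_ell2 :: "'i ell2 \<Rightarrow> real" is "\<lambda>f. sqrt (\<Sum>\<^sub>\<infinity>i. (cmod (f i))\<^sup>2)" .

definition dist_ell2 :: "'i ell2 \<Rightarrow> 'i ell2 \<Rightarrow> real" where
  "dist_ell2 f g = norm (f - g)"

definition sgn_ell2 :: "'i ell2 \<Rightarrow> 'i ell2" where
  "sgn_ell2 f = inverse (norm f) *\<^sub>R f"

definition uniformity_ell2 :: "('i ell2 \<times> 'i ell2) filter" where
  "uniformity_ell2 = (INF e\<in>{0<..}. principal {(f, g). dist f g < e})"

definition open_ell2 :: "'i ell2 set \<Rightarrow> bool" where
  "open_ell2 U \<longleftrightarrow> (\<forall>f\<in>U. \<forall>\<^sub>F (f', g) in uniformity. f' = f \<longrightarrow> g \<in> U)"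

lemma L2_set_le_norm_ell2: "L2_set (\<lambda>i. cmod (Rep_ell2 f i)) F \<le> norm f"
proof (cases "finite F")
  case True
  then show ?thesis
    unfolding L2_set_def norm_ell2.rep_eq using Rep_ell2[of f]
    by (auto intro!: finite_sum_le_infsum)
next
  case False
  then show ?thesis by (simp add: norm_ell2.rep_eq infsum_nonneg)
qed

lemma norm_ell2_le:
  assumes "\<And>F. finite F \<Longrightarrow> L2_set (\<lambda>i. cmod (Rep_ell2 f i)) F \<le> C"
  shows "norm f \<le> C"
proof -
  have "0 \<le> C" using assms[of "{}"] by simp
  moreover have "(\<Sum>\<^sub>\<infinity>i. (cmod (Rep_ell2 f i))\<^sup>2) \<le> C\<^sup>2"
  proof (rule infsum_le_finite_sums)
    show "(\<lambda>i. (cmod (Rep_ell2 f i))\<^sup>2) summable_on UNIV" using Rep_ell2[of f] by simp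
    show "(\<Sum>i\<in>F. (cmod (Rep_ell2 f i))\<^sup>2) \<le> C\<^sup>2" if "finite F" for F
      using assms[OF that] unfolding L2_set_def by (simp add: sqrt_le_D)
  qed
  ultimately show ?thesis
    unfolding norm_ell2.rep_eq by (simp add: real_le_lsqrt infsum_nonneg)
qed

lemma cmod_le_norm_ell2: "cmod (Rep_ell2 f i) \<le> norm f"
  using L2_set_le_norm_ell2[of f "{i}"] by simp

instance
proof
  fix f g :: "'a ell2" and c :: complex and r :: real
  show "dist f g = norm (f - g)" by (fact dist_ell2_def)
  show "sgn f = inverse (norm f) *\<^sub>R f" by (fact sgn_ell2_def)
  show "(uniformity :: ('a ell2 \<times> 'a ell2) filter) =
      (INF e\<in>{0<..}. principal {(f, g). dist f g < e})"
    by (fact uniformity_ell2_def)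
  show "open U \<longleftrightarrow> (\<forall>f\<in>U. \<forall>\<^sub>F (f', g) in uniformity. f' = f \<longrightarrow> g \<in> U)" for U :: "'a ell2 set"
    by (fact open_ell2_def)
  show "norm f = 0 \<longleftrightarrow> f = 0"
  proof
    assume "norm f = 0"
    then have "Rep_ell2 f i = 0" for i using cmod_le_norm_ell2[of f i] by simp
    then show "f = 0" by (auto simp: Rep_ell2_inject[symmetric] zero_ell2.rep_eq)
  qed (simp add: norm_ell2.rep_eq zero_ell2.rep_eq)
  show "norm (f + g) \<le> norm f + norm g"
  proof (rule norm_ell2_le)
    fix F :: "'a set"
    show "L2_set (\<lambda>i. cmod (Rep_ell2 (f + g) i)) F \<le> norm f + norm g"
      unfolding plus_ell2.rep_eq
      by (rule order_trans[OF L2_set_cmod_add_le add_mono]) (rule L2_set_le_norm_ell2)+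
  qed
  show *: "norm (c *\<^sub>C f) = cmod c * norm f" for c
    unfolding norm_ell2.rep_eq scaleC_ell2.rep_eq
    by (simp add: norm_mult power_mult_distrib infsum_cmult_right' real_sqrt_mult)
  show "norm (r *\<^sub>R f) = \<bar>r\<bar> * norm f"
    using *[of "complex_of_real r"] by (simp add: scaleC_of_real)
qed

end

instantiation ell2 :: (type) chilbert_space
begin

lift_definition cinner_ell2 :: "'i ell2 \<Rightarrow> 'i ell2 \<Rightarrow> complex" is
  "\<lambda>f g. \<Sum>\<^sub>\<infinity>i. cnj (f i) * g i" .

instance
proof
  fix f g h :: "'i ell2" and c :: complex
  have summ: "(\<lambda>i. cnj (Rep_ell2 f i) * Rep_ell2 g i) summable_on UNIV" for f g :: "'i ell2"
    using Rep_ell2[of f] Rep_ell2[of g] by (auto intro!: ell2_summable_inner)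
  show "cinner f g = cnj (cinner g f)"
    unfolding cinner_ell2.rep_eq infsum_cnj[symmetric] by (simp add: mult.commute)
  show "cinner f (g + h) = cinner f g + cinner f h"
    unfolding cinner_ell2.rep_eq plus_ell2.rep_eq ring_distribs by (intro infsum_add summ)
  show "cinner f (c *\<^sub>C g) = c * cinner f g"
    unfolding cinner_ell2.rep_eq scaleC_ell2.rep_eq mult.left_commute[of _ c]
    by (rule infsum_cmult_right')
  have "cinner f f = (\<Sum>\<^sub>\<infinity>i. complex_of_real ((cmod (Rep_ell2 f i))\<^sup>2))"
    unfolding cinner_ell2.rep_eq by (simp add: complex_norm_square[symmetric] mult.commute[of "cnj _"] del: of_real_power)
  also have "\<dots> = complex_of_real (\<Sum>\<^sub>\<infinity>i. (cmod (Rep_ell2 f i))\<^sup>2)"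
    using Rep_ell2[of f]
    by (intro infsumI has_sum_of_real has_sum_infsum) auto
  also have "\<dots> = complex_of_real ((norm f)\<^sup>2)"
    by (simp add: norm_ell2.rep_eq infsum_nonneg)
  finally show "cinner f f = complex_of_real ((norm f)\<^sup>2)" .
next
  fix X :: "nat \<Rightarrow> 'i ell2"
  assume X: "Cauchy X"
  have cmod_diff: "cmod (Rep_ell2 (X m) i - Rep_ell2 (X n) i) \<le> dist (X m) (X n)" for m n i
    using cmod_le_norm_ell2[of "X m - X n" i] by (simp add: dist_ell2_def minus_ell2.rep_eq)
  have "Cauchy (\<lambda>n. Rep_ell2 (X n) i)" for i
  proof (rule metric_CauchyI)
    fix e :: real assume "0 < e"
    then obtain M where "\<forall>m\<ge>M. \<forall>n\<ge>M. dist (X m) (X n) < e"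
      using metric_CauchyD[OF X] by blast
    then show "\<exists>M. \<forall>m\<ge>M. \<forall>n\<ge>M. dist (Rep_ell2 (X m) i) (Rep_ell2 (X n) i) < e"
      by (metis cmod_diff dist_norm order_le_less_trans)
  qed
  then have "\<forall>i. \<exists>l. (\<lambda>n. Rep_ell2 (X n) i) \<longlonglongrightarrow> l"
    using Cauchy_convergent_iff convergent_def by blast
  then obtain l where l: "\<And>i. (\<lambda>n. Rep_ell2 (X n) i) \<longlonglongrightarrow> l i"
    by metis
  have fin: "L2_set (\<lambda>i. cmod (Rep_ell2 (X m) i - l i)) F \<le> e"
    if M: "\<forall>n\<ge>M. dist (X m) (X n) \<le> e" for m M e F
  proof (rule tendsto_upperbound)
    show "(\<lambda>n. L2_set (\<lambda>i. cmod (Rep_ell2 (X m) i - Rep_ell2 (X n) i)) F)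
        \<longlonglongrightarrow> L2_set (\<lambda>i. cmod (Rep_ell2 (X m) i - l i)) F"
      unfolding L2_set_def by (intro tendsto_intros l)
    have "L2_set (\<lambda>i. cmod (Rep_ell2 (X m) i - Rep_ell2 (X n) i)) F \<le> e" if "n \<ge> M" for n
      using L2_set_le_norm_ell2[of "X m - X n" F] M that
      by (force simp: dist_ell2_def minus_ell2.rep_eq)
    then show "\<forall>\<^sub>F n in sequentially. L2_set (\<lambda>i. cmod (Rep_ell2 (X m) i - Rep_ell2 (X n) i)) F \<le> e"
      by (auto simp: eventually_sequentially)
  qed simp
  obtain M1 where M1: "\<forall>m\<ge>M1. \<forall>n\<ge>M1. dist (X m) (X n) < 1"
    using metric_CauchyD[OF X, of 1] by auto
  have "(\<lambda>i. (cmod (Rep_ell2 (X M1) i - l i))\<^sup>2) summable_on UNIV"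
    unfolding ell2_iff_L2_set_bounded
    using M1 by (intro exI[of _ 1] allI impI fin[of M1 M1]) (auto intro: less_imp_le)
  from ell2_summable_add[OF ell2_summable_mult[OF this, of "-1"], of "Rep_ell2 (X M1)"]
  have "(\<lambda>i. (cmod (l i))\<^sup>2) summable_on UNIV"
    using Rep_ell2[of "X M1"] by (simp add: algebra_simps)
  then have Rl: "Rep_ell2 (Abs_ell2 l) = l"
    by (simp add: Abs_ell2_inverse)
  have "X \<longlonglongrightarrow> Abs_ell2 l"
  proof (rule metric_LIMSEQ_I)
    fix e :: real assume "0 < e"
    then obtain M where M: "\<forall>m\<ge>M. \<forall>n\<ge>M. dist (X m) (X n) < e / 2"
      using metric_CauchyD[OF X, of "e / 2"] by auto
    have "norm (X m - Abs_ell2 l) \<le> e / 2" if "m \<ge> M" for m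
      using fin[of M m "e / 2"] M that
      by (intro norm_ell2_le) (auto simp: minus_ell2.rep_eq Rl less_imp_le)
    then show "\<exists>no. \<forall>n\<ge>no. dist (X n) (Abs_ell2 l) < e"
      using \<open>0 < e\<close> by (intro exI[of _ M]) (force simp: dist_ell2_def)
  qed
  then show "convergent X" by (auto simp: convergent_def)
qed

end

text \<open>Hilbert direct sum of subspaces \<open>K k\<close> of \<open>'i ell2\<close>, realised inside \<open>('k \<times> 'i) ell2\<close>.
  The function underlying \<open>direct_sum_op T f\<close> is square-summable whenever the \<open>T k\<close> are uniformly
  bounded, as is the case for *-representations evaluated at a fixed element.\<close>

definition component :: "'k \<Rightarrow> ('k \<times> 'i) ell2 \<Rightarrow> 'i ell2" where
  "component k f = Abs_ell2 (\<lambda>i. Rep_ell2 f (k, i))"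

definition direct_sum_space :: "('k \<Rightarrow> 'i ell2 set) \<Rightarrow> ('k \<times> 'i) ell2 set" where
  "direct_sum_space K = {f. \<forall>k. component k f \<in> K k}"

definition direct_sum_op ::
    "('k \<Rightarrow> 'i ell2 \<Rightarrow> 'i ell2) \<Rightarrow> ('k \<times> 'i) ell2 \<Rightarrow> ('k \<times> 'i) ell2" where
  "direct_sum_op T f = Abs_ell2 (\<lambda>(k, i). Rep_ell2 (T k (component k f)) i)"


section \<open>Tensor powers of \<open>M\<^sub>3(\<complex>)\<close> and \<open>UHF(3\<^sup>\<infinity>)\<close>\<close>

definition kron :: "complex mat \<Rightarrow> complex mat \<Rightarrow> complex mat" (infixr \<open>\<otimes>\<^sub>K\<close> 70) where
  "A \<otimes>\<^sub>K B = mat (dim_row A * dim_row B) (dim_col A * dim_col B)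
     (\<lambda>(i, j). A $$ (i div dim_row B, j div dim_col B) * B $$ (i mod dim_row B, j mod dim_col B))"

primrec kron_pow :: "complex mat \<Rightarrow> nat \<Rightarrow> complex mat" where
  "kron_pow A 0 = 1\<^sub>m 1"
| "kron_pow A (Suc n) = A \<otimes>\<^sub>K kron_pow A n"

text \<open>\<open>M\<^sub>3(\<complex>)\<^bsup>\<otimes>n\<^esup>\<close>, identified with the matrices of size \<open>3\<^sup>n\<close> via the Kronecker product.\<close>

abbreviation M3 :: "nat \<Rightarrow> complex mat set" where
  "M3 n \<equiv> carrier_mat (3 ^ n) (3 ^ n)"

text \<open>Matrix units with indices \<open>1, 2, 3\<close> read modulo 3; index \<open>i\<close> is row or column
  \<open>(i - 1) mod 3\<close> in the 0-based numbering of \<open>mat\<close>.\<close>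

definition munit :: "nat \<Rightarrow> nat \<Rightarrow> complex mat" where
  "munit i j = mat 3 3 (\<lambda>p. if p = ((i + 2) mod 3, (j + 2) mod 3) then 1 else 0)"

text \<open>\<open>\<iota> n\<close> embeds \<open>M\<^sub>3(\<complex>)\<^bsup>\<otimes>n\<^esup>\<close> into the inductive limit. An injective *-homomorphism of
  C*-algebras is isometric, so these conditions determine \<open>'a\<close> up to a *-isomorphism
  compatible with the embeddings.\<close>

definition is_UHF3 :: "(nat \<Rightarrow> complex mat \<Rightarrow> 'a::cstar_algebra) \<Rightarrow> bool" where
  "is_UHF3 \<iota> \<longleftrightarrow>
     (\<forall>n. inj_on (\<iota> n) (M3 n) \<and> \<iota> n (1\<^sub>m (3 ^ n)) = 1 \<and>
        (\<forall>x\<in>M3 n. \<forall>y\<in>M3 n. \<iota> n (x + y) = \<iota> n x + \<iota> n y \<and> \<iota> n (x * y) = \<iota> n x * \<iota> n y) \<and>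
        (\<forall>x\<in>M3 n. \<forall>c. \<iota> n (c \<cdot>\<^sub>m x) = c *\<^sub>C \<iota> n x) \<and>
        (\<forall>x\<in>M3 n. \<iota> n (mat_adjoint x) = star (\<iota> n x)) \<and>
        (\<forall>x\<in>M3 n. \<iota> (Suc n) (x \<otimes>\<^sub>K 1\<^sub>m 3) = \<iota> n x)) \<and>
     closure (\<Union>n. \<iota> n ` M3 n) = UNIV"


section \<open>The algebra \<open>\<A>\<^sub>\<infinity>\<close>\<close>

definition alpha :: "nat \<Rightarrow> nat \<Rightarrow> complex mat" where
  "alpha n j = munit j j \<otimes>\<^sub>K kron_pow (munit 2 2) n"

definition beta :: "nat \<Rightarrow> nat \<Rightarrow> complex mat" where
  "beta k j = (munit j j \<otimes>\<^sub>K munit 1 1 + munit (j + 2) (j + 2) \<otimes>\<^sub>K munit 3 3)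
                \<otimes>\<^sub>K kron_pow (munit 2 2) (k - 1)"

definition A_fin :: "(nat \<Rightarrow> complex mat \<Rightarrow> 'a::cstar_algebra) \<Rightarrow> nat \<Rightarrow> 'a set" where
  "A_fin \<iota> n = cspan (\<iota> (n + 1) `
     ({alpha n j | j. j \<in> {1..3}} \<union>
      {x \<otimes>\<^sub>K beta k j | x k j. j \<in> {1..3} \<and> k \<in> {1..n} \<and> x \<in> M3 (n - k)}))"

definition A_inf :: "(nat \<Rightarrow> complex mat \<Rightarrow> 'a::cstar_algebra) \<Rightarrow> 'a set" where
  "A_inf \<iota> = {a. \<exists>X. (\<forall>n. X n \<in> A_fin \<iota> n) \<and> X \<longlonglongrightarrow> a}"


section \<open>The representations \<open>\<rho>\<^sub>m\<close> and \<open>\<rho>\<^sub>\<infinity>\<close>\<close>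

text \<open>\<open>id \<otimes> \<phi>\<close> on the last tensor factor, where \<open>\<phi>\<close> is the state \<open>x \<mapsto> x\<^sub>2\<^sub>2\<close>
  (0-based entry \<open>(1, 1)\<close>).\<close>

definition slice_last :: "complex mat \<Rightarrow> complex mat" where
  "slice_last x = mat (dim_row x div 3) (dim_col x div 3) (\<lambda>(i, j). x $$ (3 * i + 1, 3 * j + 1))"

text \<open>The continuous extension to the inductive limit of the maps
  \<open>slice_last ^^ k : M\<^sub>3(\<complex>)\<^bsup>\<otimes>(m+1+k)\<^esup> \<rightarrow> M\<^sub>3(\<complex>)\<^bsup>\<otimes>(m+1)\<^esup>\<close>, taken entrywise: every
  element of the limit is approximated by some sequence \<open>X\<close> as below, and the limit of the
  entries does not depend on \<open>X\<close> because the slice maps are contractive.\<close>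

definition slice :: "(nat \<Rightarrow> complex mat \<Rightarrow> 'a::cstar_algebra) \<Rightarrow> nat \<Rightarrow> 'a \<Rightarrow> complex mat" where
  "slice \<iota> m a = mat (3 ^ (m + 1)) (3 ^ (m + 1)) (\<lambda>(i, j). THE z. \<exists>X.
     (\<forall>k. X k \<in> M3 (m + 1 + k)) \<and> (\<lambda>k. \<iota> (m + 1 + k) (X k)) \<longlonglongrightarrow> a \<and>
     (\<lambda>k. (slice_last ^^ k) (X k) $$ (i, j)) \<longlonglongrightarrow> z)"

text \<open>\<open>(\<complex>\<^sup>3)\<^bsup>\<otimes>(m+1)\<^esup>\<close>, as the vectors supported on the first \<open>3\<^bsup>m+1\<^esup>\<close> coordinates.\<close>

definition rho_space :: "nat \<Rightarrow> nat ell2 set" where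
  "rho_space m = {f. \<forall>i\<ge>3 ^ (m + 1). Rep_ell2 f i = 0}"

definition rho ::
    "(nat \<Rightarrow> complex mat \<Rightarrow> 'a::cstar_algebra) \<Rightarrow> nat \<Rightarrow> 'a \<Rightarrow> nat ell2 \<Rightarrow> nat ell2" where
  "rho \<iota> m a f = Abs_ell2 (\<lambda>i. if i < 3 ^ (m + 1)
     then (slice \<iota> m a *\<^sub>v vec (3 ^ (m + 1)) (Rep_ell2 f)) $ i else 0)"

definition rho_inf_space :: "(nat \<times> nat) ell2 set" where
  "rho_inf_space = direct_sum_space rho_space"

definition rho_inf ::
    "(nat \<Rightarrow> complex mat \<Rightarrow> 'a::cstar_algebra) \<Rightarrow> 'a \<Rightarrow> (nat \<times> nat) ell2 \<Rightarrow> (nat \<times> nat) ell2" where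
  "rho_inf \<iota> a = direct_sum_op (\<lambda>m. rho \<iota> m a)"

end

theory Submission
  imports Defs "HOL-Analysis.Elementary_Metric_Spaces"
begin

text \<open>An element of \<open>\<A>\<^sub>\<infinity>\<close> killed by \<open>\<rho>\<^sub>n\<close> is a limit of elements of \<open>\<A>\<^sub>n\<^sub>+\<^sub>k\<close> with vanishing slice, and
  such elements form a left module over \<open>M\<^sub>3(\<complex>)\<^bsup>\<otimes>n\<^esup>\<close>. Hence \<open>M\<^sub>3(\<complex>)\<^bsup>\<otimes>n\<^esup>\<close> multiplies every ideal
  \<open>I\<^sub>m = ker \<rho>\<^sub>m\<close> of \<open>\<A>\<^sub>\<infinity>\<close> with \<open>m \<ge> n\<close>. If \<open>\<pi>\<close> is orthogonal to \<open>\<rho>\<^sub>m\<close> then \<open>\<pi>\<close> is nondegenerate on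
  \<open>I\<^sub>m\<close>, because the orthogonal complement of \<open>\<pi>(I\<^sub>m)H\<close> carries a representation of the finite-dimensional
  algebra \<open>\<rho>\<^sub>m(\<A>\<^sub>\<infinity>)\<close> and would, if nonzero, be intertwined with \<open>\<rho>\<^sub>m\<close> by a Casimir element. So \<open>\<pi>\<close> extends
  canonically from the \<open>I\<^sub>m\<close> to their multipliers, thus to \<open>\<Union>\<^sub>n M\<^sub>3(\<complex>)\<^bsup>\<otimes>n\<^esup>\<close>, and by continuity to the
  whole UHF algebra. The extension is built from \<open>\<pi>\<close> alone, so it is unique and commutes with everything
  that commutes with \<open>\<pi>(\<A>\<^sub>\<infinity>)\<close>; it is faithful because the C*-norm on each \<open>M\<^sub>3(\<complex>)\<^bsup>\<otimes>n\<^esup>\<close> is unique.\<close>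

section \<open>Hilbert spaces\<close>

text \<open>The obstacle is that x \<mapsto> x \<otimes> 1 does not carry A_n into A_(n+1): the A_n
  are not nested, and the matrix algebras do not multiply A_inf into itself. What a left factor x
  from n tensor factors destroys in A_(n+k) is only the part seen by \<rho>_n, namely alpha^(n+k)_j
  and y \<otimes> beta^l_j with l > k, whose coefficient y has fewer than n tensor factors. The
  generators with l \<le> k absorb x into y, and they span the kernel of the slice to level n. As n
  grows, more matrices act, but on smaller ideals, so the extension is assembled along the whole
  decreasing sequence. The second difficulty is quantitative: neither \<open>star_rep\<close> nor
  \<open>is_UHF3\<close> assumes contractivity of anything. Every norm bound is drawn from the
  C*-identity. A square root of 1 - y* y among the multipliers bounds the extension; projections
  have norm 0 or 1, which gives the norms of padded matrices and hence the contractivity of the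
  slices; and the norm of a self-adjoint element is multiplicative on squares, which gives
  faithfulness.\<close>

lemma bounded_linear_continuous_on: "bounded_linear f \<Longrightarrow> continuous_on S f"
  by (rule bounded_linear.continuous_on[OF _ continuous_on_id])

lemma Cauchy_dominated:
  fixes f :: "nat \<Rightarrow> 'a::real_normed_vector" and g :: "nat \<Rightarrow> 'b::real_normed_vector"
  assumes "Cauchy f" "\<And>m n. norm (g m - g n) \<le> norm (f m - f n) * K"
  shows "Cauchy g"
proof (rule metric_CauchyI)
  fix e :: real assume e: "0 < e"
  have K: "0 < \<bar>K\<bar> + 1" by simp
  then obtain M where M: "\<And>m n. m \<ge> M \<Longrightarrow> n \<ge> M \<Longrightarrow> norm (f m - f n) < e / (\<bar>K\<bar> + 1)"
    using metric_CauchyD[OF assms(1), of "e / (\<bar>K\<bar> + 1)"] e by (auto simp: dist_norm)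
  have "dist (g m) (g n) < e" if "m \<ge> M" "n \<ge> M" for m n
  proof -
    have "norm (g m - g n) \<le> norm (f m - f n) * (\<bar>K\<bar> + 1)"
      by (rule order_trans[OF assms(2)]) (intro mult_left_mono, auto)
    also have "\<dots> < (e / (\<bar>K\<bar> + 1)) * (\<bar>K\<bar> + 1)"
      using M[OF that] K by (rule mult_strict_right_mono)
    also have "\<dots> = e" using K by simp
    finally show ?thesis by (simp add: dist_norm)
  qed
  then show "\<exists>M. \<forall>m\<ge>M. \<forall>n\<ge>M. dist (g m) (g n) < e" by blast
qed

lemma norm_le_null:
  assumes "\<And>k. norm (f k) \<le> g k" "(g \<longlongrightarrow> 0) F"
  shows "(f \<longlongrightarrow> (0::'b::real_normed_vector)) F"
  by (rule tendsto_norm_zero_cancel, rule tendsto_sandwich[OF _ _ tendsto_const assms(2)])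
    (auto simp: assms(1))

lemma bounded_clinear_scaleC: "bounded_clinear T \<Longrightarrow> T (c *\<^sub>C x) = c *\<^sub>C T x"
  by (simp add: bounded_clinear_def)

lemma bounded_clinear_imp_bounded_linear: "bounded_clinear T \<Longrightarrow> bounded_linear T"
  by (simp add: bounded_clinear_def)

lemma bounded_clinear_bound: "bounded_clinear T \<Longrightarrow> \<exists>K. \<forall>x. norm (T x) \<le> norm x * K"
  unfolding bounded_clinear_def by (meson bounded_linear.bounded)

lemma bounded_clinear_add: "bounded_clinear T \<Longrightarrow> T (x + y) = T x + T y"
  by (metis bounded_clinear_imp_bounded_linear bounded_linear.linear linear_add)

lemma bounded_clinear_diff: "bounded_clinear T \<Longrightarrow> T (x - y) = T x - T y"
  by (metis bounded_clinear_imp_bounded_linear bounded_linear.linear linear_diff)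

lemma bounded_clinear_zero: "bounded_clinear T \<Longrightarrow> T 0 = 0"
  by (metis bounded_clinear_imp_bounded_linear bounded_linear.linear linear_0)

lemma bounded_clinear_tendsto: "bounded_clinear T \<Longrightarrow> (f \<longlongrightarrow> l) F \<Longrightarrow> ((\<lambda>n. T (f n)) \<longlongrightarrow> T l) F"
  by (metis bounded_clinear_imp_bounded_linear bounded_linear.tendsto)

lemma bounded_clinearI:
  assumes "\<And>x y. T (x + y) = T x + T y" "\<And>c x. T (c *\<^sub>C x) = c *\<^sub>C T x"
    and "\<And>x. norm (T x) \<le> K * norm x"
  shows "bounded_clinear T"
  unfolding bounded_clinear_def using assms
  by (auto intro!: bounded_linear_intro[where K = K] simp: mult.commute simp flip: scaleC_of_real)

context
  fixes x y z :: "'h::chilbert_space"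
begin

lemma cinner_add_left: "cinner (x + y) z = cinner x z + cinner y z"
  by (metis cinner_add_right cinner_commute complex_cnj_add)

lemma cinner_scaleC_left: "cinner (c *\<^sub>C x) y = cnj c * cinner x y"
  by (metis cinner_commute cinner_scaleC_right complex_cnj_mult)

lemma cinner_minus_right: "cinner x (- y) = - cinner x y"
  using cinner_scaleC_right[of x "-1" y] by simp

lemma cinner_minus_left: "cinner (- x) y = - cinner x y"
  using cinner_scaleC_left[of "-1"] by simp

lemma cinner_diff_right: "cinner x (y - z) = cinner x y - cinner x z"
  using cinner_add_right[of x y "-z"] cinner_scaleC_right[of x "-1" z] by simp

lemma cinner_zero_right [simp]: "cinner x 0 = 0"
  using cinner_scaleC_right[of x 0] by simp

lemma cinner_zero_left [simp]: "cinner 0 x = 0"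
  by (metis cinner_commute cinner_zero_right complex_cnj_zero)

end

lemma cinner_diff_left: "cinner (x - y) z = cinner x z - cinner y (z::'h::chilbert_space)"
  using cinner_add_left[of x "-y" z] by (simp add: cinner_minus_left)

lemma cinner_sum_right: "cinner x (sum f I) = (\<Sum>i\<in>I. cinner x (f i :: 'h::chilbert_space))"
  by (induction I rule: infinite_finite_induct) (auto simp: cinner_add_right)

lemma cinner_sum_left: "cinner (sum f I) x = (\<Sum>i\<in>I. cinner (f i) (x :: 'h::chilbert_space))"
  by (induction I rule: infinite_finite_induct) (auto simp: cinner_add_left)

lemma norm_diff_square:
  fixes x y :: "'h::chilbert_space"
  shows "(norm (x - y))\<^sup>2 = (norm x)\<^sup>2 + (norm y)\<^sup>2 - 2 * Re (cinner x y)"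
proof -
  have "complex_of_real ((norm (x - y))\<^sup>2) = cinner (x - y) (x - y)"
    by (simp only: cinner_self)
  also have "\<dots> = cinner x x + cinner y y - (cinner x y + cnj (cinner x y))"
    by (simp add: cinner_diff_left cinner_diff_right cinner_commute[of y x])
  finally have "Re (complex_of_real ((norm (x - y))\<^sup>2))
      = Re (cinner x x + cinner y y - (cinner x y + cnj (cinner x y)))" by simp
  then show ?thesis by (simp add: cinner_self)
qed

lemma cauchy_schwarz: "cmod (cinner x y) \<le> norm x * norm (y :: 'h::chilbert_space)"
proof (cases "x = 0")
  case False
  define c where "c = cinner x y / complex_of_real ((norm x)\<^sup>2)"
  have nx: "norm x > 0" using False by simp
  have "0 \<le> (norm (y - c *\<^sub>C x))\<^sup>2" by simp
  also have "\<dots> = (norm y)\<^sup>2 + (cmod c * norm x)\<^sup>2 - 2 * Re (c * cinner y x)"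
    by (simp add: norm_diff_square norm_scaleC cinner_scaleC_right)
  also have "c * cinner y x = complex_of_real ((cmod (cinner x y))\<^sup>2 / (norm x)\<^sup>2)"
    unfolding c_def cinner_commute[of y x] by (simp add: complex_norm_square del: of_real_power)
  also have "(cmod c * norm x)\<^sup>2 = (cmod (cinner x y))\<^sup>2 / (norm x)\<^sup>2"
  proof -
    have "cmod c = cmod (cinner x y) / (norm x)\<^sup>2" by (simp add: c_def norm_divide norm_power)
    then show ?thesis using nx by (simp add: power2_eq_square field_simps)
  qed
  finally have "(cmod (cinner x y))\<^sup>2 / (norm x)\<^sup>2 \<le> (norm y)\<^sup>2" by simp
  then have "(cmod (cinner x y))\<^sup>2 \<le> (norm x * norm y)\<^sup>2"
    using nx by (simp add: pos_divide_le_eq power_mult_distrib mult.commute)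
  then show ?thesis by (rule power2_le_imp_le) simp
qed simp

lemma bounded_linear_cinner: "bounded_linear (cinner (x::'h::chilbert_space))"
proof (rule bounded_linear_intro[where K = "norm x"])
  fix y :: 'h and r :: real
  show "cinner x (r *\<^sub>R y) = r *\<^sub>R cinner x y"
    by (simp add: cinner_scaleC_right scaleR_conv_of_real flip: scaleC_of_real)
qed (auto simp: cinner_add_right mult.commute intro: order_trans[OF cauchy_schwarz])

lemma tendsto_cinner_right:
  "(f \<longlongrightarrow> l) F \<Longrightarrow> ((\<lambda>n. cinner x (f n)) \<longlongrightarrow> cinner (x::'h::chilbert_space) l) F"
  by (rule bounded_linear.tendsto[OF bounded_linear_cinner])

lemma closed_orthogonal: "closed {y. cinner (x::'h::chilbert_space) y = 0}"
proof -
  have "closed (cinner x -` {0})"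
    by (rule closed_vimage) (auto intro: bounded_linear_continuous_on bounded_linear_cinner)
  then show ?thesis by (simp add: vimage_def)
qed

lemma subspace_orthogonal: "complex_vector.subspace {y. cinner (x::'h::chilbert_space) y = 0}"
  by (auto simp: complex_vector.subspace_def cinner_add_right cinner_scaleC_right)

lemma dense_span_orthogonal_eq_0:
  assumes "closure (cspan S) = UNIV" "\<And>y. y \<in> S \<Longrightarrow> cinner x y = 0"
  shows "(x::'h::chilbert_space) = 0"
proof -
  have "cspan S \<subseteq> {y. cinner x y = 0}"
    using assms(2) by (intro complex_vector.span_minimal subspace_orthogonal) auto
  then have "closure (cspan S) \<subseteq> {y. cinner x y = 0}"
    by (intro closure_minimal closed_orthogonal)
  then have "cinner x x = 0" using assms(1) by auto
  then show ?thesis by (simp add: cinner_self)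
qed

section \<open>Nearest points and orthogonal vectors\<close>

lemma parallelogram:
  fixes x y :: "'h::chilbert_space"
  shows "(norm (x + y))\<^sup>2 + (norm (x - y))\<^sup>2 = 2 * (norm x)\<^sup>2 + 2 * (norm y)\<^sup>2"
  using norm_diff_square[of x "-y"] norm_diff_square[of x y] by (simp add: cinner_minus_right)

lemma nearest_point_exists:
  fixes M :: "'h::chilbert_space set"
  assumes M: "complex_vector.subspace M" "closed M"
  obtains m where "m \<in> M" "\<And>m'. m' \<in> M \<Longrightarrow> norm (x - m) \<le> norm (x - m')"
proof -
  have ne: "M \<noteq> {}" using complex_vector.subspace_0[OF M(1)] by auto
  define d where "d = infdist x M"
  have d: "d \<le> norm (x - m)" if "m \<in> M" for m
    using infdist_le[OF that, of x] by (simp add: d_def dist_norm)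
  have d0: "0 \<le> d" unfolding d_def by (rule infdist_nonneg)
  have "\<exists>m\<in>M. norm (x - m) < d + 1 / Suc n" for n
  proof (rule ccontr)
    assume "\<not> (\<exists>m\<in>M. norm (x - m) < d + 1 / Suc n)"
    then have "d + 1 / Suc n \<le> d"
      unfolding d_def infdist_notempty[OF ne] by (intro cINF_greatest[OF ne]) (auto simp: dist_norm not_less)
    then show False by simp
  qed
  then obtain f where f: "\<And>n. f n \<in> M" "\<And>n. norm (x - f n) < d + 1 / Suc n" by metis
  have lim: "(\<lambda>n. d + 1 / Suc n) \<longlonglongrightarrow> d"
    using tendsto_add[OF tendsto_const[of d] LIMSEQ_inverse_real_of_nat] by (simp add: inverse_eq_divide)
  have key: "(norm (f m - f n))\<^sup>2 \<le> 2 * (d + 1 / Suc m)\<^sup>2 + 2 * (d + 1 / Suc n)\<^sup>2 - 4 * d\<^sup>2" for m n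
  proof -
    let ?c = "(1/2) *\<^sub>R (f m + f n)"
    have "?c \<in> M"
      using M(1) f(1) by (metis complex_vector.subspace_def scaleC_of_real)
    then have "d\<^sup>2 \<le> (norm (x - ?c))\<^sup>2" using d d0 by (intro power_mono) auto
    moreover have "(x - f m) + (x - f n) = (2::real) *\<^sub>R (x - ?c)"
      by (simp add: algebra_simps scaleR_2)
    then have "(norm ((x - f m) + (x - f n)))\<^sup>2 = 4 * (norm (x - ?c))\<^sup>2"
      by (simp add: power_mult_distrib)
    moreover have "(norm (x - f m))\<^sup>2 \<le> (d + 1 / Suc m)\<^sup>2" "(norm (x - f n))\<^sup>2 \<le> (d + 1 / Suc n)\<^sup>2"
      by (intro power_mono less_imp_le[OF f(2)] norm_ge_zero)+
    moreover have "norm ((x - f m) - (x - f n)) = norm (f m - f n)"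
      by (simp add: norm_minus_commute)
    ultimately show ?thesis using parallelogram[of "x - f m" "x - f n"] by simp
  qed
  have "Cauchy f"
  proof (rule metric_CauchyI)
    fix e :: real assume e: "0 < e"
    have "(\<lambda>n. 4 * ((d + 1 / Suc n)\<^sup>2 - d\<^sup>2)) \<longlonglongrightarrow> 4 * (d\<^sup>2 - d\<^sup>2)"
      by (intro tendsto_intros lim)
    then have "\<forall>\<^sub>F n in sequentially. 4 * ((d + 1 / Suc n)\<^sup>2 - d\<^sup>2) < e\<^sup>2"
      using e by (intro order_tendstoD(2)) auto
    then obtain N where N: "4 * ((d + 1 / Suc n)\<^sup>2 - d\<^sup>2) < e\<^sup>2" if "n \<ge> N" for n
      by (auto simp: eventually_sequentially)
    show "\<exists>N. \<forall>m\<ge>N. \<forall>n\<ge>N. dist (f m) (f n) < e"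
    proof (intro exI[of _ N] allI impI)
      fix m n assume "m \<ge> N" "n \<ge> N"
      then have "(norm (f m - f n))\<^sup>2 < e\<^sup>2" using key[of m n] N[of m] N[of n] by simp
      then show "dist (f m) (f n) < e" using e power2_less_imp_less[of "norm (f m - f n)" e] by (simp add: dist_norm)
    qed
  qed
  then obtain m where m: "f \<longlonglongrightarrow> m" using Cauchy_convergent convergent_def by blast
  have "norm (x - m) \<le> d"
  proof (rule LIMSEQ_le)
    show "(\<lambda>n. norm (x - f n)) \<longlonglongrightarrow> norm (x - m)" by (intro tendsto_intros m)
    show "\<exists>N. \<forall>n\<ge>N. norm (x - f n) \<le> d + 1 / Suc n" using f(2) less_imp_le by blast
  qed (rule lim)
  then show ?thesis
    using closed_sequentially[OF M(2) _ m] f(1) d by (intro that[of m]) (auto intro: order_trans)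
qed

lemma orthogonal_vector_exists:
  fixes M :: "'h::chilbert_space set"
  assumes M: "complex_vector.subspace M" "closed M" "M \<noteq> UNIV"
  obtains z where "z \<noteq> 0" "\<And>m. m \<in> M \<Longrightarrow> cinner z m = 0"
proof -
  obtain x where x: "x \<notin> M" using M(3) by auto
  obtain m where m: "m \<in> M" "\<And>m'. m' \<in> M \<Longrightarrow> norm (x - m) \<le> norm (x - m')"
    using nearest_point_exists[OF M(1,2)] by blast
  define z where "z = x - m"
  have "cinner z v = 0" if v: "v \<in> M" for v
  proof (cases "v = 0")
    case False
    define c where "c = cinner v z / complex_of_real ((norm v)\<^sup>2)"
    have nv: "norm v > 0" using False by simp
    have "m + c *\<^sub>C v \<in> M" using M(1) m(1) v by (simp add: complex_vector.subspace_def)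
    from m(2)[OF this] have "(norm z)\<^sup>2 \<le> (norm (z - c *\<^sub>C v))\<^sup>2"
      by (intro power_mono) (auto simp: z_def algebra_simps)
    also have "\<dots> = (norm z)\<^sup>2 + (cmod c * norm v)\<^sup>2 - 2 * Re (c * cinner z v)"
      by (simp add: norm_diff_square norm_scaleC cinner_scaleC_right)
    also have "c * cinner z v = complex_of_real ((cmod (cinner v z))\<^sup>2 / (norm v)\<^sup>2)"
      unfolding c_def cinner_commute[of z v] by (simp add: complex_norm_square del: of_real_power)
    also have "(cmod c * norm v)\<^sup>2 = (cmod (cinner v z))\<^sup>2 / (norm v)\<^sup>2"
    proof -
    have "cmod c = cmod (cinner v z) / (norm v)\<^sup>2" by (simp add: c_def norm_divide norm_power)
    then show ?thesis using nv by (simp add: power2_eq_square field_simps)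
  qed
    finally have "(cmod (cinner v z))\<^sup>2 / (norm v)\<^sup>2 \<le> 0" by simp
    then have "cmod (cinner v z) = 0" using nv by (simp add: divide_le_0_iff)
    then show ?thesis by (metis cinner_commute complex_cnj_zero norm_eq_zero)
  qed simp
  moreover have "z \<noteq> 0" using x m(1) by (auto simp: z_def)
  ultimately show ?thesis using that by blast
qed

lemma subspace_closure:
  fixes M :: "'h::complex_normed_vector set"
  assumes "complex_vector.subspace M"
  shows "complex_vector.subspace (closure M)"
proof (rule complex_vector.subspaceI)
  show "0 \<in> closure M"
    using complex_vector.subspace_0[OF assms] closure_subset by blast
next
  fix x y assume "x \<in> closure M" "y \<in> closure M"
  then obtain f g where "\<forall>n. f n \<in> M" "f \<longlonglongrightarrow> x" "\<forall>n. g n \<in> M" "g \<longlonglongrightarrow> y"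
    unfolding closure_sequential by blast
  then show "x + y \<in> closure M"
    using assms unfolding closure_sequential complex_vector.subspace_def
    by (intro exI[of _ "\<lambda>n. f n + g n"]) (auto intro: tendsto_add)
next
  fix c x assume "x \<in> closure M"
  then obtain f where f: "\<forall>n. f n \<in> M" "f \<longlonglongrightarrow> x"
    unfolding closure_sequential by blast
  have "bounded_linear (\<lambda>y. c *\<^sub>C (y::'h))"
    by (rule bounded_linear_intro[where K = "cmod c"])
      (simp_all add: scaleC_add_right norm_scaleC scaleC_scaleC mult.commute flip: scaleC_of_real)
  then show "c *\<^sub>C x \<in> closure M"
    using assms f unfolding closure_sequential complex_vector.subspace_def
    by (intro exI[of _ "\<lambda>n. c *\<^sub>C f n"]) (auto intro: bounded_linear.tendsto)
qed

section \<open>C*-algebras\<close>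

lemma norm_star [simp]: "norm (star (x::'a::cstar_algebra)) = norm x"
proof -
  have *: "norm y \<le> norm (star y)" for y :: 'a
  proof (cases "y = 0")
    case False
    have "norm y * norm y \<le> norm (star y) * norm y"
      using norm_star_mult_self[of y] norm_mult_ineq[of "star y" y] by (simp add: power2_eq_square)
    then show ?thesis using False by simp
  qed simp
  show ?thesis using *[of x] *[of "star x"] by (simp add: star_star)
qed

lemma star_0 [simp]: "star (0::'a::cstar_algebra) = 0"
  by (metis norm_star norm_zero norm_eq_zero)

lemma star_1 [simp]: "star (1::'a::cstar_algebra) = 1"
  by (metis star_star star_mult mult_1_left mult_1_right)

lemma star_minus: "star (- x) = - star (x::'a::cstar_algebra)"
  using star_scaleC[of "-1" x] by simp

lemma star_diff: "star (x - y) = star x - star (y::'a::cstar_algebra)"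
  using star_add[of x "-y"] by (simp add: star_minus)

lemma star_scaleR: "star (r *\<^sub>R x) = r *\<^sub>R star (x::'a::cstar_algebra)"
  using star_scaleC[of "complex_of_real r" x] by (simp add: scaleC_of_real)

lemma bounded_linear_star: "bounded_linear (star :: 'a::cstar_algebra \<Rightarrow> 'a)"
  by (rule bounded_linear_intro[where K = 1]) (auto simp: star_add star_scaleR)

lemma tendsto_star: "(f \<longlongrightarrow> l) F \<Longrightarrow> ((\<lambda>n. star (f n)) \<longlongrightarrow> star (l::'a::cstar_algebra)) F"
  by (rule bounded_linear.tendsto[OF bounded_linear_star])

lemma tendsto_scaleC: "(f \<longlongrightarrow> l) F \<Longrightarrow> ((\<lambda>n. c *\<^sub>C f n) \<longlongrightarrow> c *\<^sub>C (l::'a::complex_normed_vector)) F"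
proof -
  have "bounded_linear (\<lambda>y. c *\<^sub>C (y::'a))"
    by (rule bounded_linear_intro[where K = "cmod c"])
      (simp_all add: scaleC_add_right norm_scaleC scaleC_scaleC mult.commute flip: scaleC_of_real)
  then show "(f \<longlongrightarrow> l) F \<Longrightarrow> ?thesis" by (rule bounded_linear.tendsto)
qed

text \<open>No unit is required, so that closed ideals qualify as well as
  \<open>A_inf \<iota>\<close> and the whole algebra.\<close>

definition cstar_subalgebra :: "'a::cstar_algebra set \<Rightarrow> bool" where
  "cstar_subalgebra A \<longleftrightarrow> complex_vector.subspace A \<and> closed A \<and>
     (\<forall>x\<in>A. \<forall>y\<in>A. x * y \<in> A) \<and> (\<forall>x\<in>A. star x \<in> A)"

lemma
  assumes "cstar_subalgebra A"
  shows cstar_subalgebra_0: "0 \<in> A"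
    and cstar_subalgebra_add: "x \<in> A \<Longrightarrow> y \<in> A \<Longrightarrow> x + y \<in> A"
    and cstar_subalgebra_diff: "x \<in> A \<Longrightarrow> y \<in> A \<Longrightarrow> x - y \<in> A"
    and cstar_subalgebra_scaleC: "x \<in> A \<Longrightarrow> c *\<^sub>C x \<in> A"
    and cstar_subalgebra_scaleR: "x \<in> A \<Longrightarrow> r *\<^sub>R x \<in> A"
    and cstar_subalgebra_mult: "x \<in> A \<Longrightarrow> y \<in> A \<Longrightarrow> x * y \<in> A"
    and cstar_subalgebra_star: "x \<in> A \<Longrightarrow> star x \<in> A"
    and cstar_subalgebra_closed: "closed A"
  using assms complex_vector.subspace_diff[of A] complex_vector.subspace_scale[of A x "complex_of_real r"]
  unfolding cstar_subalgebra_def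
  by (auto simp: complex_vector.subspace_def scaleC_of_real)

lemma cstar_subalgebra_sum: "cstar_subalgebra A \<Longrightarrow> (\<And>i. i \<in> I \<Longrightarrow> f i \<in> A) \<Longrightarrow> sum f I \<in> A"
  unfolding cstar_subalgebra_def by (blast intro: complex_vector.subspace_sum)

text \<open>The square root is \<open>1 - w\<close> for the fixed point \<open>w\<close> of the contraction
  \<open>w \<mapsto> (a + w\<^sup>2) / 2\<close>, where \<open>a = star y * y\<close>.\<close>

lemma sqrt_one_minus_exists:
  fixes y :: "'a::cstar_algebra"
  assumes A: "cstar_subalgebra A" "1 \<in> A" and y: "y \<in> A" "norm y < 1"
  obtains s where "s \<in> A" "star s = s" "s * s = 1 - star y * y"
proof -
  define a where "a = star y * y"
  define r where "r = norm a"
  have r: "0 \<le> r" "r < 1"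
    using y(2) power_strict_mono[of "norm y" 1 2] by (auto simp: r_def a_def norm_star_mult_self)
  define f where "f = (\<lambda>w. (1/2) *\<^sub>R (a + w * w))"
  \<comment> \<open>A set that the contraction maps into itself. It is closed, so the fixed point is
    again a self-adjoint element of \<open>A\<close>, and its radius r < 1 is also the Lipschitz
    constant of f on it.\<close>
  define S where "S = A \<inter> {w. star w = w} \<inter> cball 0 r"
  have aA: "a \<in> A" "star a = a"
    using A y by (auto simp: a_def star_mult star_star cstar_subalgebra_mult cstar_subalgebra_star)
  have "closed {w::'a. star w = w}"
    by (intro closed_Collect_eq bounded_linear_continuous_on bounded_linear_star continuous_on_id)
  then have "closed S" unfolding S_def
    using cstar_subalgebra_closed[OF A(1)] by (intro closed_Int) auto
  then have cS: "complete S" by (simp add: complete_eq_closed)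
  have "0 \<in> S" using A r by (auto simp: S_def cstar_subalgebra_0)
  then have ne: "S \<noteq> {}" by auto
  have fS: "f ` S \<subseteq> S"
  proof
    fix z assume "z \<in> f ` S"
    then obtain w where w: "w \<in> A" "star w = w" "norm w \<le> r" "z = f w"
      by (auto simp: S_def)
    have "norm (a + w * w) \<le> r + norm w * norm w"
      unfolding r_def by (rule norm_triangle_le[OF add_left_mono[OF norm_mult_ineq]])
    also have "\<dots> \<le> r + r * 1" using w(3) r by (intro add_left_mono mult_mono) auto
    finally have "norm (f w) \<le> r" by (simp add: f_def)
    then show "z \<in> S"
      using A w aA unfolding S_def f_def
      by (auto simp: star_scaleR star_add star_mult cstar_subalgebra_scaleR cstar_subalgebra_add cstar_subalgebra_mult)
  qed
  have lip: "dist (f w) (f z) \<le> r * dist w z" if "w \<in> S" "z \<in> S" for w z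
  proof -
    have "f w - f z = (1/2) *\<^sub>R (w * (w - z) + (w - z) * z)"
      by (simp add: f_def algebra_simps)
    then have "norm (f w - f z) \<le> (norm w * norm (w - z) + norm (w - z) * norm z) / 2"
      by (simp add: norm_triangle_le[OF add_mono[OF norm_mult_ineq norm_mult_ineq]])
    also have "\<dots> \<le> (r * norm (w - z) + norm (w - z) * r) / 2"
      using that by (intro divide_right_mono add_mono mult_right_mono mult_left_mono) (auto simp: S_def)
    finally show ?thesis by (simp add: dist_norm mult.commute)
  qed
  obtain w where w: "w \<in> S" "f w = w"
    using Banach_fix[OF cS ne r fS lip] by blast
  have "a + w * w = (2::real) *\<^sub>R w"
    using arg_cong[OF w(2), of "\<lambda>v. 2 *\<^sub>R v"] by (simp add: f_def)
  then have "(1 - w) * (1 - w) = 1 - a"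
    by (simp add: algebra_simps scaleR_2)
  then show ?thesis
    using w(1) A by (intro that[of "1 - w"])
      (auto simp: S_def a_def star_diff intro: cstar_subalgebra_diff)
qed

section \<open>Extending a representation of an ideal to its multipliers\<close>

text \<open>One-sided conditions suffice: if J is closed under \<open>star\<close>, then i * y =
  star (star y * star i) gives multiplication from the right. Asking for \<open>star y\<close> as
  well makes the set itself closed under \<open>star\<close>.\<close>

definition multipliers :: "'a::cstar_algebra set \<Rightarrow> 'a set" where
  "multipliers J = {y. \<forall>i\<in>J. y * i \<in> J \<and> star y * i \<in> J}"

lemma multipliersD:
  assumes "cstar_subalgebra J" "y \<in> multipliers J" "i \<in> J"
  shows "y * i \<in> J" "star y * i \<in> J" "i * y \<in> J"
proof -
  show "y * i \<in> J" "star y * i \<in> J" using assms by (auto simp: multipliers_def)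
  have "star (star y * star i) \<in> J"
    using assms by (auto simp: multipliers_def cstar_subalgebra_star)
  then show "i * y \<in> J" by (simp add: star_mult star_star)
qed

lemma cstar_subalgebra_multipliers:
  assumes "cstar_subalgebra J"
  shows "cstar_subalgebra (multipliers J)"
proof -
  have "closed (multipliers J)"
  proof (unfold closed_sequential_limits, intro allI impI, elim conjE)
    fix f l assume f: "\<forall>n. f n \<in> multipliers J" "f \<longlonglongrightarrow> l"
    show "l \<in> multipliers J"
      unfolding multipliers_def
    proof (intro CollectI ballI conjI)
      fix i assume i: "i \<in> J"
      show "l * i \<in> J"
        using f i by (intro closed_sequentially[OF cstar_subalgebra_closed[OF assms] _ tendsto_mult_right[OF f(2)]])
          (auto simp: multipliers_def)
      show "star l * i \<in> J"
        using f i by (intro closed_sequentially[OF cstar_subalgebra_closed[OF assms] _ tendsto_mult_right[OF tendsto_star[OF f(2)]]])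
          (auto simp: multipliers_def)
    qed
  qed
  moreover have "complex_vector.subspace (multipliers J)"
    using assms unfolding multipliers_def
    by (auto simp: complex_vector.subspace_def star_add star_scaleC distrib_right mult_scaleC_left
        cstar_subalgebra_0 cstar_subalgebra_add cstar_subalgebra_scaleC)
  moreover have "x * y \<in> multipliers J" if "x \<in> multipliers J" "y \<in> multipliers J" for x y
    using that by (auto simp: multipliers_def star_mult mult.assoc)
  moreover have "star x \<in> multipliers J" if "x \<in> multipliers J" for x
    using that by (auto simp: multipliers_def star_star)
  ultimately show ?thesis by (auto simp: cstar_subalgebra_def)
qed

lemma one_in_multipliers: "1 \<in> multipliers J"
  by (auto simp: multipliers_def)

section \<open>Rules for representations of a *-subalgebra\<close>

lemma
  assumes "star_rep A \<pi>"
  shows star_rep_nonzero: "\<exists>x::'h::chilbert_space. x \<noteq> 0"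
    and star_rep_bounded: "a \<in> A \<Longrightarrow> bounded_clinear (\<pi> a)"
    and star_rep_add: "a \<in> A \<Longrightarrow> b \<in> A \<Longrightarrow> \<pi> (a + b) x = \<pi> a x + \<pi> b x"
    and star_rep_scaleC: "a \<in> A \<Longrightarrow> \<pi> (c *\<^sub>C a) x = c *\<^sub>C \<pi> a x"
    and star_rep_mult: "a \<in> A \<Longrightarrow> b \<in> A \<Longrightarrow> \<pi> (a * b) x = \<pi> a (\<pi> b x)"
    and star_rep_adjoint: "a \<in> A \<Longrightarrow> cinner (\<pi> (star a) x) y = cinner x (\<pi> a y)"
    and star_rep_nondegenerate: "closure (cspan {\<pi> a x | a x. a \<in> A}) = (UNIV :: 'h set)"
  using assms unfolding star_rep_def by auto

lemma star_rep_diff: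
  assumes "star_rep A \<pi>" "cstar_subalgebra A" "a \<in> A" "b \<in> A"
  shows "\<pi> (a - b) x = \<pi> a x - \<pi> b x"
  using star_rep_add[OF assms(1), of "a - b" b x] assms by (simp add: cstar_subalgebra_diff)

lemma star_rep_sum:
  assumes "star_rep A \<pi>" "cstar_subalgebra A" "\<And>i. i \<in> I \<Longrightarrow> f i \<in> A" "finite I"
  shows "\<pi> (sum f I) x = (\<Sum>i\<in>I. \<pi> (f i) x)"
  using assms(4,3)
proof (induction I rule: finite_induct)
  case empty
  have "\<pi> (0 *\<^sub>C 0) x = 0 *\<^sub>C \<pi> 0 x"
    using assms by (intro star_rep_scaleC) (auto simp: cstar_subalgebra_0)
  then show ?case by simp
next
  case (insert i I)
  then show ?case using assms by (simp add: star_rep_add cstar_subalgebra_sum)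
qed

text \<open>Nondegeneracy in dual form: as J is closed under \<open>star\<close>, a vector killed by
  J is orthogonal to every \<open>\<pi> a x\<close>. This makes the extension unique.\<close>

lemma separating:
  assumes "star_rep J \<pi>" "cstar_subalgebra J" "\<And>i. i \<in> J \<Longrightarrow> \<pi> i z = 0"
  shows "z = 0"
proof (rule dense_span_orthogonal_eq_0[OF star_rep_nondegenerate[OF assms(1)]])
  fix y assume "y \<in> {\<pi> a x |a x. a \<in> J}"
  then obtain a x where y: "a \<in> J" "y = \<pi> a x" by auto
  have "cinner (\<pi> (star a) z) x = cinner z (\<pi> a x)"
    using assms y by (intro star_rep_adjoint) auto
  then show "cinner z y = 0" using assms y by (simp add: cstar_subalgebra_star)
qed

text \<open>Writing \<open>1 - star y * y = s * s\<close>, the difference of the squared norms is the squared norm of \<open>\<Sum>t\<in>F. \<pi> (s * i t) (x t)\<close>.\<close>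

lemma multiplier_norm_le_aux:
  fixes \<pi> :: "'a::cstar_algebra \<Rightarrow> 'h::chilbert_space \<Rightarrow> 'h"
  assumes \<pi>: "star_rep J \<pi>" and J: "cstar_subalgebra J" and y: "y \<in> multipliers J" "norm y < 1"
    and i: "\<And>t. t \<in> F \<Longrightarrow> i t \<in> J"
  shows "norm (\<Sum>t\<in>F. \<pi> (y * i t) (x t)) \<le> norm (\<Sum>t\<in>F. \<pi> (i t) (x t))"
proof -
  obtain s where s: "s \<in> multipliers J" "star s = s" "s * s = 1 - star y * y"
    using sqrt_one_minus_exists[OF cstar_subalgebra_multipliers[OF J] one_in_multipliers y] by blast
  \<comment> \<open>Only star z * z enters the Gram matrix, and it is absorbed by the elements of J
    on both sides, so that \<pi> is evaluated on J alone. It is applied to z = 1, y and s.\<close>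
  have gram: "cinner (\<Sum>t\<in>F. \<pi> (z * i t) (x t)) (\<Sum>t\<in>F. \<pi> (z * i t) (x t))
      = (\<Sum>t\<in>F. \<Sum>u\<in>F. cinner (x t) (\<pi> (star (i t) * (star z * z * i u)) (x u)))"
    if z: "z \<in> multipliers J" for z
    unfolding cinner_sum_left unfolding cinner_sum_right
  proof (intro sum.cong refl)
    fix t u assume tu: "t \<in> F" "u \<in> F"
    have J': "z * i t \<in> J" "z * i u \<in> J" using tu i z J multipliersD by blast+
    have "cinner (\<pi> (z * i t) (x t)) (\<pi> (z * i u) (x u))
        = cinner (x t) (\<pi> (star (z * i t)) (\<pi> (z * i u) (x u)))"
      using star_rep_adjoint[OF \<pi>, of "star (z * i t)"] J' J by (simp add: star_star cstar_subalgebra_star)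
    also have "\<pi> (star (z * i t)) (\<pi> (z * i u) (x u)) = \<pi> (star (z * i t) * (z * i u)) (x u)"
      using star_rep_mult[OF \<pi>] J' J by (simp add: cstar_subalgebra_star)
    finally show "cinner (\<pi> (z * i t) (x t)) (\<pi> (z * i u) (x u))
        = cinner (x t) (\<pi> (star (i t) * (star z * z * i u)) (x u))"
      by (simp add: star_mult mult.assoc)
  qed
  have "cinner (x t) (\<pi> (star (i t) * (star 1 * 1 * i u)) (x u))
      - cinner (x t) (\<pi> (star (i t) * (star y * y * i u)) (x u))
      = cinner (x t) (\<pi> (star (i t) * (star s * s * i u)) (x u))" if tu: "t \<in> F" "u \<in> F" for t u
  proof -
    have "star (i t) * i u \<in> J" "star (i t) * (star y * y * i u) \<in> J"
      using tu i J y multipliersD[OF J, of y] by (auto simp: mult.assoc cstar_subalgebra_mult cstar_subalgebra_star)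
    then have "\<pi> (star (i t) * i u - star (i t) * (star y * y * i u)) (x u)
        = \<pi> (star (i t) * i u) (x u) - \<pi> (star (i t) * (star y * y * i u)) (x u)"
      by (intro star_rep_diff[OF \<pi> J])
    moreover have "star (i t) * i u - star (i t) * (star y * y * i u) = star (i t) * (star s * s * i u)"
      by (simp add: s algebra_simps)
    ultimately show ?thesis by (simp add: cinner_diff_right)
  qed
  then have "cinner (\<Sum>t\<in>F. \<pi> (1 * i t) (x t)) (\<Sum>t\<in>F. \<pi> (1 * i t) (x t))
      - cinner (\<Sum>t\<in>F. \<pi> (y * i t) (x t)) (\<Sum>t\<in>F. \<pi> (y * i t) (x t))
      = cinner (\<Sum>t\<in>F. \<pi> (s * i t) (x t)) (\<Sum>t\<in>F. \<pi> (s * i t) (x t))"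
    by (simp only: gram[OF one_in_multipliers] gram[OF y(1)] gram[OF s(1)] flip: sum_subtractf)
       (auto intro!: sum.cong)
  then have "complex_of_real ((norm (\<Sum>t\<in>F. \<pi> (i t) (x t)))\<^sup>2)
      = complex_of_real ((norm (\<Sum>t\<in>F. \<pi> (y * i t) (x t)))\<^sup>2 + (norm (\<Sum>t\<in>F. \<pi> (s * i t) (x t)))\<^sup>2)"
    by (simp add: cinner_self algebra_simps)
  then have "(norm (\<Sum>t\<in>F. \<pi> (i t) (x t)))\<^sup>2
      = (norm (\<Sum>t\<in>F. \<pi> (y * i t) (x t)))\<^sup>2 + (norm (\<Sum>t\<in>F. \<pi> (s * i t) (x t)))\<^sup>2"
    by (simp only: of_real_eq_iff)
  then have "(norm (\<Sum>t\<in>F. \<pi> (y * i t) (x t)))\<^sup>2 \<le> (norm (\<Sum>t\<in>F. \<pi> (i t) (x t)))\<^sup>2" by simp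
  then show ?thesis by (rule power2_le_imp_le) simp
qed

lemma multiplier_norm_le:
  fixes \<pi> :: "'a::cstar_algebra \<Rightarrow> 'h::chilbert_space \<Rightarrow> 'h"
  assumes \<pi>: "star_rep J \<pi>" and J: "cstar_subalgebra J" and y: "y \<in> multipliers J"
    and i: "\<And>t. t \<in> F \<Longrightarrow> i t \<in> J"
  shows "norm (\<Sum>t\<in>F. \<pi> (y * i t) (x t)) \<le> norm y * norm (\<Sum>t\<in>F. \<pi> (i t) (x t))"
proof (rule field_le_epsilon)
  fix e :: real assume e: "e > 0"
  define n where "n = norm (\<Sum>t\<in>F. \<pi> (i t) (x t))"
  \<comment> \<open>Slightly more than norm y, so that y / K falls under the strict bound of
    \<open>multiplier_norm_le_aux\<close>. The denominator n + 1 keeps the error e * n / (n + 1)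
    below e and is nonzero even for n = 0.\<close>
  define K where "K = norm y + e / (n + 1)"
  have n: "n \<ge> 0" by (simp add: n_def)
  have K: "K > norm y" "K > 0"
    using e n by (auto simp: K_def intro!: add_nonneg_pos divide_pos_pos)
  have y': "(1 / K) *\<^sub>R y \<in> multipliers J" "norm ((1 / K) *\<^sub>R y) < 1"
    using y K cstar_subalgebra_multipliers[OF J] by (auto intro: cstar_subalgebra_scaleR)
  have "(\<Sum>t\<in>F. \<pi> (((1 / K) *\<^sub>R y) * i t) (x t)) = (\<Sum>t\<in>F. complex_of_real (1 / K) *\<^sub>C \<pi> (y * i t) (x t))"
    using star_rep_scaleC[OF \<pi>, of "y * i _" "complex_of_real (1 / K)"] i multipliersD(1)[OF J y]
    by (intro sum.cong refl) (simp add: mult_scaleC_left flip: scaleC_of_real)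
  also have "\<dots> = (1 / K) *\<^sub>R (\<Sum>t\<in>F. \<pi> (y * i t) (x t))"
    by (simp only: scaleC_of_real scaleR_sum_right)
  finally have "norm (\<Sum>t\<in>F. \<pi> (y * i t) (x t)) / K \<le> n"
    using multiplier_norm_le_aux[where F = F and i = i and x = x, OF \<pi> J y' i] K by (simp add: n_def)
  then have "norm (\<Sum>t\<in>F. \<pi> (y * i t) (x t)) \<le> K * n" using K by (simp add: pos_divide_le_eq mult.commute)
  also have "K * n \<le> norm y * n + e"
    using e n by (simp add: K_def distrib_right) (simp add: field_simps)
  finally show "norm (\<Sum>t\<in>F. \<pi> (y * i t) (x t)) \<le> norm y * norm (\<Sum>t\<in>F. \<pi> (i t) (x t)) + e"
    by (simp add: n_def)
qed

text \<open>Here h is the prospective value of the extension at y on z. Pairing h with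
  \<open>\<pi> i w\<close> moves star y onto i, and \<open>multiplier_norm_le\<close> for star y
  then bounds the functional given by h on a dense subspace. Testing it on approximations of h
  itself gives the claim.\<close>

lemma multiplier_image_norm_le:
  fixes \<pi> :: "'a::cstar_algebra \<Rightarrow> 'h::chilbert_space \<Rightarrow> 'h"
  assumes \<pi>: "star_rep J \<pi>" and J: "cstar_subalgebra J" and y: "y \<in> multipliers J"
    and h: "\<And>i. i \<in> J \<Longrightarrow> \<pi> i h = \<pi> (i * y) z"
  shows "norm h \<le> norm y * norm z"
proof -
  have sy: "star y \<in> multipliers J"
    using cstar_subalgebra_star[OF cstar_subalgebra_multipliers[OF J] y] .
  have bound: "cmod (cinner h v) \<le> norm z * (norm y * norm v)"
    if v: "v \<in> cspan {\<pi> a x | a x. a \<in> J}" for v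
  proof -
    obtain t r where t: "finite t" "t \<subseteq> {\<pi> a x | a x. a \<in> J}" "v = (\<Sum>a\<in>t. r a *\<^sub>C a)"
      using v unfolding complex_vector.span_explicit by blast
    then have "\<forall>a\<in>t. \<exists>i x. i \<in> J \<and> a = \<pi> i x" by blast
    then obtain i x where ix: "\<And>a. a \<in> t \<Longrightarrow> i a \<in> J" "\<And>a. a \<in> t \<Longrightarrow> a = \<pi> (i a) (x a)" by metis
    have "v = (\<Sum>a\<in>t. \<pi> (i a) (r a *\<^sub>C x a))"
      unfolding t(3) using ix star_rep_bounded[OF \<pi>]
      by (intro sum.cong refl) (metis bounded_clinear_scaleC)
    moreover have "cinner h (\<pi> (i a) w) = cinner z (\<pi> (star y * i a) w)" if "a \<in> t" for a w
    proof -
      have a: "star (i a) \<in> J" "star y * i a \<in> J"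
        using ix(1)[OF that] J y by (auto simp: cstar_subalgebra_star multipliersD)
      have "cinner h (\<pi> (i a) w) = cinner (\<pi> (star (i a)) h) w"
        using star_rep_adjoint[OF \<pi> ix(1)[OF that]] by simp
      also have "\<dots> = cinner (\<pi> (star (star y * i a)) z) w"
        using h[OF a(1)] by (simp add: star_mult star_star)
      also have "\<dots> = cinner z (\<pi> (star y * i a) w)"
        using star_rep_adjoint[OF \<pi> a(2)] by simp
      finally show ?thesis .
    qed
    ultimately have "cinner h v = cinner z (\<Sum>a\<in>t. \<pi> (star y * i a) (r a *\<^sub>C x a))"
      and "norm (\<Sum>a\<in>t. \<pi> (star y * i a) (r a *\<^sub>C x a)) \<le> norm y * norm v"
      using multiplier_norm_le[OF \<pi> J sy, of t i "\<lambda>a. r a *\<^sub>C x a"] ix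
      by (simp_all add: cinner_sum_right)
    then show ?thesis
      using cauchy_schwarz[of z "\<Sum>a\<in>t. \<pi> (star y * i a) (r a *\<^sub>C x a)"]
        mult_left_mono[of _ _ "norm z"] by (metis norm_ge_zero order_trans)
  qed
  have "h \<in> closure (cspan {\<pi> a x | a x. a \<in> J})"
    using star_rep_nondegenerate[OF \<pi>] by simp
  then obtain f where f: "\<And>n. f n \<in> cspan {\<pi> a x | a x. a \<in> J}" "f \<longlonglongrightarrow> h"
    unfolding closure_sequential by blast
  have "cmod (cinner h h) \<le> norm z * (norm y * norm h)"
    by (rule LIMSEQ_le[OF tendsto_norm[OF tendsto_cinner_right[OF f(2)]]
          tendsto_mult_left[OF tendsto_mult_left[OF tendsto_norm[OF f(2)]]]])
       (use bound f in blast)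
  then have "norm h * norm h \<le> (norm y * norm z) * norm h"
    by (simp add: cinner_self norm_power power2_eq_square algebra_simps norm_mult)
  then show ?thesis by (cases "h = 0") auto
qed

text \<open>On \<open>\<pi> a x\<close> the value has to be \<open>\<pi> (y * a) x\<close>. Instead
  of checking that this is well defined on the span, one collects in D all z that possess an image:
  D is a subspace, and it is closed because \<open>multiplier_image_norm_le\<close> turns
  convergence of the z into Cauchy convergence of the images.\<close>

lemma multiplier_image_exists:
  fixes \<pi> :: "'a::cstar_algebra \<Rightarrow> 'h::chilbert_space \<Rightarrow> 'h"
  assumes \<pi>: "star_rep J \<pi>" and J: "cstar_subalgebra J" and y: "y \<in> multipliers J"
  shows "\<exists>h. \<forall>i\<in>J. \<pi> i h = \<pi> (i * y) z"
proof -
  define D where "D = {z. \<exists>h. \<forall>i\<in>J. \<pi> i h = \<pi> (i * y) z}"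
  have iy: "i * y \<in> J" if "i \<in> J" for i using multipliersD(3)[OF J y that] .
  note b = star_rep_bounded[OF \<pi>]
  have "complex_vector.subspace D"
  proof (rule complex_vector.subspaceI)
    show "0 \<in> D" unfolding D_def
      using bounded_clinear_zero[OF b] iy by (intro CollectI exI[of _ 0]) metis
  next
    fix z w assume "z \<in> D" "w \<in> D"
    then obtain h k where "\<forall>i\<in>J. \<pi> i h = \<pi> (i * y) z" "\<forall>i\<in>J. \<pi> i k = \<pi> (i * y) w"
      by (auto simp: D_def)
    then show "z + w \<in> D" unfolding D_def
      using bounded_clinear_add[OF b] iy by (intro CollectI exI[of _ "h + k"]) metis
  next
    fix c z assume "z \<in> D"
    then obtain h where "\<forall>i\<in>J. \<pi> i h = \<pi> (i * y) z" by (auto simp: D_def)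
    then show "c *\<^sub>C z \<in> D" unfolding D_def
      using bounded_clinear_scaleC[OF b] iy by (intro CollectI exI[of _ "c *\<^sub>C h"]) metis
  qed
  moreover have "{\<pi> a x | a x. a \<in> J} \<subseteq> D"
  proof
    fix z assume "z \<in> {\<pi> a x | a x. a \<in> J}"
    then obtain a x where a: "a \<in> J" "z = \<pi> a x" by auto
    have "\<pi> i (\<pi> (y * a) x) = \<pi> (i * y) z" if "i \<in> J" for i
      using star_rep_mult[OF \<pi>, of i "y * a"] star_rep_mult[OF \<pi>, of "i * y" a]
        that a iy multipliersD(1)[OF J y] by (simp add: mult.assoc)
    then show "z \<in> D" by (auto simp: D_def)
  qed
  ultimately have "cspan {\<pi> a x | a x. a \<in> J} \<subseteq> D"
    by (intro complex_vector.span_minimal)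
  moreover have "closed D"
  proof (unfold closed_sequential_limits, intro allI impI, elim conjE)
    fix f l assume f: "\<forall>n. f n \<in> D" "f \<longlonglongrightarrow> l"
    then obtain g where g: "\<And>n i. i \<in> J \<Longrightarrow> \<pi> i (g n) = \<pi> (i * y) (f n)"
      unfolding D_def by (auto, metis)
    have "norm (g m - g n) \<le> norm (f m - f n) * norm y" for m n
      using multiplier_image_norm_le[OF \<pi> J y, of "g m - g n" "f m - f n"] g
      by (simp add: bounded_clinear_diff[OF b] iy mult.commute)
    then have "Cauchy g" by (rule Cauchy_dominated[OF LIMSEQ_imp_Cauchy[OF f(2)]])
    then obtain h where h: "g \<longlonglongrightarrow> h" using Cauchy_convergent convergent_def by blast
    have "\<pi> i h = \<pi> (i * y) l" if i: "i \<in> J" for i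
      using LIMSEQ_unique[OF bounded_clinear_tendsto[OF b[OF i] h]]
        bounded_clinear_tendsto[OF b[OF iy[OF i]] f(2)] g[OF i] by simp
    then show "l \<in> D" by (auto simp: D_def)
  qed
  ultimately have "closure (cspan {\<pi> a x | a x. a \<in> J}) \<subseteq> D" by (intro closure_minimal)
  then show ?thesis using star_rep_nondegenerate[OF \<pi>] by (auto simp: D_def)
qed

lemma star_rep_subset:
  assumes "star_rep A \<pi>" "J \<subseteq> A" "closure (cspan {\<pi> a x | a x. a \<in> J}) = (UNIV :: 'h::chilbert_space set)"
  shows "star_rep J (\<pi> :: 'a::cstar_algebra \<Rightarrow> 'h \<Rightarrow> 'h)"
  unfolding star_rep_def
  using assms(3) star_rep_nonzero[OF assms(1)] star_rep_bounded[OF assms(1)] star_rep_add[OF assms(1)]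
    star_rep_scaleC[OF assms(1)] star_rep_mult[OF assms(1)] star_rep_adjoint[OF assms(1)]
  by (intro conjI ballI allI) (simp_all add: subsetD[OF assms(2)])

text \<open>An element is only asked to multiply \<open>J n\<close> for all large n, since the
  matrices with n tensor factors multiply the ideals from level n on. Density concerns all these
  elements together, not one multiplier algebra.\<close>

locale multiplier_tower =
  fixes A :: "'a::cstar_algebra set" and J :: "nat \<Rightarrow> 'a set"
    and \<pi> :: "'a \<Rightarrow> 'h::chilbert_space \<Rightarrow> 'h"
  assumes rep: "star_rep A \<pi>"
    and subalgebra: "cstar_subalgebra (J n)"
    and decreasing: "decseq J"
    and ideal: "J n \<subseteq> A" "A \<subseteq> multipliers (J n)"
    and nondegenerate: "closure (cspan {\<pi> a x | a x. a \<in> J n}) = (UNIV :: 'h set)"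
    and dense: "closure {y. \<forall>\<^sub>F n in sequentially. y \<in> multipliers (J n)} = UNIV"
begin

definition V :: "'a set" where
  "V = {y. \<forall>\<^sub>F n in sequentially. y \<in> multipliers (J n)}"

text \<open>The extension in implicit form: h is described by what the ideals see of it. Identities
  for \<open>act\<close> are verified after applying \<open>\<pi> i\<close>, where they become
  identities of \<pi> on J, and \<open>acts_unique\<close> lifts them back.\<close>

definition acts :: "'a \<Rightarrow> 'h \<Rightarrow> 'h \<Rightarrow> bool" where
  "acts y z h \<longleftrightarrow> (\<forall>\<^sub>F n in sequentially. \<forall>i\<in>J n. \<pi> i h = \<pi> (i * y) z)"

definition act :: "'a \<Rightarrow> 'h \<Rightarrow> 'h" where
  "act y z = (THE h. acts y z h)"

text \<open>The choice of the sequence is immaterial: by \<open>act_norm_le\<close>, two sequences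
  in \<open>V\<close> with the same limit give images with the same limit, see
  \<open>tendsto_ext\<close>.\<close>

definition ext :: "'a \<Rightarrow> 'h \<Rightarrow> 'h" where
  "ext y z = lim (\<lambda>k. act ((SOME f. (\<forall>k. f k \<in> V) \<and> f \<longlonglongrightarrow> y) k) z)"

lemma rep_J: "star_rep (J n) \<pi>"
  by (rule star_rep_subset[OF rep ideal(1) nondegenerate])

lemma mult_J: "y \<in> multipliers (J n) \<Longrightarrow> i \<in> J n \<Longrightarrow> i * y \<in> J n"
  "y \<in> multipliers (J n) \<Longrightarrow> i \<in> J n \<Longrightarrow> y * i \<in> J n"
  using multipliersD[OF subalgebra] by blast+

lemma bounded_J: "i \<in> J n \<Longrightarrow> bounded_clinear (\<pi> i)"
  by (rule star_rep_bounded[OF rep_J])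

lemma acts_unique:
  assumes "acts y z h" "acts y z k"
  shows "h = k"
proof -
  have "\<forall>\<^sub>F n in sequentially. \<forall>i\<in>J n. \<pi> i h = \<pi> i k"
    using assms unfolding acts_def by eventually_elim simp
  then obtain n where "\<forall>i\<in>J n. \<pi> i h = \<pi> i k" by (auto simp: eventually_sequentially)
  then have "\<And>i. i \<in> J n \<Longrightarrow> \<pi> i (h - k) = 0"
    by (simp add: bounded_clinear_diff[OF bounded_J])
  then have "h - k = 0" by (rule separating[OF rep_J subalgebra])
  then show ?thesis by simp
qed

lemma act_eq: "acts y z h \<Longrightarrow> act y z = h"
  unfolding act_def by (rule the_equality, assumption) (rule acts_unique)

lemma acts_act:
  assumes "y \<in> V"
  shows "acts y z (act y z)"
proof -
  obtain n where n: "y \<in> multipliers (J n)"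
    using assms by (auto simp: V_def eventually_sequentially)
  obtain h where "\<forall>i\<in>J n. \<pi> i h = \<pi> (i * y) z"
    using multiplier_image_exists[OF rep_J subalgebra n] by blast
  \<comment> \<open>What holds on \<open>J n\<close> holds on the smaller ideals after it, so a
    single n suffices.\<close>
  then have "acts y z h"
    unfolding acts_def eventually_sequentially
    by (intro exI[of _ n]) (use decseqD[OF decreasing] in fast)
  then show ?thesis using act_eq by simp
qed

lemma act_norm_le:
  assumes "y \<in> V"
  shows "norm (act y z) \<le> norm y * norm z"
proof -
  have "\<forall>\<^sub>F n in sequentially. y \<in> multipliers (J n) \<and> (\<forall>i\<in>J n. \<pi> i (act y z) = \<pi> (i * y) z)"
    using assms acts_act[OF assms] unfolding V_def acts_def by (simp add: eventually_conj)
  then obtain n where "y \<in> multipliers (J n)" "\<forall>i\<in>J n. \<pi> i (act y z) = \<pi> (i * y) z"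
    by (auto simp: eventually_sequentially)
  then show ?thesis by (intro multiplier_image_norm_le[OF rep_J subalgebra]) auto
qed

section \<open>The *-algebra \<open>V\<close> and its action\<close>

lemma V_add: "x \<in> V \<Longrightarrow> y \<in> V \<Longrightarrow> x + y \<in> V"
  unfolding V_def mem_Collect_eq
  by (erule (1) eventually_elim2) (rule cstar_subalgebra_add[OF cstar_subalgebra_multipliers[OF subalgebra]])

lemma V_diff: "x \<in> V \<Longrightarrow> y \<in> V \<Longrightarrow> x - y \<in> V"
  unfolding V_def mem_Collect_eq
  by (erule (1) eventually_elim2) (rule cstar_subalgebra_diff[OF cstar_subalgebra_multipliers[OF subalgebra]])

lemma V_mult: "x \<in> V \<Longrightarrow> y \<in> V \<Longrightarrow> x * y \<in> V"
  unfolding V_def mem_Collect_eq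
  by (erule (1) eventually_elim2) (rule cstar_subalgebra_mult[OF cstar_subalgebra_multipliers[OF subalgebra]])

lemma V_scaleC: "x \<in> V \<Longrightarrow> c *\<^sub>C x \<in> V"
  unfolding V_def mem_Collect_eq
  by (erule eventually_mono) (rule cstar_subalgebra_scaleC[OF cstar_subalgebra_multipliers[OF subalgebra]])

lemma V_star: "x \<in> V \<Longrightarrow> star x \<in> V"
  unfolding V_def mem_Collect_eq
  by (erule eventually_mono) (rule cstar_subalgebra_star[OF cstar_subalgebra_multipliers[OF subalgebra]])

lemma act_add: "x \<in> V \<Longrightarrow> y \<in> V \<Longrightarrow> act (x + y) z = act x z + act y z"
proof (rule act_eq)
  assume xy: "x \<in> V" "y \<in> V"
  show "acts (x + y) z (act x z + act y z)"
    using acts_act[OF xy(1), of z] acts_act[OF xy(2), of z] xy unfolding acts_def V_def mem_Collect_eq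
  proof eventually_elim
    case (elim n)
    then show ?case
      by (auto simp: bounded_clinear_add[OF bounded_J] distrib_left star_rep_add[OF rep_J[of n]] mult_J)
  qed
qed

lemma act_scaleC: "y \<in> V \<Longrightarrow> act (c *\<^sub>C y) z = c *\<^sub>C act y z"
proof (rule act_eq)
  assume y: "y \<in> V"
  show "acts (c *\<^sub>C y) z (c *\<^sub>C act y z)"
    using acts_act[OF y, of z] y unfolding acts_def V_def mem_Collect_eq
  proof eventually_elim
    case (elim n)
    then show ?case
      by (auto simp: bounded_clinear_scaleC[OF bounded_J] mult_scaleC_right star_rep_scaleC[OF rep_J[of n]] mult_J)
  qed
qed

lemma act_diff: "x \<in> V \<Longrightarrow> y \<in> V \<Longrightarrow> act (x - y) z = act x z - act y z"
  using act_add[of x "-y" z] V_scaleC[of y "-1"] act_scaleC[of y "-1" z] by simp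

lemma act_mult: "x \<in> V \<Longrightarrow> y \<in> V \<Longrightarrow> act (x * y) z = act x (act y z)"
proof (rule act_eq)
  assume xy: "x \<in> V" "y \<in> V"
  show "acts (x * y) z (act x (act y z))"
    using acts_act[OF xy(1), of "act y z"] acts_act[OF xy(2), of z] xy unfolding acts_def V_def mem_Collect_eq
  proof eventually_elim
    case (elim n)
    then show ?case by (metis mult.assoc mult_J(1))
  qed
qed

lemma act_add_right: "y \<in> V \<Longrightarrow> act y (z + w) = act y z + act y w"
proof (rule act_eq)
  assume y: "y \<in> V"
  show "acts y (z + w) (act y z + act y w)"
    using acts_act[OF y, of z] acts_act[OF y, of w] y unfolding acts_def V_def mem_Collect_eq
  proof eventually_elim
    case (elim n)
    then show ?case by (metis bounded_clinear_add[OF bounded_J] mult_J(1))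
  qed
qed

lemma act_scaleC_right: "y \<in> V \<Longrightarrow> act y (c *\<^sub>C z) = c *\<^sub>C act y z"
proof (rule act_eq)
  assume y: "y \<in> V"
  show "acts y (c *\<^sub>C z) (c *\<^sub>C act y z)"
    using acts_act[OF y, of z] y unfolding acts_def V_def mem_Collect_eq
  proof eventually_elim
    case (elim n)
    then show ?case by (metis bounded_clinear_scaleC[OF bounded_J] mult_J(1))
  qed
qed

lemma bounded_act: "y \<in> V \<Longrightarrow> bounded_clinear (act y)"
  by (rule bounded_clinearI) (auto intro: act_add_right act_scaleC_right act_norm_le)

text \<open>For w of the form \<open>\<pi> i x\<close> the factor i is moved to the left as star i,
  multiplied with star y inside J, and moved back as y * i. Both sides are linear and continuous in
  w, so nondegeneracy of \<open>J n\<close> extends this to all w.\<close>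

lemma act_adjoint:
  assumes y: "y \<in> V"
  shows "cinner (act (star y) z) w = cinner z (act y w)"
proof -
  have "\<forall>\<^sub>F n in sequentially. y \<in> multipliers (J n) \<and> (\<forall>i\<in>J n. \<pi> i (act (star y) z) = \<pi> (i * star y) z)
      \<and> (\<forall>i\<in>J n. \<pi> i (act y w) = \<pi> (i * y) w)"
    using y acts_act[OF y, of w] acts_act[OF V_star[OF y], of z] unfolding V_def acts_def by (simp add: eventually_conj)
  then obtain n where n: "y \<in> multipliers (J n)" "\<And>i. i \<in> J n \<Longrightarrow> \<pi> i (act (star y) z) = \<pi> (i * star y) z"
    "\<And>i. i \<in> J n \<Longrightarrow> \<pi> i (act y w) = \<pi> (i * y) w"
    by (auto simp: eventually_sequentially)
  have base: "cinner (act (star y) z) (\<pi> i x) = cinner z (act y (\<pi> i x))" if i: "i \<in> J n" for i x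
  proof -
    have i': "star i \<in> J n" "y * i \<in> J n" "star (y * i) \<in> J n"
      using i mult_J(2)[OF n(1) i] by (simp_all add: cstar_subalgebra_star[OF subalgebra])
    have "cinner (act (star y) z) (\<pi> i x) = cinner (\<pi> (star i) (act (star y) z)) x"
      using star_rep_adjoint[OF rep_J i] by simp
    also have "\<dots> = cinner (\<pi> (star (y * i)) z) x"
      using n(2)[OF i'(1)] by (simp add: star_mult)
    also have "\<dots> = cinner z (\<pi> (y * i) x)"
      by (rule star_rep_adjoint[OF rep_J i'(2)])
    also have "\<pi> (y * i) x = act y (\<pi> i x)"
    proof (rule act_eq[symmetric])
      show "acts y (\<pi> i x) (\<pi> (y * i) x)"
        using y unfolding acts_def V_def mem_Collect_eq
      proof eventually_elim
        case (elim m)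
        show ?case
        proof
          fix j assume j: "j \<in> J m"
          have jA: "j \<in> A" "j * y \<in> A" "i \<in> A" "y * i \<in> A"
            using ideal(1) i i'(2) j elim mult_J by blast+
          show "\<pi> j (\<pi> (y * i) x) = \<pi> (j * y) (\<pi> i x)"
            using star_rep_mult[OF rep jA(1,4), of x] star_rep_mult[OF rep jA(2,3), of x]
            by (simp add: mult.assoc)
        qed
      qed
    qed
    finally show ?thesis .
  qed
  have "w \<in> closure (cspan {\<pi> a x | a x. a \<in> J n})" using nondegenerate by simp
  then have "w \<in> {w. cinner (act (star y) z) w - cinner z (act y w) = 0}"
  proof (rule rev_subsetD, intro closure_minimal complex_vector.span_minimal)
    show "complex_vector.subspace {w. cinner (act (star y) z) w - cinner z (act y w) = 0}"
      using bounded_act[OF y]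
      by (auto simp: complex_vector.subspace_def bounded_clinear_add bounded_clinear_scaleC bounded_clinear_zero
          cinner_add_right cinner_scaleC_right)
    have "bounded_linear (\<lambda>w. cinner (act (star y) z) w - cinner z (act y w))"
      by (intro bounded_linear_sub bounded_linear_cinner bounded_linear_compose[OF bounded_linear_cinner]
          bounded_clinear_imp_bounded_linear bounded_act y)
    then have "closed ((\<lambda>w. cinner (act (star y) z) w - cinner z (act y w)) -` {0})"
      by (intro closed_vimage bounded_linear_continuous_on) auto
    then show "closed {w. cinner (act (star y) z) w - cinner z (act y w) = 0}"
      by (simp add: vimage_def)
  qed (use base in auto)
  then show ?thesis by simp
qed

section \<open>Agreement with \<pi> and passage to norm limits\<close>

lemma A_subset_V: "A \<subseteq> V"
  using subsetD[OF ideal(2)] by (auto simp: V_def)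

lemma act_on_A:
  assumes "a \<in> A"
  shows "act a z = \<pi> a z"
proof (rule act_eq)
  have "\<pi> i (\<pi> a z) = \<pi> (i * a) z" if "i \<in> J n" for i n
    using star_rep_mult[OF rep, of i a z] that assms subsetD[OF ideal(1)] by auto
  then show "acts a z (\<pi> a z)" by (auto simp: acts_def)
qed

lemma act_seq_diff_le:
  assumes "f k \<in> V" "g l \<in> V"
  shows "norm (act (f k) z - act (g l) z) \<le> norm (f k - g l) * norm z"
  using act_norm_le[of "f k - g l" z] assms by (simp add: act_diff V_diff)

lemma tendsto_ext:
  assumes f: "\<And>k. f k \<in> V" "f \<longlonglongrightarrow> y"
  shows "(\<lambda>k. act (f k) z) \<longlonglongrightarrow> ext y z"
proof -
  define g where "g = (SOME f. (\<forall>k. f k \<in> V) \<and> f \<longlonglongrightarrow> y)"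
  have "(\<forall>k. g k \<in> V) \<and> g \<longlonglongrightarrow> y"
    unfolding g_def by (rule someI[of _ f]) (use f in auto)
  then have g: "\<And>k. g k \<in> V" "g \<longlonglongrightarrow> y" by auto
  have "Cauchy (\<lambda>k. act (g k) z)"
    by (rule Cauchy_dominated[OF LIMSEQ_imp_Cauchy[OF g(2)]]) (rule act_seq_diff_le[of g _ g, OF g(1) g(1)])
  then have "(\<lambda>k. act (g k) z) \<longlonglongrightarrow> ext y z"
    unfolding ext_def g_def[symmetric] using Cauchy_convergent convergent_LIMSEQ_iff by blast
  moreover have "(\<lambda>k. act (f k) z - act (g k) z) \<longlonglongrightarrow> 0"
  proof (rule norm_le_null)
    show "norm (act (f k) z - act (g k) z) \<le> norm (f k - g k) * norm z" for k
      using act_seq_diff_le[of f _ g _ z] f(1) g(1) by simp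
    have "(\<lambda>k. norm (f k - g k) * norm z) \<longlonglongrightarrow> norm (y - y) * norm z"
      by (intro tendsto_intros f g)
    then show "(\<lambda>k. norm (f k - g k) * norm z) \<longlonglongrightarrow> 0" by simp
  qed
  ultimately have "(\<lambda>k. act (f k) z - act (g k) z + act (g k) z) \<longlonglongrightarrow> 0 + ext y z"
    by (intro tendsto_add)
  then show ?thesis by simp
qed

lemma ext_eqI:
  assumes "\<And>k. f k \<in> V" "f \<longlonglongrightarrow> y" "(\<lambda>k. act (f k) z) \<longlonglongrightarrow> l"
  shows "ext y z = l"
  using LIMSEQ_unique[OF tendsto_ext[OF assms(1,2)] assms(3)] .

lemma approximation:
  obtains f where "\<And>k. f k \<in> V" "f \<longlonglongrightarrow> y"
proof -
  have "y \<in> closure V" using dense by (simp add: V_def)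
  then show ?thesis using that unfolding closure_sequential by blast
qed

lemma ext_eq_act: "y \<in> V \<Longrightarrow> ext y z = act y z"
  using tendsto_ext[of "\<lambda>_. y" y z] by (simp add: LIMSEQ_const_iff)

lemma ext_norm_le: "norm (ext y z) \<le> norm y * norm z"
proof -
  obtain f where f: "\<And>k. f k \<in> V" "f \<longlonglongrightarrow> y" using approximation by blast
  show ?thesis
    by (rule LIMSEQ_le[OF tendsto_norm[OF tendsto_ext[OF f]] tendsto_mult_right[OF tendsto_norm[OF f(2)]]])
      (use act_norm_le f in blast)
qed

lemma ext_add: "ext (x + y) z = ext x z + ext y z"
proof -
  obtain f where f: "\<And>k. f k \<in> V" "f \<longlonglongrightarrow> x" using approximation by blast
  obtain g where g: "\<And>k. g k \<in> V" "g \<longlonglongrightarrow> y" using approximation by blast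
  have "(\<lambda>k. act (f k + g k) z) \<longlonglongrightarrow> ext (x + y) z"
    by (intro tendsto_ext V_add f g tendsto_add)
  moreover have "(\<lambda>k. act (f k) z + act (g k) z) \<longlonglongrightarrow> ext x z + ext y z"
    by (intro tendsto_add tendsto_ext f g)
  ultimately show ?thesis using LIMSEQ_unique f g by (simp add: act_add)
qed

lemma ext_scaleC: "ext (c *\<^sub>C y) z = c *\<^sub>C ext y z"
proof -
  obtain f where f: "\<And>k. f k \<in> V" "f \<longlonglongrightarrow> y" using approximation by blast
  have "(\<lambda>k. act (c *\<^sub>C f k) z) \<longlonglongrightarrow> ext (c *\<^sub>C y) z"
    by (intro tendsto_ext V_scaleC f tendsto_scaleC)
  moreover have "(\<lambda>k. c *\<^sub>C act (f k) z) \<longlonglongrightarrow> c *\<^sub>C ext y z"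
    by (intro tendsto_scaleC tendsto_ext f)
  ultimately show ?thesis using LIMSEQ_unique f by (simp add: act_scaleC)
qed

lemma bounded_ext: "bounded_clinear (ext y)"
proof (rule bounded_clinearI)
  obtain f where f: "\<And>k. f k \<in> V" "f \<longlonglongrightarrow> y" using approximation by blast
  show "ext y (z + w) = ext y z + ext y w" for z w
    using tendsto_add[OF tendsto_ext[OF f] tendsto_ext[OF f]]
    by (intro ext_eqI[OF f]) (simp add: act_add_right f(1))
  show "ext y (c *\<^sub>C z) = c *\<^sub>C ext y z" for c z
    using tendsto_scaleC[OF tendsto_ext[OF f]]
    by (intro ext_eqI[OF f]) (simp add: act_scaleC_right f(1))
qed (rule ext_norm_le)

text \<open>The two limits are taken one after the other. With the left factor fixed in
  \<open>V\<close>, the right one converges because \<open>act (f k)\<close> is continuous; then the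
  left factor converges by the bound \<open>ext_norm_le\<close>.\<close>

lemma ext_mult: "ext (x * y) z = ext x (ext y z)"
proof -
  obtain f where f: "\<And>k. f k \<in> V" "f \<longlonglongrightarrow> x" using approximation by blast
  obtain g where g: "\<And>k. g k \<in> V" "g \<longlonglongrightarrow> y" using approximation by blast
  have half: "ext (f k * y) z = act (f k) (ext y z)" for k
  proof (rule ext_eqI)
    show "f k * g l \<in> V" for l by (intro V_mult f g)
    show "(\<lambda>l. f k * g l) \<longlonglongrightarrow> f k * y" by (intro tendsto_mult_left g)
    show "(\<lambda>l. act (f k * g l) z) \<longlonglongrightarrow> act (f k) (ext y z)"
      using bounded_clinear_tendsto[OF bounded_act[OF f(1)] tendsto_ext[OF g]] by (simp add: act_mult f(1) g(1))
  qed
  have "norm (ext (f k * y) z - ext (x * y) z) \<le> norm (f k - x) * norm y * norm z" for k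
  proof -
    have "ext (f k * y) z - ext (x * y) z = ext (f k * y - x * y) z"
      using ext_add[of "f k * y - x * y" "x * y" z] by simp
    also have "norm \<dots> \<le> norm ((f k - x) * y) * norm z"
      using ext_norm_le[of "(f k - x) * y" z] by (simp add: left_diff_distrib)
    also have "\<dots> \<le> norm (f k - x) * norm y * norm z"
      by (intro mult_right_mono norm_mult_ineq) auto
    finally show ?thesis .
  qed
  moreover have "(\<lambda>k. norm (f k - x) * norm y * norm z) \<longlonglongrightarrow> norm (x - x) * norm y * norm z"
    by (intro tendsto_intros f)
  ultimately have "(\<lambda>k. ext (f k * y) z - ext (x * y) z) \<longlonglongrightarrow> 0"
    using norm_le_null[of "\<lambda>k. ext (f k * y) z - ext (x * y) z" "\<lambda>k. norm (f k - x) * norm y * norm z"]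
    by simp
  then have "(\<lambda>k. act (f k) (ext y z)) \<longlonglongrightarrow> ext (x * y) z"
    unfolding half by (rule LIM_zero_cancel)
  then show ?thesis using ext_eqI[OF f] by simp
qed

lemma ext_adjoint: "cinner (ext (star y) z) w = cinner z (ext y w)"
proof -
  obtain f where f: "\<And>k. f k \<in> V" "f \<longlonglongrightarrow> y" using approximation by blast
  have "(\<lambda>k. cinner w (act (star (f k)) z)) \<longlonglongrightarrow> cinner w (ext (star y) z)"
    by (intro tendsto_cinner_right tendsto_ext V_star f tendsto_star)
  then have "(\<lambda>k. cnj (cinner w (act (star (f k)) z))) \<longlonglongrightarrow> cnj (cinner w (ext (star y) z))"
    by (rule tendsto_cnj)
  moreover have "(\<lambda>k. cinner z (act (f k) w)) \<longlonglongrightarrow> cinner z (ext y w)"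
    by (intro tendsto_cinner_right tendsto_ext f)
  moreover have "cnj (cinner w (act (star (f k)) z)) = cinner z (act (f k) w)" for k
    using act_adjoint[OF f(1)] cinner_commute by metis
  ultimately have "cnj (cinner w (ext (star y) z)) = cinner z (ext y w)"
    by (simp add: LIMSEQ_unique)
  then show ?thesis by (metis cinner_commute)
qed

lemma ext_on_A: "a \<in> A \<Longrightarrow> ext a = \<pi> a"
  using subsetD[OF A_subset_V] by (simp add: fun_eq_iff ext_eq_act act_on_A)

lemma star_rep_ext: "star_rep UNIV ext"
proof -
  have "{\<pi> a x | a x. a \<in> A} \<subseteq> {ext a x | a x. a \<in> UNIV}"
    by (auto, metis ext_on_A)
  then have "closure (cspan {ext a x | a x. a \<in> UNIV}) = UNIV"
    using star_rep_nondegenerate[OF rep] closure_mono[OF complex_vector.span_mono] by blast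
  then show ?thesis
    unfolding star_rep_def
    using star_rep_nonzero[OF rep] bounded_ext ext_add ext_scaleC ext_mult ext_adjoint by simp
qed

lemma commutant_eq: "commutant (\<pi> ` A) = commutant (range ext)"
proof
  have "\<pi> ` A \<subseteq> range ext" by (auto simp flip: ext_on_A)
  then show "commutant (range ext) \<subseteq> commutant (\<pi> ` A)" by (auto simp: commutant_def)
  show "commutant (\<pi> ` A) \<subseteq> commutant (range ext)"
  proof
    fix T assume T: "T \<in> commutant (\<pi> ` A)"
    then have bT: "bounded_clinear T" and cT: "\<And>a z. a \<in> A \<Longrightarrow> T (\<pi> a z) = \<pi> a (T z)"
      by (auto simp: commutant_def fun_eq_iff)
    have V: "T (act y z) = act y (T z)" if y: "y \<in> V" for y z
    proof (rule act_eq[symmetric])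
      show "acts y (T z) (T (act y z))"
        using acts_act[OF y, of z] y unfolding acts_def V_def mem_Collect_eq
      proof eventually_elim
        case (elim n)
        then show ?case using cT ideal(1)[of n] mult_J by (metis subsetD)
      qed
    qed
    have "T (ext y z) = ext y (T z)" for y z
    proof -
      obtain f where f: "\<And>k. f k \<in> V" "f \<longlonglongrightarrow> y" using approximation by blast
      show ?thesis
        using LIMSEQ_unique[OF bounded_clinear_tendsto[OF bT tendsto_ext[OF f]] ] tendsto_ext[OF f]
        by (simp add: V f(1))
    qed
    then show "T \<in> commutant (range ext)" using bT by (auto simp: commutant_def fun_eq_iff)
  qed
qed

text \<open>A representation of the whole algebra satisfies \<open>acts y z (\<pi> y z)\<close> by
  multiplicativity, so it agrees with \<open>act\<close> on \<open>V\<close>. Applying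
  \<open>multiplier_image_norm_le\<close> with \<open>UNIV\<close> in place of J shows that it is
  contractive, and density does the rest. This reduces the second claim of the theorem to the
  first.\<close>

lemma ext_unique:
  assumes r: "star_rep UNIV \<pi>"
  shows "ext = \<pi>"
proof (intro ext)
  fix y z
  have U: "cstar_subalgebra (UNIV :: 'a set)" "y \<in> multipliers UNIV" for y :: 'a
    by (auto simp: cstar_subalgebra_def complex_vector.subspace_def multipliers_def)
  have bound: "norm (\<pi> x z) \<le> norm x * norm z" for x
    using star_rep_mult[OF r] by (intro multiplier_image_norm_le[OF r U]) auto
  obtain f where f: "\<And>k. f k \<in> V" "f \<longlonglongrightarrow> y" using approximation by blast
  have "act x z = \<pi> x z" for x
    by (rule act_eq) (auto simp: acts_def star_rep_mult[OF r])
  then have "(\<lambda>k. \<pi> (f k) z) \<longlonglongrightarrow> ext y z" using tendsto_ext[OF f, of z] by simp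
  moreover have "(\<lambda>k. \<pi> (f k) z - \<pi> y z) \<longlonglongrightarrow> 0"
  proof (rule norm_le_null)
    show "norm (\<pi> (f k) z - \<pi> y z) \<le> norm (f k - y) * norm z" for k
      using bound[of "f k - y"] by (simp add: star_rep_diff[OF r U(1)])
    have "(\<lambda>k. norm (f k - y) * norm z) \<longlonglongrightarrow> norm (y - y) * norm z"
      by (intro tendsto_intros f)
    then show "(\<lambda>k. norm (f k - y) * norm z) \<longlonglongrightarrow> 0" by simp
  qed
  ultimately show "ext y z = \<pi> y z"
    using LIMSEQ_unique LIM_zero_iff by blast
qed

end

section \<open>Block decomposition with respect to the last tensor factor\<close>

text \<open>The coefficients of a with respect to the matrix units of the last tensor factor: in
  \<open>\<otimes>\<^sub>K\<close> the position in the last factor is the index modulo 3. Indices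
  count from 0, so \<open>blk 1 1\<close> is the coefficient of e_22.\<close>

definition blk :: "nat \<Rightarrow> nat \<Rightarrow> complex mat \<Rightarrow> complex mat" where
  "blk l l' a = mat (dim_row a div 3) (dim_col a div 3) (\<lambda>(i, j). a $$ (3 * i + l, 3 * j + l'))"

lemma slice_last_eq_blk: "slice_last = blk 1 1"
  by (simp add: fun_eq_iff slice_last_def blk_def)

lemma M3_Suc: "a \<in> M3 (Suc n) \<longleftrightarrow> dim_row a = 3 * 3 ^ n \<and> dim_col a = 3 * 3 ^ n"
  by (simp only: carrier_mat_def mem_Collect_eq power_Suc)

lemma blk_carrier: "a \<in> M3 (Suc n) \<Longrightarrow> blk l l' a \<in> M3 n"
  by (auto simp: blk_def)

lemma index_blk: "a \<in> M3 (Suc n) \<Longrightarrow> i < 3 ^ n \<Longrightarrow> j < 3 ^ n \<Longrightarrow> blk l l' a $$ (i, j) = a $$ (3 * i + l, 3 * j + l')"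
  by (auto simp: blk_def)

lemma blk_eqI:
  assumes "a \<in> M3 (Suc n)" "b \<in> M3 (Suc n)" "\<And>l l'. l < 3 \<Longrightarrow> l' < 3 \<Longrightarrow> blk l l' a = blk l l' b"
  shows "a = b"
proof (rule eq_matI)
  fix i j assume "i < dim_row b" "j < dim_col b"
  then have "i div 3 < 3 ^ n" "j div 3 < 3 ^ n" using assms(2) by (auto simp: M3_Suc)
  then show "a $$ (i, j) = b $$ (i, j)"
    using assms(3)[of "i mod 3" "j mod 3"] index_blk[OF assms(1), of "i div 3" "j div 3" "i mod 3" "j mod 3"]
      index_blk[OF assms(2), of "i div 3" "j div 3" "i mod 3" "j mod 3"] by simp
qed (use assms in auto)

lemma less_3_iff: "l < 3 \<longleftrightarrow> l = 0 \<or> l = 1 \<or> l = (2::nat)"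
  by auto

lemma div_mod_less: "3 * i + l < 3 * (m::nat)" if "i < m" "l < 3"
  using that by linarith

lemma index_add_M3: "b \<in> M3 n \<Longrightarrow> i < 3 ^ n \<Longrightarrow> j < 3 ^ n \<Longrightarrow> (a + b) $$ (i, j) = a $$ (i, j) + b $$ (i, j)"
  by auto

lemma blk_add:
  "a \<in> M3 (Suc n) \<Longrightarrow> b \<in> M3 (Suc n) \<Longrightarrow> l < 3 \<Longrightarrow> l' < 3 \<Longrightarrow> blk l l' (a + b) = blk l l' a + blk l l' b"
  by (rule eq_matI) (auto simp: blk_def div_mod_less)

lemma blk_smult:
  "a \<in> M3 (Suc n) \<Longrightarrow> l < 3 \<Longrightarrow> l' < 3 \<Longrightarrow> blk l l' (c \<cdot>\<^sub>m a) = c \<cdot>\<^sub>m blk l l' a"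
  by (rule eq_matI) (auto simp: blk_def div_mod_less)

lemma sum_lessThan_times_3: "sum f {0..<3 * m} = (\<Sum>k = 0..<m. f (3 * k) + f (3 * k + 1) + f (3 * k + (2::nat)))"
  for f :: "nat \<Rightarrow> 'b::comm_monoid_add"
proof (induction m)
  case (Suc m)
  have "{0..<3 * Suc m} = {0..<3 * m} \<union> {3 * m, 3 * m + 1, 3 * m + 2}" by auto
  then have "sum f {0..<3 * Suc m} = sum f {0..<3 * m} + sum f {3 * m, 3 * m + 1, 3 * m + 2}"
    by (simp only:) (rule sum.union_disjoint, auto)
  then show ?case using Suc by (simp add: ac_simps)
qed simp

lemma blk_mult:
  assumes "a \<in> M3 (Suc n)" "b \<in> M3 (Suc n)" "l < 3" "l' < 3"
  shows "blk l l' (a * b) = blk l 0 a * blk 0 l' b + blk l 1 a * blk 1 l' b + blk l 2 a * blk 2 l' b"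
proof (rule eq_matI)
  fix i j
  assume "i < dim_row (blk l 0 a * blk 0 l' b + blk l 1 a * blk 1 l' b + blk l 2 a * blk 2 l' b)"
    "j < dim_col (blk l 0 a * blk 0 l' b + blk l 1 a * blk 1 l' b + blk l 2 a * blk 2 l' b)"
  then have ij: "i < 3 ^ n" "j < 3 ^ n" using assms by (auto simp: blk_def)
  have "blk l l' (a * b) $$ (i, j) = (a * b) $$ (3 * i + l, 3 * j + l')"
    using assms ij by (intro index_blk) auto
  also have "\<dots> = (\<Sum>k = 0..<3 * 3 ^ n. a $$ (3 * i + l, k) * b $$ (k, 3 * j + l'))"
    using assms ij div_mod_less[OF ij(1) assms(3)] div_mod_less[OF ij(2) assms(4)]
    by (auto simp: scalar_prod_def M3_Suc intro!: sum.cong)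
  also have "\<dots> = (\<Sum>k = 0..<3 ^ n. blk l 0 a $$ (i, k) * blk 0 l' b $$ (k, j))
      + (\<Sum>k = 0..<3 ^ n. blk l 1 a $$ (i, k) * blk 1 l' b $$ (k, j))
      + (\<Sum>k = 0..<3 ^ n. blk l 2 a $$ (i, k) * blk 2 l' b $$ (k, j))"
    unfolding sum_lessThan_times_3 sum.distrib[symmetric]
    using assms ij by (intro sum.cong refl) (simp add: index_blk)
  also have "\<dots> = (blk l 0 a * blk 0 l' b + blk l 1 a * blk 1 l' b + blk l 2 a * blk 2 l' b) $$ (i, j)"
  proof -
    have "dim_row (blk m m' a) = 3 ^ n" "dim_col (blk m m' a) = 3 ^ n"
      "dim_row (blk m m' b) = 3 ^ n" "dim_col (blk m m' b) = 3 ^ n" for m m'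
      using assms(1,2) by (auto simp: blk_def)
    then show ?thesis using ij by (simp add: scalar_prod_def)
  qed
  finally show "blk l l' (a * b) $$ (i, j)
      = (blk l 0 a * blk 0 l' b + blk l 1 a * blk 1 l' b + blk l 2 a * blk 2 l' b) $$ (i, j)" .
qed (use assms in \<open>auto simp: blk_def\<close>)

lemma dim_mat_adjoint [simp]: "dim_row (mat_adjoint a) = dim_col a" "dim_col (mat_adjoint a) = dim_row a"
  by (auto simp: mat_adjoint_def)

lemma mat_adjoint_carrier: "a \<in> carrier_mat m n \<Longrightarrow> mat_adjoint a \<in> carrier_mat n m"
  by (intro carrier_matI) auto

lemma index_mat_adjoint [simp]:
  "i < dim_col a \<Longrightarrow> j < dim_row a \<Longrightarrow> mat_adjoint a $$ (i, j) = cnj (a $$ (j, i))"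
  by (simp add: mat_adjoint_def mat_of_rows_index)

lemma blk_mat_adjoint:
  "a \<in> M3 (Suc n) \<Longrightarrow> l < 3 \<Longrightarrow> l' < 3 \<Longrightarrow> blk l l' (mat_adjoint a) = mat_adjoint (blk l' l a)"
  by (rule eq_matI) (auto simp: blk_def div_mod_less)

lemma blk_one:
  "l < 3 \<Longrightarrow> l' < 3 \<Longrightarrow> blk l l' (1\<^sub>m (3 ^ Suc n)) = (if l = l' then 1\<^sub>m (3 ^ n) else 0\<^sub>m (3 ^ n) (3 ^ n))"
  by (rule eq_matI) (auto simp: blk_def div_mod_less less_3_iff, presburger+)

lemma blk_zero: "l < 3 \<Longrightarrow> l' < 3 \<Longrightarrow> blk l l' (0\<^sub>m (3 ^ Suc n) (3 ^ Suc n)) = 0\<^sub>m (3 ^ n) (3 ^ n)"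
  by (rule eq_matI) (auto simp: blk_def div_mod_less)

lemma mat_adjoint_simps:
  shows "mat_adjoint (0\<^sub>m m n) = (0\<^sub>m n m :: complex mat)"
    and "mat_adjoint (1\<^sub>m m) = (1\<^sub>m m :: complex mat)"
    and "mat_adjoint (mat_adjoint a) = (a :: complex mat)"
  by (rule eq_matI; auto)+

section \<open>Kronecker products and their blocks\<close>

lemma kron_carrier:
  "A \<in> carrier_mat a b \<Longrightarrow> B \<in> carrier_mat c d \<Longrightarrow> A \<otimes>\<^sub>K B \<in> carrier_mat (a * c) (b * d)"
  by (auto simp: kron_def)

lemma kron_carrier_3: "x \<in> M3 n \<Longrightarrow> e \<in> carrier_mat 3 3 \<Longrightarrow> x \<otimes>\<^sub>K e \<in> M3 (Suc n)"
  using kron_carrier[of x "3 ^ n" "3 ^ n" e 3 3] by (simp add: mult.commute)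

lemma blk_kron:
  assumes "x \<in> M3 n" "e \<in> carrier_mat 3 3" "l < 3" "l' < 3"
  shows "blk l l' (x \<otimes>\<^sub>K e) = e $$ (l, l') \<cdot>\<^sub>m x"
  using assms by (intro eq_matI) (auto simp: blk_def kron_def div_mod_less mult.commute[of _ 3])

lemma kron_assoc:
  assumes "A \<in> carrier_mat a a'" "B \<in> carrier_mat b b'" "C \<in> carrier_mat c c'"
    and "b > 0" "b' > 0" "c > 0" "c' > 0"
  shows "(A \<otimes>\<^sub>K B) \<otimes>\<^sub>K C = A \<otimes>\<^sub>K (B \<otimes>\<^sub>K C)"
proof (rule eq_matI)
  fix i j assume "i < dim_row (A \<otimes>\<^sub>K (B \<otimes>\<^sub>K C))" "j < dim_col (A \<otimes>\<^sub>K (B \<otimes>\<^sub>K C))"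
  then have ij: "i < a * b * c" "j < a' * b' * c'" using assms by (auto simp: kron_def mult.assoc)
  have "i div c < a * b" "j div c' < a' * b'" "i mod (b * c) < b * c" "j mod (b' * c') < b' * c'"
    using ij assms by (simp_all add: less_mult_imp_div_less)
  moreover have "i div c mod b = i mod (b * c) div c" "i mod c = i mod (b * c) mod c"
    "j div c' mod b' = j mod (b' * c') div c'" "j mod c' = j mod (b' * c') mod c'"
    "i div c div b = i div (b * c)" "j div c' div b' = j div (b' * c')"
    using assms by (auto simp: mult.commute[of b] mult.commute[of b'] mod_mult2_eq div_mult2_eq)
  moreover have "i < a * (b * c)" "j < a' * (b' * c')" using ij by (simp_all add: mult.assoc)
  ultimately show "((A \<otimes>\<^sub>K B) \<otimes>\<^sub>K C) $$ (i, j) = (A \<otimes>\<^sub>K (B \<otimes>\<^sub>K C)) $$ (i, j)"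
    using assms ij by (simp add: kron_def mult.assoc)
qed (use assms in \<open>auto simp: kron_def\<close>)

lemma kron_add_right:
  assumes "A \<in> carrier_mat a a'" "B \<in> carrier_mat b b'" "C \<in> carrier_mat b b'" "b > 0" "b' > 0"
  shows "A \<otimes>\<^sub>K (B + C) = (A \<otimes>\<^sub>K B) + (A \<otimes>\<^sub>K C)"
  using assms by (intro eq_matI) (auto simp: kron_def distrib_left)

lemma kron_one_1: "A \<otimes>\<^sub>K 1\<^sub>m 1 = A"
  by (rule eq_matI) (auto simp: kron_def)

lemma one_1_kron: "1\<^sub>m 1 \<otimes>\<^sub>K A = A"
  by (rule eq_matI) (auto simp: kron_def)

lemma munit_carrier [simp, intro]: "munit i j \<in> carrier_mat 3 3"
  by (simp add: munit_def)

lemma kron_pow_carrier: "kron_pow (munit i j) n \<in> M3 n"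
  by (induction n) (use kron_carrier[OF munit_carrier] in auto)

lemma kron_pow_Suc_right: "kron_pow (munit i j) (Suc n) = kron_pow (munit i j) n \<otimes>\<^sub>K munit i j"
proof (induction n)
  case 0
  then show ?case by (simp only: kron_pow.simps kron_one_1 one_1_kron)
next
  case (Suc n)
  have "kron_pow (munit i j) (Suc (Suc n)) = munit i j \<otimes>\<^sub>K (kron_pow (munit i j) n \<otimes>\<^sub>K munit i j)"
    using Suc by simp
  also have "\<dots> = kron_pow (munit i j) (Suc n) \<otimes>\<^sub>K munit i j"
    using kron_assoc[OF munit_carrier kron_pow_carrier munit_carrier] by simp
  finally show ?case .
qed

lemma index_munit:
  "l < 3 \<Longrightarrow> l' < 3 \<Longrightarrow> munit i j $$ (l, l') = (if l = (i + 2) mod 3 \<and> l' = (j + 2) mod 3 then 1 else 0)"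
  by (simp add: munit_def)

text \<open>Unlike the unital embedding \<open>x \<otimes>\<^sub>K 1\<^sub>m 3\<close>, this
  multiplicative but non-unital one maps \<open>A_mat n\<close> into \<open>A_mat (Suc n)\<close>.
  It is a right inverse of \<open>slice_last\<close>.\<close>

definition pad1 :: "complex mat \<Rightarrow> complex mat" where
  "pad1 x = x \<otimes>\<^sub>K munit 2 2"

lemma pad1_carrier: "x \<in> M3 n \<Longrightarrow> pad1 x \<in> M3 (Suc n)"
  unfolding pad1_def by (intro kron_carrier_3 munit_carrier)

lemma zero_smult_M3: "x \<in> M3 n \<Longrightarrow> 0 \<cdot>\<^sub>m x = 0\<^sub>m (3 ^ n) (3 ^ n)"
  by (intro eq_matI) auto

lemma one_smult_mat: "(1::complex) \<cdot>\<^sub>m x = x"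
  by (intro eq_matI) auto

lemma blk_pad1:
  "x \<in> M3 n \<Longrightarrow> l < 3 \<Longrightarrow> l' < 3 \<Longrightarrow>
    blk l l' (pad1 x) = (if l = 1 \<and> l' = 1 then x else 0\<^sub>m (3 ^ n) (3 ^ n))"
  unfolding pad1_def by (auto simp: blk_kron index_munit zero_smult_M3 one_smult_mat)

lemma blk_kron_one:
  "x \<in> M3 n \<Longrightarrow> l < 3 \<Longrightarrow> l' < 3 \<Longrightarrow>
    blk l l' (x \<otimes>\<^sub>K 1\<^sub>m 3) = (if l = l' then x else 0\<^sub>m (3 ^ n) (3 ^ n))"
  by (auto simp: blk_kron zero_smult_M3 one_smult_mat)

section \<open>The algebras \<open>\<A>\<^sub>n\<close>\<close>

text \<open>Otherwise \<open>3 ^ Suc n\<close> is normalised in two different ways and \<open>M3 (Suc n)\<close> is no longer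
  recognised.\<close>

declare power_Suc [simp del] VS_Connect.class_semiring.nat_pow_Suc [simp del]

definition bdiag :: "nat \<Rightarrow> complex mat set" where
  "bdiag n = {a \<in> M3 (Suc n). \<forall>l<3. \<forall>l'<3. l \<noteq> l' \<longrightarrow> blk l l' a = 0\<^sub>m (3 ^ n) (3 ^ n)}"

lemma bdiag_carrier: "a \<in> bdiag n \<Longrightarrow> a \<in> M3 (Suc n)"
  by (simp add: bdiag_def)

lemma bdiag_blk: "a \<in> bdiag n \<Longrightarrow> l < 3 \<Longrightarrow> l' < 3 \<Longrightarrow> l \<noteq> l' \<Longrightarrow> blk l l' a = 0\<^sub>m (3 ^ n) (3 ^ n)"
  by (simp add: bdiag_def)

lemma bdiag_add: "a \<in> bdiag n \<Longrightarrow> b \<in> bdiag n \<Longrightarrow> a + b \<in> bdiag n"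
  unfolding bdiag_def by (auto simp: blk_add)

lemma bdiag_smult: "a \<in> bdiag n \<Longrightarrow> c \<cdot>\<^sub>m a \<in> bdiag n"
  unfolding bdiag_def by (auto simp: blk_smult)

lemma bdiag_adjoint: "a \<in> bdiag n \<Longrightarrow> mat_adjoint a \<in> bdiag n"
  unfolding bdiag_def
  by (auto simp: blk_mat_adjoint mat_adjoint_simps mat_adjoint_carrier)

lemma bdiag_one: "1\<^sub>m (3 ^ Suc n) \<in> bdiag n"
  unfolding bdiag_def by (auto simp: blk_one)

lemma blk_mult_bdiag:
  assumes "a \<in> bdiag n" "b \<in> M3 (Suc n)" "l < 3" "l' < 3"
  shows "blk l l' (a * b) = blk l l a * blk l l' b"
proof -
  have c: "blk m m' a \<in> M3 n" "blk m m' b \<in> M3 n" for m m'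
    using assms by (auto intro: blk_carrier bdiag_carrier)
  have "blk l l' (a * b) = blk l 0 a * blk 0 l' b + blk l 1 a * blk 1 l' b + blk l 2 a * blk 2 l' b"
    using assms bdiag_carrier by (intro blk_mult) auto
  also have "\<dots> = blk l l a * blk l l' b"
    using assms(3) bdiag_blk[OF assms(1,3)] c[of l l] c[of l l'] c(2)
    by (auto simp: less_3_iff left_mult_zero_mat[OF c(2)])
  finally show ?thesis .
qed

lemma bdiag_mult:
  assumes "a \<in> bdiag n" "b \<in> bdiag n"
  shows "a * b \<in> bdiag n"
proof -
  have "blk l l' (a * b) = 0\<^sub>m (3 ^ n) (3 ^ n)" if "l < 3" "l' < 3" "l \<noteq> l'" for l l'
    using assms that right_mult_zero_mat[OF blk_carrier[OF bdiag_carrier[OF assms(1)]], of l l]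
    by (simp add: blk_mult_bdiag bdiag_carrier bdiag_blk)
  moreover have "a * b \<in> M3 (Suc n)" using assms bdiag_carrier by (auto intro: mult_carrier_mat)
  ultimately show ?thesis by (simp add: bdiag_def)
qed

text \<open>The matrices of \<open>\<A>\<^sub>n\<close> are those of the form \<open>c \<otimes> e\<^sub>2\<^sub>2 + x \<otimes> e\<^sub>1\<^sub>1 + y \<otimes> e\<^sub>3\<^sub>3\<close> with \<open>c \<in> \<A>\<^sub>n\<^sub>-\<^sub>1\<close> and
  \<open>x\<close>, \<open>y\<close> block diagonal with the same blocks up to a cyclic shift.\<close>

primrec A_mat :: "nat \<Rightarrow> complex mat set" where
  "A_mat 0 = bdiag 0"
| "A_mat (Suc n) = {a \<in> bdiag (Suc n). blk 1 1 a \<in> A_mat n \<and> blk 0 0 a \<in> bdiag n \<and> blk 2 2 a \<in> bdiag n \<and>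
     (\<forall>d<3. blk d d (blk 0 0 a) = blk ((d + 2) mod 3) ((d + 2) mod 3) (blk 2 2 a))}"

lemma A_mat_bdiag: "a \<in> A_mat n \<Longrightarrow> a \<in> bdiag n"
  by (cases n) auto

lemma A_mat_carrier: "a \<in> A_mat n \<Longrightarrow> a \<in> M3 (Suc n)"
  using A_mat_bdiag bdiag_carrier by blast

lemma A_mat_add: "a \<in> A_mat n \<Longrightarrow> b \<in> A_mat n \<Longrightarrow> a + b \<in> A_mat n"
proof (induction n arbitrary: a b)
  case (Suc n)
  then show ?case
    using bdiag_carrier[of a "Suc n"] bdiag_carrier[of b "Suc n"]
      bdiag_carrier[of "blk 0 0 a" n] bdiag_carrier[of "blk 0 0 b" n] bdiag_carrier[of "blk 2 2 a" n] bdiag_carrier[of "blk 2 2 b" n]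
    by (simp add: bdiag_add blk_add)
qed (simp add: bdiag_add)

lemma A_mat_smult: "a \<in> A_mat n \<Longrightarrow> c \<cdot>\<^sub>m a \<in> A_mat n"
proof (induction n arbitrary: a)
  case (Suc n)
  then show ?case
    using bdiag_carrier[of a "Suc n"] bdiag_carrier[of "blk 0 0 a" n] bdiag_carrier[of "blk 2 2 a" n]
    by (simp add: bdiag_smult blk_smult)
qed (simp add: bdiag_smult)

lemma A_mat_adjoint: "a \<in> A_mat n \<Longrightarrow> mat_adjoint a \<in> A_mat n"
proof (induction n arbitrary: a)
  case (Suc n)
  then show ?case
    using bdiag_carrier[of a "Suc n"] bdiag_carrier[of "blk 0 0 a" n] bdiag_carrier[of "blk 2 2 a" n]
    by (simp add: bdiag_adjoint blk_mat_adjoint)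
qed (simp add: bdiag_adjoint)

lemma A_mat_mult: "a \<in> A_mat n \<Longrightarrow> b \<in> A_mat n \<Longrightarrow> a * b \<in> A_mat n"
proof (induction n arbitrary: a b)
  case (Suc n)
  have ab: "a \<in> bdiag (Suc n)" "b \<in> bdiag (Suc n)" "blk 0 0 a \<in> bdiag n" "blk 0 0 b \<in> bdiag n"
    "blk 2 2 a \<in> bdiag n" "blk 2 2 b \<in> bdiag n" "blk 1 1 a \<in> A_mat n" "blk 1 1 b \<in> A_mat n"
    and shift: "\<And>d. d < 3 \<Longrightarrow> blk d d (blk 0 0 a) = blk ((d + 2) mod 3) ((d + 2) mod 3) (blk 2 2 a)"
      "\<And>d. d < 3 \<Longrightarrow> blk d d (blk 0 0 b) = blk ((d + 2) mod 3) ((d + 2) mod 3) (blk 2 2 b)"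
    using Suc.prems by auto
  have outer: "blk d d (a * b) = blk d d a * blk d d b" if "d < 3" for d
    using blk_mult_bdiag[OF ab(1) bdiag_carrier[OF ab(2)] that that] .
  have inner: "blk d d (blk 0 0 a * blk 0 0 b)
      = blk ((d + 2) mod 3) ((d + 2) mod 3) (blk 2 2 a * blk 2 2 b)" if "d < 3" for d
    using blk_mult_bdiag[OF ab(3) bdiag_carrier[OF ab(4)] that that] shift[OF that]
      blk_mult_bdiag[OF ab(5) bdiag_carrier[OF ab(6)], of "(d + 2) mod 3" "(d + 2) mod 3"] by simp
  have o: "blk 0 0 (a * b) = blk 0 0 a * blk 0 0 b" "blk 1 1 (a * b) = blk 1 1 a * blk 1 1 b"
    "blk 2 2 (a * b) = blk 2 2 a * blk 2 2 b"
    by (rule outer, simp)+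
  show ?case
    unfolding A_mat.simps mem_Collect_eq o
    using inner ab by (intro conjI allI impI bdiag_mult Suc.IH)
qed (simp add: bdiag_mult)

lemma A_mat_one: "1\<^sub>m (3 ^ Suc n) \<in> A_mat n"
proof (induction n)
  case 0
  then show ?case using bdiag_one[of 0] by simp
next
  case (Suc n)
  then show ?case using bdiag_one[of n] bdiag_one[of "Suc n"] by (simp add: blk_one)
qed

lemma A_mat_zero: "0\<^sub>m (3 ^ Suc n) (3 ^ Suc n) \<in> A_mat n"
  using A_mat_smult[OF A_mat_one, of 0 n] by (simp add: zero_smult_M3[of _ "Suc n"])

lemma A_mat_pad1: "c \<in> A_mat n \<Longrightarrow> pad1 c \<in> A_mat (Suc n)"
proof -
  assume c: "c \<in> A_mat n"
  have z: "0\<^sub>m (3 ^ Suc n) (3 ^ Suc n) \<in> bdiag n" using A_mat_bdiag[OF A_mat_zero] .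
  have "pad1 c \<in> bdiag (Suc n)"
    using A_mat_carrier[OF c] pad1_carrier by (auto simp: bdiag_def blk_pad1)
  then show ?thesis
    using c z A_mat_carrier[OF c] by (simp add: blk_pad1 blk_zero)
qed

lemma slice_last_A_mat: "a \<in> A_mat (Suc n) \<Longrightarrow> slice_last a \<in> A_mat n"
  by (simp add: slice_last_eq_blk)

text \<open>Off-diagonal blocks vanish in \<open>bdiag\<close>, so the e_22-block of a product is
  the product of the e_22-blocks. This is why \<rho>_m is multiplicative on A_inf, while the slice
  map of the full UHF algebra is not.\<close>

lemma slice_last_mult_A_mat: "a \<in> A_mat (Suc n) \<Longrightarrow> b \<in> A_mat (Suc n) \<Longrightarrow> slice_last (a * b) = slice_last a * slice_last b"
  using blk_mult_bdiag[of a "Suc n" b 1 1] bdiag_carrier[of b "Suc n"] by (simp add: slice_last_eq_blk)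

section \<open>The generators of \<A>_n as elements of \<open>A_mat\<close>\<close>

lemma kron_beta_1:
  assumes "x \<in> M3 n"
  shows "x \<otimes>\<^sub>K beta 1 j = ((x \<otimes>\<^sub>K munit j j) \<otimes>\<^sub>K munit 1 1) + ((x \<otimes>\<^sub>K munit (j + 2) (j + 2)) \<otimes>\<^sub>K munit 3 3)"
proof -
  have c: "munit i i \<otimes>\<^sub>K munit k k \<in> carrier_mat 9 9" for i k
    using kron_carrier[OF munit_carrier[of i i] munit_carrier[of k k]] by simp
  show ?thesis
    using kron_add_right[OF assms c c] kron_assoc[OF assms munit_carrier munit_carrier]
    by (simp add: beta_def kron_one_1 del: One_nat_def)
qed

lemma kron_beta_1_carrier: "x \<in> M3 n \<Longrightarrow> x \<otimes>\<^sub>K beta 1 j \<in> M3 (Suc (Suc n))"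
  unfolding kron_beta_1 by (intro add_carrier_mat kron_carrier_3 munit_carrier)

lemma blk_kron_beta_1:
  assumes "x \<in> M3 n" "l < 3" "l' < 3"
  shows "blk l l' (x \<otimes>\<^sub>K beta 1 j) = (if l = 0 \<and> l' = 0 then x \<otimes>\<^sub>K munit j j
    else if l = 2 \<and> l' = 2 then x \<otimes>\<^sub>K munit (j + 2) (j + 2) else 0\<^sub>m (3 ^ Suc n) (3 ^ Suc n))"
proof -
  have x: "x \<otimes>\<^sub>K munit k k \<in> M3 (Suc n)" for k using assms by (intro kron_carrier_3) auto
  have y: "(x \<otimes>\<^sub>K munit k k) \<otimes>\<^sub>K munit i i \<in> M3 (Suc (Suc n))" for i k by (intro kron_carrier_3 x) auto
  show ?thesis
    unfolding kron_beta_1[OF assms(1)] blk_add[OF y y assms(2,3)] blk_kron[OF x munit_carrier assms(2,3)]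
    using assms right_add_zero_mat[OF x] left_add_zero_mat[OF x]
    by (auto simp: index_munit zero_smult_M3[OF x] one_smult_mat simp del: One_nat_def)
qed

lemma A_mat_kron_beta_1:
  assumes "x \<in> M3 n"
  shows "x \<otimes>\<^sub>K beta 1 j \<in> A_mat (Suc n)"
proof -
  have x: "x \<otimes>\<^sub>K munit k k \<in> M3 (Suc n)" for k using assms by (intro kron_carrier_3) auto
  have b: "x \<otimes>\<^sub>K munit k k \<in> bdiag n" for k
    using x assms unfolding bdiag_def by (auto simp: blk_kron index_munit zero_smult_M3)
  have "x \<otimes>\<^sub>K beta 1 j \<in> bdiag (Suc n)"
    using kron_beta_1_carrier[OF assms] unfolding bdiag_def
    by (auto simp: blk_kron_beta_1[OF assms] simp del: One_nat_def)
  \<comment> \<open>In 0-based numbering e_jj sits at (j + 2) mod 3 and e_(j+2)(j+2) at (j + 4) mod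
    3. The claim is that the shift d \<mapsto> d + 2 in the definition of \<open>A_mat\<close>
    carries the first position to the second.\<close>
  moreover have "(d = (j + 2) mod 3) = ((d + 2) mod 3 = (j + 2 + 2) mod 3)" if "d < 3" for d
  proof -
    define r where "r = (j + 2) mod 3"
    have "r < 3" by (simp add: r_def)
    moreover have "(j + 2 + 2) mod 3 = (r + 2) mod 3" unfolding r_def by (rule mod_add_left_eq[symmetric])
    ultimately show ?thesis
      using that unfolding r_def[symmetric] by (auto simp: less_3_iff)
  qed
  ultimately show ?thesis
    using b A_mat_zero[of n] assms
    by (simp add: blk_kron_beta_1 blk_kron index_munit del: One_nat_def)
qed

lemma alpha_Suc: "alpha (Suc n) j = pad1 (alpha n j)"
  unfolding alpha_def pad1_def kron_pow_Suc_right
  using kron_assoc[OF munit_carrier kron_pow_carrier munit_carrier] by simp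

lemma A_mat_alpha: "alpha n j \<in> A_mat n"
proof (induction n)
  case 0
  have "alpha 0 j = 1\<^sub>m (3 ^ 0) \<otimes>\<^sub>K munit j j"
    by (simp only: alpha_def kron_pow.simps kron_one_1 one_1_kron power_0)
  moreover have c: "1\<^sub>m (3 ^ 0) \<in> M3 0" by (rule one_carrier_mat)
  moreover have "blk l l' (1\<^sub>m (3 ^ 0) \<otimes>\<^sub>K munit j j) = munit j j $$ (l, l') \<cdot>\<^sub>m 1\<^sub>m (3 ^ 0)" if "l < 3" "l' < 3" for l l'
    using that by (intro blk_kron[OF c]) auto
  ultimately show ?case
    using kron_carrier_3[OF c, of "munit j j"] zero_smult_M3[OF c]
    by (auto simp: bdiag_def index_munit)
qed (simp only: alpha_Suc A_mat_pad1)

lemma kron_beta_carrier: "beta (Suc k) j \<in> M3 (Suc (Suc k))"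
proof -
  have "munit j j \<otimes>\<^sub>K munit 1 1 + munit (j + 2) (j + 2) \<otimes>\<^sub>K munit 3 3 \<in> carrier_mat (3 * 3) (3 * 3)"
    by (intro add_carrier_mat kron_carrier munit_carrier)
  from kron_carrier[OF this kron_pow_carrier] show ?thesis by (simp add: beta_def power_Suc)
qed

text \<open>Together with \<open>alpha_Suc\<close> this shows that the generators of level n + 1 are
  the padded generators of level n and the new elements x \<otimes> beta^1_j.\<close>

lemma kron_beta_Suc:
  assumes "x \<in> M3 n"
  shows "x \<otimes>\<^sub>K beta (Suc (Suc k)) j = pad1 (x \<otimes>\<^sub>K beta (Suc k) j)"
proof -
  have c: "munit j j \<otimes>\<^sub>K munit 1 1 + munit (j + 2) (j + 2) \<otimes>\<^sub>K munit 3 3 \<in> carrier_mat (3 * 3) (3 * 3)"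
    by (intro add_carrier_mat kron_carrier munit_carrier)
  have "beta (Suc (Suc k)) j = beta (Suc k) j \<otimes>\<^sub>K munit 2 2"
    unfolding beta_def diff_Suc_1 kron_pow_Suc_right
    using kron_assoc[OF c kron_pow_carrier munit_carrier] by simp
  then show ?thesis
    unfolding pad1_def using kron_assoc[OF assms kron_beta_carrier munit_carrier] by simp
qed

lemma A_mat_kron_beta: "x \<in> M3 n \<Longrightarrow> x \<otimes>\<^sub>K beta (Suc k) j \<in> A_mat (n + Suc k)"
proof (induction k)
  case 0
  then show ?case using A_mat_kron_beta_1 by simp
next
  case (Suc k)
  then show ?case using A_mat_pad1[of _ "n + Suc k"] by (simp add: kron_beta_Suc)
qed

text \<open>One step of expanding a matrix of \<open>A_mat\<close> in generators. The e_22-block is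
  a padded element of \<open>A_mat n\<close>; the diagonal blocks of the e_11-block are the
  coefficients of beta^1_1, beta^1_2, beta^1_3; the e_33-block is then forced by the cyclic
  shift.\<close>

lemma A_mat_Suc_decomp:
  assumes "a \<in> A_mat (Suc n)"
  shows "a = pad1 (slice_last a) + (blk 0 0 (blk 0 0 a) \<otimes>\<^sub>K beta 1 1
    + (blk 1 1 (blk 0 0 a) \<otimes>\<^sub>K beta 1 2 + blk 2 2 (blk 0 0 a) \<otimes>\<^sub>K beta 1 3))" (is "a = ?p + (?x + (?y + ?z))")
proof (rule blk_eqI)
  define b where "b = blk 0 0 a"
  have a: "a \<in> M3 (Suc (Suc n))" "a \<in> bdiag (Suc n)" using assms bdiag_carrier by auto
  have b: "b \<in> bdiag n" "blk 2 2 a \<in> bdiag n" "b \<in> M3 (Suc n)" "blk 2 2 a \<in> M3 (Suc n)"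
    using assms bdiag_carrier by (auto simp: b_def)
  have s: "slice_last a \<in> M3 (Suc n)" using blk_carrier[OF a(1)] by (simp add: slice_last_eq_blk)
  have x: "blk d d b \<in> M3 n" for d using blk_carrier[OF b(3)] .
  have k: "blk d d b \<otimes>\<^sub>K munit i i \<in> M3 (Suc n)" for d i using x by (intro kron_carrier_3) auto
  show a': "a \<in> M3 (Suc (Suc n))" by fact
  have t: "?p \<in> M3 (Suc (Suc n))" "?x \<in> M3 (Suc (Suc n))" "?y \<in> M3 (Suc (Suc n))" "?z \<in> M3 (Suc (Suc n))"
    using pad1_carrier[OF s] kron_beta_1_carrier[OF x] unfolding b_def by auto
  then show sum: "?p + (?x + (?y + ?z)) \<in> M3 (Suc (Suc n))" by (intro add_carrier_mat)
  have shift: "blk 0 0 b = blk 2 2 (blk 2 2 a)" "blk 1 1 b = blk 0 0 (blk 2 2 a)" "blk 2 2 b = blk 1 1 (blk 2 2 a)"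
  proof -
    have *: "blk d d b = blk ((d + 2) mod 3) ((d + 2) mod 3) (blk 2 2 a)" if "d < 3" for d
      using assms that by (simp add: b_def)
    show "blk 0 0 b = blk 2 2 (blk 2 2 a)" "blk 1 1 b = blk 0 0 (blk 2 2 a)" "blk 2 2 b = blk 1 1 (blk 2 2 a)"
      using *[of 0] *[of 1] *[of 2] by (simp_all add: numeral_2_eq_2)
  qed
  have 0: "b = blk 0 0 b \<otimes>\<^sub>K munit 1 1 + (blk 1 1 b \<otimes>\<^sub>K munit 2 2 + blk 2 2 b \<otimes>\<^sub>K munit 3 3)"
  proof (rule blk_eqI[OF b(3)])
    show "blk 0 0 b \<otimes>\<^sub>K munit 1 1 + (blk 1 1 b \<otimes>\<^sub>K munit 2 2 + blk 2 2 b \<otimes>\<^sub>K munit 3 3) \<in> M3 (Suc n)"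
      by (intro add_carrier_mat k)
    fix l l' :: nat assume l: "l < 3" "l' < 3"
    show "blk l l' b = blk l l' (blk 0 0 b \<otimes>\<^sub>K munit 1 1 + (blk 1 1 b \<otimes>\<^sub>K munit 2 2 + blk 2 2 b \<otimes>\<^sub>K munit 3 3))"
      unfolding blk_add[OF k add_carrier_mat[OF k] l] blk_add[OF k k l] blk_kron[OF x munit_carrier l]
      using l bdiag_blk[OF b(1) l] unfolding less_3_iff
      by (auto simp: index_munit zero_smult_M3[OF x] one_smult_mat left_add_zero_mat[OF x] right_add_zero_mat[OF x] simp del: One_nat_def)
  qed
  \<comment> \<open>The indices 3, 4, 5 are j + 2 for j = 1, 2, 3; modulo 3 the last two are 1 and
    2.\<close>
  have 2: "blk 2 2 a = blk 0 0 b \<otimes>\<^sub>K munit 3 3 + (blk 1 1 b \<otimes>\<^sub>K munit 4 4 + blk 2 2 b \<otimes>\<^sub>K munit 5 5)"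
  proof (rule blk_eqI[OF b(4)])
    show "blk 0 0 b \<otimes>\<^sub>K munit 3 3 + (blk 1 1 b \<otimes>\<^sub>K munit 4 4 + blk 2 2 b \<otimes>\<^sub>K munit 5 5) \<in> M3 (Suc n)"
      by (intro add_carrier_mat k)
    fix l l' :: nat assume l: "l < 3" "l' < 3"
    show "blk l l' (blk 2 2 a) = blk l l' (blk 0 0 b \<otimes>\<^sub>K munit 3 3 + (blk 1 1 b \<otimes>\<^sub>K munit 4 4 + blk 2 2 b \<otimes>\<^sub>K munit 5 5))"
      unfolding blk_add[OF k add_carrier_mat[OF k] l] blk_add[OF k k l] blk_kron[OF x munit_carrier l]
      using l bdiag_blk[OF b(2) l] shift[symmetric] unfolding less_3_iff
      by (auto simp: index_munit zero_smult_M3[OF x] one_smult_mat left_add_zero_mat[OF x] right_add_zero_mat[OF x] simp del: One_nat_def)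
  qed
  fix l l' :: nat assume l: "l < 3" "l' < 3"
  have "blk l l' (?p + (?x + (?y + ?z))) = blk l l' ?p + (blk l l' ?x + (blk l l' ?y + blk l l' ?z))"
    by (simp only: blk_add[OF t(1) add_carrier_mat[OF add_carrier_mat[OF t(4)]] l]
        blk_add[OF t(2) add_carrier_mat[OF t(4)] l] blk_add[OF t(3,4) l])
  also have "\<dots> = blk l l' a"
    unfolding b_def[symmetric] blk_pad1[OF s l] blk_kron_beta_1[OF x l]
    using l bdiag_blk[OF a(2) l] 0 2 s left_add_zero_mat[OF b(3)] left_add_zero_mat[OF b(4)] unfolding less_3_iff
    by (auto simp: slice_last_eq_blk b_def[symmetric] simp del: One_nat_def)
  finally show "blk l l' a = blk l l' (?p + (?x + (?y + ?z)))" by simp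
qed

section \<open>Iterated embeddings and slices\<close>

primrec emb :: "nat \<Rightarrow> complex mat \<Rightarrow> complex mat" where
  "emb 0 x = x"
| "emb (Suc k) x = emb k x \<otimes>\<^sub>K 1\<^sub>m 3"

lemma kron_one_carrier: "x \<in> M3 n \<Longrightarrow> x \<otimes>\<^sub>K 1\<^sub>m 3 \<in> M3 (Suc n)"
  by (intro kron_carrier_3 one_carrier_mat)

lemma emb_carrier: "x \<in> M3 n \<Longrightarrow> emb k x \<in> M3 (n + k)"
  by (induction k) (auto intro: kron_one_carrier)

lemma pad_carrier: "x \<in> M3 n \<Longrightarrow> (pad1 ^^ k) x \<in> M3 (n + k)"
  by (induction k) (auto intro: pad1_carrier)

lemma slice_last_carrier: "x \<in> M3 (Suc n) \<Longrightarrow> slice_last x \<in> M3 n"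
  by (simp add: slice_last_eq_blk blk_carrier)

lemma slice_last_pad1: "x \<in> M3 n \<Longrightarrow> slice_last (pad1 x) = x"
  using blk_pad1[of x n 1 1] by (simp add: slice_last_eq_blk)

lemma slice_last_kron_one: "x \<in> M3 n \<Longrightarrow> slice_last (x \<otimes>\<^sub>K 1\<^sub>m 3) = x"
  using blk_kron_one[of x n 1 1] by (simp add: slice_last_eq_blk)

lemma slice_pow_carrier: "x \<in> M3 (n + k) \<Longrightarrow> (slice_last ^^ k) x \<in> M3 n"
proof (induction k arbitrary: x)
  case (Suc k)
  then show ?case using slice_last_carrier[of x "n + k"] by (simp add: funpow_swap1)
qed simp

lemma slice_pow_pad: "x \<in> M3 n \<Longrightarrow> (slice_last ^^ k) ((pad1 ^^ k) x) = x"
proof (induction k)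
  case (Suc k)
  have "(slice_last ^^ Suc k) ((pad1 ^^ Suc k) x) = (slice_last ^^ k) (slice_last (pad1 ((pad1 ^^ k) x)))"
    by (simp only: funpow.simps comp_def funpow_swap1)
  then show ?case using slice_last_pad1[OF pad_carrier[OF Suc.prems]] Suc by simp
qed simp

lemma slice_pow_emb: "x \<in> M3 n \<Longrightarrow> (slice_last ^^ k) (emb k x) = x"
proof (induction k)
  case (Suc k)
  have "(slice_last ^^ Suc k) (emb (Suc k) x) = (slice_last ^^ k) (slice_last (emb k x \<otimes>\<^sub>K 1\<^sub>m 3))"
    by (simp only: funpow.simps comp_def funpow_swap1 emb.simps)
  then show ?case using slice_last_kron_one[OF emb_carrier[OF Suc.prems]] Suc by simp
qed simp

lemma slice_pow_add:
  "x \<in> M3 (n + k) \<Longrightarrow> y \<in> M3 (n + k) \<Longrightarrow> (slice_last ^^ k) (x + y) = (slice_last ^^ k) x + (slice_last ^^ k) y"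
proof (induction k arbitrary: x y)
  case (Suc k)
  then have "slice_last (x + y) = slice_last x + slice_last y"
    using blk_add[of x "n + k" y 1 1] by (simp add: slice_last_eq_blk)
  then show ?case
    using Suc slice_last_carrier[of _ "n + k"] by (simp add: funpow_swap1)
qed simp

lemma slice_pow_smult: "x \<in> M3 (n + k) \<Longrightarrow> (slice_last ^^ k) (c \<cdot>\<^sub>m x) = c \<cdot>\<^sub>m (slice_last ^^ k) x"
proof (induction k arbitrary: x)
  case (Suc k)
  then have "slice_last (c \<cdot>\<^sub>m x) = c \<cdot>\<^sub>m slice_last x"
    using blk_smult[of x "n + k" 1 1] by (simp add: slice_last_eq_blk)
  then show ?case
    using Suc slice_last_carrier[of _ "n + k"] by (simp add: funpow_swap1)
qed simp

lemma slice_pow_adjoint: "x \<in> M3 (n + k) \<Longrightarrow> (slice_last ^^ k) (mat_adjoint x) = mat_adjoint ((slice_last ^^ k) x)"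
proof (induction k arbitrary: x)
  case (Suc k)
  then have "slice_last (mat_adjoint x) = mat_adjoint (slice_last x)"
    using blk_mat_adjoint[of x "n + k" 1 1] by (simp add: slice_last_eq_blk)
  then show ?case
    using Suc slice_last_carrier[of _ "n + k"] by (simp add: funpow_swap1)
qed simp

section \<open>Products and compressions of padded matrices\<close>

lemma pad1_bdiag: "x \<in> M3 n \<Longrightarrow> pad1 x \<in> bdiag n"
  unfolding bdiag_def using pad1_carrier[of x n] by (auto simp: blk_pad1)

lemma kron_one_bdiag: "x \<in> M3 n \<Longrightarrow> x \<otimes>\<^sub>K 1\<^sub>m 3 \<in> bdiag n"
  unfolding bdiag_def using kron_one_carrier[of x n] by (auto simp: blk_kron_one)

lemma blk_mult_bdiag_right:
  assumes "a \<in> M3 (Suc n)" "b \<in> bdiag n" "l < 3" "l' < 3"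
  shows "blk l l' (a * b) = blk l l' a * blk l' l' b"
proof -
  have c: "blk m m' a \<in> M3 n" "blk m m' b \<in> M3 n" for m m'
    using assms by (auto intro: blk_carrier bdiag_carrier)
  have "blk l l' (a * b) = blk l 0 a * blk 0 l' b + blk l 1 a * blk 1 l' b + blk l 2 a * blk 2 l' b"
    using assms bdiag_carrier by (intro blk_mult) auto
  also have "\<dots> = blk l l' a * blk l' l' b"
    using assms(4) bdiag_blk[OF assms(2) _ assms(4)] c[of l l'] c[of l' l'] c(1)
    by (auto simp: less_3_iff right_mult_zero_mat[OF c(1)] left_add_zero_mat[OF mult_carrier_mat[OF c]]
        right_add_zero_mat[OF mult_carrier_mat[OF c]])
  finally show ?thesis .
qed

lemma pad1_mult_kron_one:
  assumes "x \<in> M3 n" "y \<in> M3 n"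
  shows "pad1 (x * y) = pad1 x * (y \<otimes>\<^sub>K 1\<^sub>m 3)"
proof (rule blk_eqI)
  have xy: "x * y \<in> M3 n" using assms by auto
  show "pad1 (x * y) \<in> M3 (Suc n)" by (rule pad1_carrier[OF xy])
  show "pad1 x * (y \<otimes>\<^sub>K 1\<^sub>m 3) \<in> M3 (Suc n)"
    by (intro mult_carrier_mat[of _ "3 ^ Suc n" "3 ^ Suc n"] pad1_carrier kron_one_carrier assms)
  fix l l' :: nat assume l: "l < 3" "l' < 3"
  have "blk l l' (pad1 x * (y \<otimes>\<^sub>K 1\<^sub>m 3)) = blk l l (pad1 x) * blk l l' (y \<otimes>\<^sub>K 1\<^sub>m 3)"
    using assms l by (intro blk_mult_bdiag pad1_bdiag kron_one_carrier)
  then show "blk l l' (pad1 (x * y)) = blk l l' (pad1 x * (y \<otimes>\<^sub>K 1\<^sub>m 3))"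
    using assms l by (auto simp: blk_pad1[OF xy] blk_pad1[OF assms(1)] blk_kron_one[OF assms(2)]
        left_mult_zero_mat[OF assms(2)] right_mult_zero_mat[OF assms(1)])
qed

lemma pad1_mult:
  assumes "x \<in> M3 n" "y \<in> M3 n"
  shows "pad1 (x * y) = pad1 x * pad1 y"
proof (rule blk_eqI)
  have xy: "x * y \<in> M3 n" using assms by auto
  show "pad1 (x * y) \<in> M3 (Suc n)" by (rule pad1_carrier[OF xy])
  show "pad1 x * pad1 y \<in> M3 (Suc n)"
    by (intro mult_carrier_mat[of _ "3 ^ Suc n" "3 ^ Suc n"] pad1_carrier assms)
  fix l l' :: nat assume l: "l < 3" "l' < 3"
  have "blk l l' (pad1 x * pad1 y) = blk l l (pad1 x) * blk l l' (pad1 y)"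
    using assms l by (intro blk_mult_bdiag pad1_bdiag pad1_carrier)
  then show "blk l l' (pad1 (x * y)) = blk l l' (pad1 x * pad1 y)"
    using assms l by (auto simp: blk_pad1[OF xy] blk_pad1[OF assms(1)] blk_pad1[OF assms(2)]
        left_mult_zero_mat[OF assms(2)] right_mult_zero_mat[OF assms(1)])
qed

text \<open>Padded matrices live in the corner of the projection 1 \<otimes> e_22, so between two of
  them only the e_22-block of a survives. In this way a slice becomes a product in the algebra,
  where norms can be estimated.\<close>

lemma pad1_compress:
  assumes "x \<in> M3 n" "y \<in> M3 n" "a \<in> M3 (Suc n)"
  shows "pad1 x * a * pad1 y = pad1 (x * slice_last a * y)"
proof (rule blk_eqI)
  have s: "slice_last a \<in> M3 n" by (rule slice_last_carrier[OF assms(3)])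
  have xs: "x * slice_last a \<in> M3 n" "x * slice_last a * y \<in> M3 n" using assms s by auto
  show "pad1 (x * slice_last a * y) \<in> M3 (Suc n)" by (rule pad1_carrier[OF xs(2)])
  have xa: "pad1 x * a \<in> M3 (Suc n)"
    by (intro mult_carrier_mat[of _ "3 ^ Suc n" "3 ^ Suc n"] pad1_carrier assms)
  show "pad1 x * a * pad1 y \<in> M3 (Suc n)"
    by (intro mult_carrier_mat[of _ "3 ^ Suc n" "3 ^ Suc n"] pad1_carrier xa assms)
  fix l l' :: nat assume l: "l < 3" "l' < 3"
  have b: "blk m m' a \<in> M3 n" for m m' using blk_carrier[OF assms(3)] .
  have "blk l l' (pad1 x * a * pad1 y) = blk l l (pad1 x) * blk l l' a * blk l' l' (pad1 y)"
    using blk_mult_bdiag_right[OF xa pad1_bdiag[OF assms(2)] l] blk_mult_bdiag[OF pad1_bdiag[OF assms(1)] assms(3) l]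
    by simp
  then show "blk l l' (pad1 x * a * pad1 y) = blk l l' (pad1 (x * slice_last a * y))"
    using l by (auto simp: blk_pad1[OF xs(2), unfolded slice_last_eq_blk] blk_pad1[OF assms(1)] blk_pad1[OF assms(2)] slice_last_eq_blk
        left_mult_zero_mat[OF b] left_mult_zero_mat[OF assms(2)]
        right_mult_zero_mat[OF mult_carrier_mat[OF assms(1) b]] simp del: One_nat_def)
qed

lemma pad_mult_emb:
  "x \<in> M3 n \<Longrightarrow> y \<in> M3 n \<Longrightarrow> (pad1 ^^ k) (x * y) = (pad1 ^^ k) x * emb k y"
  by (induction k) (simp_all add: pad1_mult_kron_one[OF pad_carrier emb_carrier])

lemma pad_mult:
  "x \<in> M3 n \<Longrightarrow> y \<in> M3 n \<Longrightarrow> (pad1 ^^ k) (x * y) = (pad1 ^^ k) x * (pad1 ^^ k) y"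
  by (induction k) (simp_all add: pad1_mult[OF pad_carrier pad_carrier])

lemma pad1_adjoint: "x \<in> M3 n \<Longrightarrow> pad1 (mat_adjoint x) = mat_adjoint (pad1 x)"
proof (rule blk_eqI)
  assume x: "x \<in> M3 n"
  note ax = mat_adjoint_carrier[OF x]
  show "pad1 (mat_adjoint x) \<in> M3 (Suc n)" "mat_adjoint (pad1 x) \<in> M3 (Suc n)"
    by (intro pad1_carrier mat_adjoint_carrier x)+
  show "blk l l' (pad1 (mat_adjoint x)) = blk l l' (mat_adjoint (pad1 x))" if "l < 3" "l' < 3" for l l'
    using that by (simp add: blk_mat_adjoint[OF pad1_carrier[OF x]] blk_pad1[OF x] blk_pad1[OF ax] mat_adjoint_simps)
qed

lemma pad_adjoint: "x \<in> M3 n \<Longrightarrow> (pad1 ^^ k) (mat_adjoint x) = mat_adjoint ((pad1 ^^ k) x)"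
  by (induction k) (simp_all add: pad1_adjoint[OF pad_carrier])

lemma pad_compress:
  "x \<in> M3 n \<Longrightarrow> y \<in> M3 n \<Longrightarrow> a \<in> M3 (n + k) \<Longrightarrow>
    (pad1 ^^ k) x * a * (pad1 ^^ k) y = (pad1 ^^ k) (x * (slice_last ^^ k) a * y)"
proof (induction k arbitrary: a)
  case (Suc k)
  have a: "slice_last a \<in> M3 (n + k)" using Suc.prems(3) by (intro slice_last_carrier) simp
  have "(pad1 ^^ Suc k) x * a * (pad1 ^^ Suc k) y = pad1 ((pad1 ^^ k) x * slice_last a * (pad1 ^^ k) y)"
    using Suc.prems pad1_compress[OF pad_carrier[OF Suc.prems(1)] pad_carrier[OF Suc.prems(2)]] by simp
  also have "\<dots> = (pad1 ^^ Suc k) (x * (slice_last ^^ Suc k) a * y)"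
    using Suc.IH[OF Suc.prems(1,2) a] by (simp add: funpow_swap1)
  finally show ?case .
qed simp

lemma pad_smult: "x \<in> M3 n \<Longrightarrow> (pad1 ^^ k) (c \<cdot>\<^sub>m x) = c \<cdot>\<^sub>m (pad1 ^^ k) x"
proof (induction k)
  case (Suc k)
  have "pad1 (c \<cdot>\<^sub>m y) = c \<cdot>\<^sub>m pad1 y" if y: "y \<in> M3 m" for y m
  proof (rule blk_eqI)
    note cy = smult_carrier_mat[OF y, of c]
    show "pad1 (c \<cdot>\<^sub>m y) \<in> M3 (Suc m)" "c \<cdot>\<^sub>m pad1 y \<in> M3 (Suc m)"
      by (intro pad1_carrier smult_carrier_mat y)+
    show "blk l l' (pad1 (c \<cdot>\<^sub>m y)) = blk l l' (c \<cdot>\<^sub>m pad1 y)" if "l < 3" "l' < 3" for l l'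
      using that by (simp add: blk_smult[OF pad1_carrier[OF y]] blk_pad1[OF y] blk_pad1[OF cy])
  qed
  from this[OF pad_carrier[OF Suc.prems]] show ?case using Suc by simp
qed simp

lemma A_mat_pad: "c \<in> A_mat n \<Longrightarrow> (pad1 ^^ k) c \<in> A_mat (n + k)"
  by (induction k) (simp_all add: A_mat_pad1 del: A_mat.simps)

lemma A_mat_slice_pow: "a \<in> A_mat (n + k) \<Longrightarrow> (slice_last ^^ k) a \<in> A_mat n"
proof (induction k arbitrary: a)
  case (Suc k)
  then show ?case using slice_last_A_mat[of a "n + k"] by (simp add: funpow_swap1 del: A_mat.simps)
qed simp

lemma A_mat_slice_pow_mult:
  "a \<in> A_mat (n + k) \<Longrightarrow> b \<in> A_mat (n + k) \<Longrightarrow> (slice_last ^^ k) (a * b) = (slice_last ^^ k) a * (slice_last ^^ k) b"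
proof (induction k arbitrary: a b)
  case (Suc k)
  then show ?case
    using slice_last_A_mat[of _ "n + k"] slice_last_mult_A_mat[of a "n + k" b]
    by (simp add: funpow_swap1 del: A_mat.simps)
qed simp

text \<open>Although \<open>\<A>\<^sub>n\<^sub>+\<^sub>k\<close> is not a module over the first \<open>n\<close> tensor factors, the kernel of the
  iterated slice is.\<close>

lemma emb_mult_A_mat:
  assumes "x \<in> M3 n" "a \<in> A_mat (n + k)" "(slice_last ^^ k) a = 0\<^sub>m (3 ^ Suc n) (3 ^ Suc n)"
  shows "emb (Suc k) x * a \<in> A_mat (n + k)
    \<and> (slice_last ^^ k) (emb (Suc k) x * a) = 0\<^sub>m (3 ^ Suc n) (3 ^ Suc n)"
  using assms(2,3)
proof (induction k arbitrary: a)
  \<comment> \<open>For k = 0 the hypothesis says a = 0; a general element of \<open>A_mat n\<close>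
    would not remain there under left multiplication.\<close>
  case 0
  have "emb (Suc 0) x * 0\<^sub>m (3 ^ Suc n) (3 ^ Suc n) = 0\<^sub>m (3 ^ Suc n) (3 ^ Suc n)"
    using emb_carrier[OF assms(1), of "Suc 0"] by (intro right_mult_zero_mat) simp
  then show ?case using 0 A_mat_zero[of n] by simp
next
  case (Suc k)
  \<comment> \<open>The relations that define \<open>A_mat\<close> couple blocks of the last two
    tensor factors. Since \<open>emb (Suc k)\<close> is used, y is itself of the form emb k x
    \<otimes> 1, so y \<otimes> 1 is trivial on both of these factors and multiplies all coupled
    blocks by the same matrix \<open>emb k x\<close>.\<close>
  define y where "y = emb (Suc k) x"
  have ec: "emb k x \<in> M3 (n + k)" using emb_carrier[OF assms(1)] .
  have y: "y \<in> M3 (Suc (n + k))" "y \<in> bdiag (n + k)"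
    using kron_one_bdiag[OF ec] bdiag_carrier by (auto simp: y_def)
  have y': "y \<otimes>\<^sub>K 1\<^sub>m 3 \<in> bdiag (Suc (n + k))" by (rule kron_one_bdiag[OF y(1)])
  have a: "a \<in> A_mat (Suc (n + k))" using Suc.prems(1) by simp
  have a': "a \<in> bdiag (Suc (n + k))" "blk 0 0 a \<in> bdiag (n + k)" "blk 2 2 a \<in> bdiag (n + k)"
    "\<And>d. d < 3 \<Longrightarrow> blk d d (blk 0 0 a) = blk ((d + 2) mod 3) ((d + 2) mod 3) (blk 2 2 a)"
    using a by auto
  have b: "blk l l' ((y \<otimes>\<^sub>K 1\<^sub>m 3) * a) = y * blk l l' a" if "l < 3" "l' < 3" for l l'
    using blk_mult_bdiag[OF y' bdiag_carrier[OF a'(1)] that] blk_kron_one[OF y(1) that(1) that(1)] by simp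
  have IH: "y * slice_last a \<in> A_mat (n + k)
      \<and> (slice_last ^^ k) (y * slice_last a) = 0\<^sub>m (3 ^ Suc n) (3 ^ Suc n)"
    unfolding y_def using Suc.prems(2) slice_last_A_mat[OF a] by (intro Suc.IH) (simp_all add: funpow_swap1)
  have inner: "blk d d (y * c) = emb k x * blk d d c" if "d < 3" "c \<in> bdiag (n + k)" for d c
    using blk_mult_bdiag[OF y(2) bdiag_carrier[OF that(2)] that(1) that(1)] blk_kron_one[OF ec that(1) that(1)]
    by (simp add: y_def)
  have shift: "blk d d (y * blk 0 0 a) = blk ((d + 2) mod 3) ((d + 2) mod 3) (y * blk 2 2 a)" if "d < 3" for d
    using inner[OF that a'(2)] inner[of "(d + 2) mod 3", OF _ a'(3)] a'(4)[OF that] by simp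
  have "(y \<otimes>\<^sub>K 1\<^sub>m 3) * a \<in> bdiag (Suc (n + k))" by (rule bdiag_mult[OF y' a'(1)])
  moreover have "y * blk 0 0 a \<in> bdiag (n + k)" "y * blk 2 2 a \<in> bdiag (n + k)"
    by (intro bdiag_mult y a')+
  ultimately have "(y \<otimes>\<^sub>K 1\<^sub>m 3) * a \<in> A_mat (Suc (n + k))"
    using IH shift b[of 0 0] b[of 1 1] b[of 2 2] by (simp add: slice_last_eq_blk)
  moreover have "(slice_last ^^ Suc k) ((y \<otimes>\<^sub>K 1\<^sub>m 3) * a) = 0\<^sub>m (3 ^ Suc n) (3 ^ Suc n)"
    using IH b[of 1 1] by (simp add: funpow_swap1 slice_last_eq_blk)
  ultimately show ?case by (simp add: y_def del: A_mat.simps)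
qed

section \<open>Norms in \<open>UHF(3\<^sup>\<infinity>)\<close>\<close>

definition unit_mat :: "nat \<Rightarrow> nat \<Rightarrow> nat \<Rightarrow> complex mat" where
  "unit_mat n i j = mat (3 ^ n) (3 ^ n) (\<lambda>p. if p = (i, j) then 1 else 0)"

lemma unit_mat_carrier [simp]: "unit_mat n i j \<in> M3 n"
  by (simp add: unit_mat_def)

lemma index_unit_mat:
  "r < 3 ^ n \<Longrightarrow> c < 3 ^ n \<Longrightarrow> unit_mat n i j $$ (r, c) = (if r = i \<and> c = j then 1 else 0)"
  by (simp add: unit_mat_def)

lemma unit_mat_mult:
  assumes "i < 3 ^ n" "j < 3 ^ n" "k < 3 ^ n"
  shows "unit_mat n i j * unit_mat n j k = unit_mat n i k"
proof (rule eq_matI)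
  fix r c assume "r < dim_row (unit_mat n i k)" "c < dim_col (unit_mat n i k)"
  then have rc: "r < 3 ^ n" "c < 3 ^ n" by (auto simp: unit_mat_def)
  have "(unit_mat n i j * unit_mat n j k) $$ (r, c)
      = (\<Sum>t = 0..<3 ^ n. unit_mat n i j $$ (r, t) * unit_mat n j k $$ (t, c))"
    using rc by (simp add: scalar_prod_def unit_mat_def)
  also have "\<dots> = (\<Sum>t = 0..<3 ^ n. if t = j then (if r = i \<and> c = k then 1 else 0) else 0)"
    using rc by (intro sum.cong) (auto simp: unit_mat_def)
  also have "\<dots> = unit_mat n i k $$ (r, c)"
    using rc assms by (simp add: unit_mat_def)
  finally show "(unit_mat n i j * unit_mat n j k) $$ (r, c) = unit_mat n i k $$ (r, c)" .
qed (auto simp: unit_mat_def)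

lemma unit_mat_adjoint: "mat_adjoint (unit_mat n i j) = unit_mat n j i"
  by (rule eq_matI) (auto simp: unit_mat_def)

lemma unit_mat_compress:
  assumes "x \<in> M3 n" "i < 3 ^ n" "j < 3 ^ n"
  shows "unit_mat n i i * x * unit_mat n j j = x $$ (i, j) \<cdot>\<^sub>m unit_mat n i j"
proof (rule eq_matI)
  fix r c assume "r < dim_row (x $$ (i, j) \<cdot>\<^sub>m unit_mat n i j)" "c < dim_col (x $$ (i, j) \<cdot>\<^sub>m unit_mat n i j)"
  then have rc: "r < 3 ^ n" "c < 3 ^ n" by (auto simp: unit_mat_def)
  have d: "dim_row x = 3 ^ n" "dim_col x = 3 ^ n" using assms by auto
  have left: "(unit_mat n i i * x) $$ (r, t) = (if r = i then x $$ (i, t) else 0)" if "t < 3 ^ n" for t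
  proof -
    have "(unit_mat n i i * x) $$ (r, t) = (\<Sum>s = 0..<3 ^ n. unit_mat n i i $$ (r, s) * x $$ (s, t))"
      using rc d that by (simp add: scalar_prod_def unit_mat_def)
    also have "\<dots> = (\<Sum>s = 0..<3 ^ n. if s = i then (if r = i then x $$ (i, t) else 0) else 0)"
      using rc by (intro sum.cong) (auto simp: unit_mat_def)
    finally show ?thesis using assms by simp
  qed
  have "(unit_mat n i i * x * unit_mat n j j) $$ (r, c)
      = (\<Sum>t = 0..<3 ^ n. (unit_mat n i i * x) $$ (r, t) * unit_mat n j j $$ (t, c))"
    using rc d by (simp add: scalar_prod_def unit_mat_def)
  also have "\<dots> = (\<Sum>t = 0..<3 ^ n. if t = j then (if r = i \<and> c = j then x $$ (i, j) else 0) else 0)"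
    using rc by (intro sum.cong) (auto simp: index_unit_mat left)
  also have "\<dots> = (x $$ (i, j) \<cdot>\<^sub>m unit_mat n i j) $$ (r, c)"
    using rc assms by (simp add: unit_mat_def)
  finally show "(unit_mat n i i * x * unit_mat n j j) $$ (r, c) = (x $$ (i, j) \<cdot>\<^sub>m unit_mat n i j) $$ (r, c)" .
qed (use assms in \<open>auto simp: unit_mat_def\<close>)

definition col_mat :: "nat \<Rightarrow> (nat \<Rightarrow> complex) \<Rightarrow> complex mat" where
  "col_mat n v = mat (3 ^ n) (3 ^ n) (\<lambda>(i, j). if j = 0 then v i else 0)"

lemma col_mat_carrier [simp]: "col_mat n v \<in> M3 n"
  by (simp add: col_mat_def)

lemma mult_col_mat:
  assumes "y \<in> M3 n"
  shows "y * col_mat n v = col_mat n (\<lambda>i. \<Sum>j<3 ^ n. y $$ (i, j) * v j)"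
  using assms by (intro eq_matI) (auto simp: col_mat_def scalar_prod_def lessThan_atLeast0)

lemma col_mat_gram:
  "mat_adjoint (col_mat n v) * col_mat n v
    = complex_of_real (\<Sum>i<3 ^ n. (cmod (v i))\<^sup>2) \<cdot>\<^sub>m unit_mat n 0 0"
proof (rule eq_matI)
  fix r c assume "r < dim_row (complex_of_real (\<Sum>i<3 ^ n. (cmod (v i))\<^sup>2) \<cdot>\<^sub>m unit_mat n 0 0)"
    "c < dim_col (complex_of_real (\<Sum>i<3 ^ n. (cmod (v i))\<^sup>2) \<cdot>\<^sub>m unit_mat n 0 0)"
  then have rc: "r < 3 ^ n" "c < 3 ^ n" by (auto simp: unit_mat_def)
  have "(mat_adjoint (col_mat n v) * col_mat n v) $$ (r, c)
      = (\<Sum>t<3 ^ n. cnj (col_mat n v $$ (t, r)) * col_mat n v $$ (t, c))"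
    using rc by (simp add: scalar_prod_def col_mat_def lessThan_atLeast0)
  also have "\<dots> = (\<Sum>t<3 ^ n. if r = 0 \<and> c = 0 then complex_of_real ((cmod (v t))\<^sup>2) else 0)"
    using rc by (intro sum.cong refl)
      (auto simp: col_mat_def complex_norm_square mult.commute simp del: of_real_power)
  also have "\<dots> = (complex_of_real (\<Sum>i<3 ^ n. (cmod (v i))\<^sup>2) \<cdot>\<^sub>m unit_mat n 0 0) $$ (r, c)"
    using rc by (auto simp: unit_mat_def)
  finally show "(mat_adjoint (col_mat n v) * col_mat n v) $$ (r, c)
      = (complex_of_real (\<Sum>i<3 ^ n. (cmod (v i))\<^sup>2) \<cdot>\<^sub>m unit_mat n 0 0) $$ (r, c)" .
qed (auto simp: unit_mat_def col_mat_def)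

lemma norm_projection_le_1:
  fixes p :: "'a::cstar_algebra"
  assumes "star p * p = p"
  shows "norm p \<le> 1"
proof (cases "p = 0")
  case False
  have "norm p * norm p = norm p" using norm_star_mult_self[of p] assms by (simp add: power2_eq_square)
  then show ?thesis using False by simp
qed simp

lemma norm_projection_eq_1:
  fixes p :: "'a::cstar_algebra"
  assumes "star p * p = p" "p \<noteq> 0"
  shows "norm p = 1"
  using norm_star_mult_self[of p] assms by (simp add: power2_eq_square)

section \<open>Norm estimates from the C*-identity\<close>

locale uhf3 =
  fixes \<iota> :: "nat \<Rightarrow> complex mat \<Rightarrow> 'a::cstar_algebra"
  assumes uhf: "is_UHF3 \<iota>"
begin

lemma
  shows inj_iota: "inj_on (\<iota> n) (M3 n)"
    and iota_one: "\<iota> n (1\<^sub>m (3 ^ n)) = 1"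
    and iota_add: "x \<in> M3 n \<Longrightarrow> y \<in> M3 n \<Longrightarrow> \<iota> n (x + y) = \<iota> n x + \<iota> n y"
    and iota_mult: "x \<in> M3 n \<Longrightarrow> y \<in> M3 n \<Longrightarrow> \<iota> n (x * y) = \<iota> n x * \<iota> n y"
    and iota_smult: "x \<in> M3 n \<Longrightarrow> \<iota> n (c \<cdot>\<^sub>m x) = c *\<^sub>C \<iota> n x"
    and iota_adjoint: "x \<in> M3 n \<Longrightarrow> \<iota> n (mat_adjoint x) = star (\<iota> n x)"
    and iota_kron_one: "x \<in> M3 n \<Longrightarrow> \<iota> (Suc n) (x \<otimes>\<^sub>K 1\<^sub>m 3) = \<iota> n x"
    and iota_dense: "closure (\<Union>n. \<iota> n ` M3 n) = UNIV"
  using uhf unfolding is_UHF3_def by blast+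

lemma iota_emb: "x \<in> M3 n \<Longrightarrow> \<iota> (n + k) (emb k x) = \<iota> n x"
  by (induction k) (auto simp: iota_kron_one emb_carrier)

lemma iota_zero: "\<iota> n (0\<^sub>m (3 ^ n) (3 ^ n)) = 0"
  using iota_smult[of "1\<^sub>m (3 ^ n)" n 0] by (simp add: zero_smult_M3[of _ n])

lemma iota_diff: "x \<in> M3 n \<Longrightarrow> y \<in> M3 n \<Longrightarrow> \<iota> n (x + (- 1) \<cdot>\<^sub>m y) = \<iota> n x - \<iota> n y"
  using iota_add[of x n "(- 1) \<cdot>\<^sub>m y"] iota_smult[of y n "- 1"] by simp

lemma iota_pad_gram:
  assumes x: "x \<in> M3 n"
  shows "star (\<iota> (n + k) ((pad1 ^^ k) x)) * \<iota> (n + k) ((pad1 ^^ k) x)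
    = \<iota> (n + k) ((pad1 ^^ k) (mat_adjoint x * x))"
  unfolding pad_mult[OF mat_adjoint_carrier[OF x] x]
    iota_mult[OF pad_carrier[OF mat_adjoint_carrier[OF x]] pad_carrier[OF x]]
  unfolding pad_adjoint[OF x] iota_adjoint[OF pad_carrier[OF x]] ..

text \<open>In the algebra, padding is left multiplication by the image of the padded unit matrix,
  which is a projection.\<close>

lemma norm_iota_pad_le:
  assumes "c \<in> M3 n"
  shows "norm (\<iota> (n + k) ((pad1 ^^ k) c)) \<le> norm (\<iota> n c)"
proof -
  have one: "1\<^sub>m (3 ^ n) \<in> M3 n" by simp
  have "norm (\<iota> (n + k) ((pad1 ^^ k) (1\<^sub>m (3 ^ n)))) \<le> 1"
    by (intro norm_projection_le_1) (simp add: iota_pad_gram[OF one] mat_adjoint_simps)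
  moreover have "\<iota> (n + k) ((pad1 ^^ k) c) = \<iota> (n + k) ((pad1 ^^ k) (1\<^sub>m (3 ^ n))) * \<iota> n c"
    using pad_mult_emb[OF one assms, of k] assms
    by (simp add: iota_emb iota_mult[OF pad_carrier[OF one] emb_carrier])
  ultimately show ?thesis
    using norm_mult_ineq[of "\<iota> (n + k) ((pad1 ^^ k) (1\<^sub>m (3 ^ n)))" "\<iota> n c"]
      mult_right_mono[of "norm (\<iota> (n + k) ((pad1 ^^ k) (1\<^sub>m (3 ^ n))))" 1 "norm (\<iota> n c)"] by simp
qed

text \<open>By \<open>col_mat_gram\<close> and the C*-identity the left side is the squared
  Euclidean norm of v times the norm of a padded minimal projection q. Slicing undoes padding and
  \<iota> is injective, hence q \<noteq> 0 and norm q = 1.\<close>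

lemma norm_iota_pad_col:
  "(norm (\<iota> (n + k) ((pad1 ^^ k) (col_mat n v))))\<^sup>2 = (\<Sum>i<3 ^ n. (cmod (v i))\<^sup>2)"
proof -
  define q where "q = \<iota> (n + k) ((pad1 ^^ k) (unit_mat n 0 0))"
  have "unit_mat n 0 0 $$ (0, 0) \<noteq> 0\<^sub>m (3 ^ n) (3 ^ n) $$ (0, 0)" by (simp add: index_unit_mat)
  then have "(slice_last ^^ k) ((pad1 ^^ k) (unit_mat n 0 0)) \<noteq> (slice_last ^^ k) ((pad1 ^^ k) (0\<^sub>m (3 ^ n) (3 ^ n)))"
    unfolding slice_pow_pad[OF unit_mat_carrier] slice_pow_pad[OF zero_carrier_mat] by auto
  then have "(pad1 ^^ k) (unit_mat n 0 0) \<noteq> (pad1 ^^ k) (0\<^sub>m (3 ^ n) (3 ^ n))" by metis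
  then have "q \<noteq> \<iota> (n + k) ((pad1 ^^ k) (0\<^sub>m (3 ^ n) (3 ^ n)))"
    unfolding q_def using inj_onD[OF inj_iota] pad_carrier[OF unit_mat_carrier] pad_carrier[OF zero_carrier_mat] by blast
  moreover have "norm (\<iota> (n + k) ((pad1 ^^ k) (0\<^sub>m (3 ^ n) (3 ^ n)))) \<le> norm (\<iota> n (0\<^sub>m (3 ^ n) (3 ^ n)))"
    by (rule norm_iota_pad_le) simp
  ultimately have "q \<noteq> 0" by (auto simp: iota_zero)
  moreover have "star q * q = q"
    unfolding q_def iota_pad_gram[OF unit_mat_carrier] by (simp add: unit_mat_adjoint unit_mat_mult)
  ultimately have "norm q = 1" by (rule norm_projection_eq_1[rotated])
  have "(norm (\<iota> (n + k) ((pad1 ^^ k) (col_mat n v))))\<^sup>2 = norm (complex_of_real (\<Sum>i<3 ^ n. (cmod (v i))\<^sup>2) *\<^sub>C q)"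
    unfolding norm_star_mult_self[symmetric] iota_pad_gram[OF col_mat_carrier] col_mat_gram
      pad_smult[OF unit_mat_carrier] iota_smult[OF pad_carrier[OF unit_mat_carrier]] q_def ..
  also have "\<dots> = (\<Sum>i<3 ^ n. (cmod (v i))\<^sup>2)"
    unfolding norm_scaleC \<open>norm q = 1\<close> norm_of_real by (simp add: sum_nonneg)
  finally show ?thesis .
qed

text \<open>Encoding a vector as the first column of a matrix turns the operator norm of a compression
  into a norm in the algebra.\<close>

lemma slice_pow_contractive:
  assumes "x \<in> M3 (n + k)"
  shows "(\<Sum>i<3 ^ n. (cmod (\<Sum>j<3 ^ n. (slice_last ^^ k) x $$ (i, j) * v j))\<^sup>2)
    \<le> (norm (\<iota> (n + k) x))\<^sup>2 * (\<Sum>i<3 ^ n. (cmod (v i))\<^sup>2)"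
proof -
  let ?P = "pad1 ^^ k" and ?y = "(slice_last ^^ k) x"
  have one: "1\<^sub>m (3 ^ n) \<in> M3 n" by simp
  have y: "?y \<in> M3 n" by (rule slice_pow_carrier[OF assms])
  have "?P (1\<^sub>m (3 ^ n)) * x * ?P (col_mat n v) = ?P (col_mat n (\<lambda>i. \<Sum>j<3 ^ n. ?y $$ (i, j) * v j))"
    unfolding pad_compress[OF one col_mat_carrier assms] using y by (simp add: mult_col_mat)
  moreover have "\<iota> (n + k) (?P (1\<^sub>m (3 ^ n)) * x * ?P (col_mat n v))
      = \<iota> (n + k) (?P (1\<^sub>m (3 ^ n))) * \<iota> (n + k) x * \<iota> (n + k) (?P (col_mat n v))"
    by (simp only: iota_mult[OF mult_carrier_mat[OF pad_carrier[OF one] assms] pad_carrier[OF col_mat_carrier]]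
        iota_mult[OF pad_carrier[OF one] assms])
  ultimately have "norm (\<iota> (n + k) (?P (col_mat n (\<lambda>i. \<Sum>j<3 ^ n. ?y $$ (i, j) * v j))))
      \<le> norm (\<iota> (n + k) (?P (1\<^sub>m (3 ^ n)))) * norm (\<iota> (n + k) x) * norm (\<iota> (n + k) (?P (col_mat n v)))"
    by (simp add: order_trans[OF norm_mult_ineq mult_right_mono[OF norm_mult_ineq norm_ge_zero]])
  also have "norm (\<iota> (n + k) (?P (1\<^sub>m (3 ^ n)))) \<le> 1"
    using norm_iota_pad_le[OF one, of k] by (simp add: iota_one)
  then have "norm (\<iota> (n + k) (?P (1\<^sub>m (3 ^ n)))) * norm (\<iota> (n + k) x) * norm (\<iota> (n + k) (?P (col_mat n v)))
      \<le> 1 * norm (\<iota> (n + k) x) * norm (\<iota> (n + k) (?P (col_mat n v)))"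
    by (intro mult_right_mono) auto
  finally have "(norm (\<iota> (n + k) (?P (col_mat n (\<lambda>i. \<Sum>j<3 ^ n. ?y $$ (i, j) * v j)))))\<^sup>2
      \<le> (norm (\<iota> (n + k) x) * norm (\<iota> (n + k) (?P (col_mat n v))))\<^sup>2"
    by (intro power_mono) auto
  then show ?thesis unfolding power_mult_distrib norm_iota_pad_col .
qed

lemma slice_pow_entry_le:
  assumes "x \<in> M3 (n + k)" "i < 3 ^ n" "j < 3 ^ n"
  shows "cmod ((slice_last ^^ k) x $$ (i, j)) \<le> norm (\<iota> (n + k) x)"
proof -
  let ?v = "\<lambda>t. if t = j then 1 else (0::complex)"
  have "(\<Sum>t<3 ^ n. (slice_last ^^ k) x $$ (r, t) * ?v t) = (slice_last ^^ k) x $$ (r, j)" for r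
    using assms(3) by (simp add: if_distrib cong: if_cong)
  moreover have "(\<Sum>t<3 ^ n. (cmod (?v t))\<^sup>2) = 1"
    using assms(3) by (simp add: if_distrib[of cmod] if_distrib[of "\<lambda>z. z\<^sup>2"] cong: if_cong)
  ultimately have "(\<Sum>r<3 ^ n. (cmod ((slice_last ^^ k) x $$ (r, j)))\<^sup>2) \<le> (norm (\<iota> (n + k) x))\<^sup>2"
    using slice_pow_contractive[OF assms(1), of ?v] by simp
  moreover have "(cmod ((slice_last ^^ k) x $$ (i, j)))\<^sup>2 \<le> (\<Sum>r<3 ^ n. (cmod ((slice_last ^^ k) x $$ (r, j)))\<^sup>2)"
    using assms(2) by (intro member_le_sum) auto
  ultimately show ?thesis by (meson norm_ge_zero order_trans power2_le_imp_le)
qed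

lemma sum_iota_unit_mat: "(\<Sum>i<3 ^ n. \<iota> n (unit_mat n i i)) = 1"
proof -
  \<comment> \<open>The partial sums of the diagonal matrix units, written as single matrices so
    that no sums over matrices occur.\<close>
  define P where "P m = mat (3 ^ n) (3 ^ n) (\<lambda>(i, j). if i = j \<and> i < m then 1 else (0::complex))" for m
  have "\<iota> n (P m) = (\<Sum>i<m. \<iota> n (unit_mat n i i))" for m
  proof (induction m)
    case 0
    have "P 0 = 0\<^sub>m (3 ^ n) (3 ^ n)" by (rule eq_matI) (auto simp: P_def)
    then show ?case by (simp add: iota_zero)
  next
    case (Suc m)
    have "P (Suc m) = P m + unit_mat n m m"
      by (rule eq_matI) (auto simp: P_def unit_mat_def)
    then show ?case using Suc iota_add[of "P m" n "unit_mat n m m"] by (simp add: P_def)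
  qed
  moreover have "P (3 ^ n) = 1\<^sub>m (3 ^ n)" by (rule eq_matI) (auto simp: P_def)
  ultimately show ?thesis by (metis iota_one)
qed

lemma iota_eq_sum:
  assumes "x \<in> M3 n"
  shows "\<iota> n x = (\<Sum>i<3 ^ n. \<Sum>j<3 ^ n. x $$ (i, j) *\<^sub>C \<iota> n (unit_mat n i j))"
proof -
  have "\<iota> n x = (\<Sum>i<3 ^ n. \<iota> n (unit_mat n i i)) * \<iota> n x * (\<Sum>j<3 ^ n. \<iota> n (unit_mat n j j))"
    by (simp add: sum_iota_unit_mat)
  also have "\<dots> = (\<Sum>i<3 ^ n. \<Sum>j<3 ^ n. \<iota> n (unit_mat n i i) * \<iota> n x * \<iota> n (unit_mat n j j))"
    by (simp only: sum_distrib_left sum_distrib_right) (rule sum.swap)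
  also have "\<dots> = (\<Sum>i<3 ^ n. \<Sum>j<3 ^ n. x $$ (i, j) *\<^sub>C \<iota> n (unit_mat n i j))"
  proof (intro sum.cong refl)
    fix i j assume "i \<in> {..<3 ^ n :: nat}" "j \<in> {..<3 ^ n :: nat}"
    then have "\<iota> n (unit_mat n i i * x * unit_mat n j j) = \<iota> n (x $$ (i, j) \<cdot>\<^sub>m unit_mat n i j)"
      using unit_mat_compress[OF assms, of i j] by simp
    then show "\<iota> n (unit_mat n i i) * \<iota> n x * \<iota> n (unit_mat n j j) = x $$ (i, j) *\<^sub>C \<iota> n (unit_mat n i j)"
      by (simp only: iota_mult[OF mult_carrier_mat[OF unit_mat_carrier assms] unit_mat_carrier]
          iota_mult[OF unit_mat_carrier assms] iota_smult[OF unit_mat_carrier])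
  qed
  finally show ?thesis .
qed

lemma norm_iota_unit_mat_le:
  assumes "i < 3 ^ n" "j < 3 ^ n"
  shows "norm (\<iota> n (unit_mat n i j)) \<le> 1"
proof -
  have "star (\<iota> n (unit_mat n i k)) * \<iota> n (unit_mat n i k) = \<iota> n (unit_mat n k k)" if "k < 3 ^ n" for k
    using assms that iota_mult[OF unit_mat_carrier unit_mat_carrier, of n k i i k] iota_adjoint[OF unit_mat_carrier, of n i k]
    by (simp add: unit_mat_adjoint unit_mat_mult)
  moreover have "norm (\<iota> n (unit_mat n j j)) \<le> 1"
    using iota_mult[OF unit_mat_carrier unit_mat_carrier, of n j j j j] iota_adjoint[OF unit_mat_carrier, of n j j] assms
    by (intro norm_projection_le_1) (simp add: unit_mat_adjoint unit_mat_mult)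
  ultimately have "(norm (\<iota> n (unit_mat n i j)))\<^sup>2 \<le> 1\<^sup>2"
    using assms by (simp flip: norm_star_mult_self)
  then show ?thesis by (rule power2_le_imp_le) simp
qed

text \<open>Crude, but enough to pass from entrywise convergence to norm convergence at a fixed
  level. For faithfulness the loss depending on the dimension is removed later.\<close>

lemma norm_iota_le_sum:
  assumes "x \<in> M3 n"
  shows "norm (\<iota> n x) \<le> (\<Sum>i<3 ^ n. \<Sum>j<3 ^ n. cmod (x $$ (i, j)))"
  unfolding iota_eq_sum[OF assms]
proof (intro sum_norm_le)
  fix i j assume "i \<in> {..<3 ^ n :: nat}" "j \<in> {..<3 ^ n :: nat}"
  then show "norm (x $$ (i, j) *\<^sub>C \<iota> n (unit_mat n i j)) \<le> cmod (x $$ (i, j))"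
    using norm_iota_unit_mat_le[of i n j] by (simp add: norm_scaleC mult_left_le)
qed

end

section \<open>The algebra \<open>\<A>\<^sub>\<infinity>\<close> and its ideals\<close>

declare A_mat.simps(2) [simp del]

context uhf3
begin

lemma subspace_iota_image:
  assumes "L \<subseteq> M3 n" "0\<^sub>m (3 ^ n) (3 ^ n) \<in> L" "\<And>x y. x \<in> L \<Longrightarrow> y \<in> L \<Longrightarrow> x + y \<in> L"
    "\<And>c x. x \<in> L \<Longrightarrow> c \<cdot>\<^sub>m x \<in> L"
  shows "complex_vector.subspace (\<iota> n ` L)"
proof (rule complex_vector.subspaceI)
  show "0 \<in> \<iota> n ` L" using assms(2) iota_zero[of n] by force
  show "a + b \<in> \<iota> n ` L" if "a \<in> \<iota> n ` L" "b \<in> \<iota> n ` L" for a b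
    using that assms(1,3) iota_add by (smt (verit) image_iff subsetD)
  show "c *\<^sub>C a \<in> \<iota> n ` L" if "a \<in> \<iota> n ` L" for a c
    using that assms(1,4) iota_smult by (smt (verit) image_iff subsetD)
qed

section \<open>Identification of \<open>A_mat\<close> with the spans \<A>_n\<close>

lemma A_fin_subset: "A_fin \<iota> n \<subseteq> \<iota> (Suc n) ` A_mat n"
  unfolding A_fin_def Suc_eq_plus1[symmetric]
proof (rule complex_vector.span_minimal)
  show "complex_vector.subspace (\<iota> (Suc n) ` A_mat n)"
    by (intro subspace_iota_image A_mat_zero A_mat_add A_mat_smult) (auto intro: A_mat_carrier)
  have "x \<otimes>\<^sub>K beta k j \<in> A_mat n" if "k \<in> {1..n}" "x \<in> M3 (n - k)" for x k j
    using A_mat_kron_beta[OF that(2), of "k - 1" j] that(1) by simp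
  then show "\<iota> (Suc n) ` ({alpha n j |j. j \<in> {1..3}} \<union>
      {x \<otimes>\<^sub>K beta k j |x k j. j \<in> {1..3} \<and> k \<in> {1..n} \<and> x \<in> M3 (n - k)}) \<subseteq> \<iota> (Suc n) ` A_mat n"
    using A_mat_alpha by (intro image_mono) auto
qed

lemma iota_alpha_in_A_fin: "j \<in> {1..3} \<Longrightarrow> \<iota> (Suc n) (alpha n j) \<in> A_fin \<iota> n"
  unfolding A_fin_def Suc_eq_plus1[symmetric] by (intro complex_vector.span_base imageI UnI1) blast

lemma iota_beta_in_A_fin:
  "j \<in> {1..3} \<Longrightarrow> k \<in> {1..n} \<Longrightarrow> x \<in> M3 (n - k) \<Longrightarrow> \<iota> (Suc n) (x \<otimes>\<^sub>K beta k j) \<in> A_fin \<iota> n"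
  unfolding A_fin_def Suc_eq_plus1[symmetric] by (intro complex_vector.span_base imageI UnI2) blast

lemma subspace_A_fin: "complex_vector.subspace (A_fin \<iota> n)"
  unfolding A_fin_def by (rule complex_vector.subspace_span)

text \<open>Padding sends generators to generators: alpha^n_j to alpha^(n+1)_j and x \<otimes>
  beta^k_j to x \<otimes> beta^(k+1)_j. Padding acts on matrices whereas the span is formed in the
  algebra, so the span argument runs over the image of L, and injectivity of \<iota> leads back to
  the matrix c.\<close>

lemma A_fin_pad1:
  assumes "c \<in> A_mat n" "\<iota> (Suc n) c \<in> A_fin \<iota> n"
  shows "\<iota> (Suc (Suc n)) (pad1 c) \<in> A_fin \<iota> (Suc n)"
proof -
  define L where "L = {c \<in> M3 (Suc n). \<iota> (Suc (Suc n)) (pad1 c) \<in> A_fin \<iota> (Suc n)}"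
  have pad_smult1: "pad1 (d \<cdot>\<^sub>m x) = d \<cdot>\<^sub>m pad1 x" if "x \<in> M3 (Suc n)" for d x
    using pad_smult[OF that, of "Suc 0" d] by simp
  have pad_add1: "pad1 (x + y) = pad1 x + pad1 y" if x: "x \<in> M3 (Suc n)" and y: "y \<in> M3 (Suc n)" for x y
  proof (rule blk_eqI)
    show "pad1 (x + y) \<in> M3 (Suc (Suc n))" "pad1 x + pad1 y \<in> M3 (Suc (Suc n))"
      by (intro pad1_carrier add_carrier_mat x y)+
    show "blk l l' (pad1 (x + y)) = blk l l' (pad1 x + pad1 y)" if "l < 3" "l' < 3" for l l'
      using that by (simp add: blk_add[OF pad1_carrier[OF x] pad1_carrier[OF y]] blk_pad1[OF x] blk_pad1[OF y]
          blk_pad1[OF add_carrier_mat[OF y]])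
  qed
  have "complex_vector.subspace (\<iota> (Suc n) ` L)"
  proof (rule subspace_iota_image)
    show "0\<^sub>m (3 ^ Suc n) (3 ^ Suc n) \<in> L"
      using pad_smult1[of "0\<^sub>m (3 ^ Suc n) (3 ^ Suc n)" 0] complex_vector.subspace_0[OF subspace_A_fin]
        pad1_carrier[of "0\<^sub>m (3 ^ Suc n) (3 ^ Suc n)" "Suc n"]
      by (simp add: L_def zero_smult_M3[of _ "Suc n"] zero_smult_M3[of _ "Suc (Suc n)"] iota_zero)
    show "x + y \<in> L" if "x \<in> L" "y \<in> L" for x y
      using that complex_vector.subspace_add[OF subspace_A_fin]
      by (auto simp: L_def pad_add1 iota_add[OF pad1_carrier pad1_carrier])
    show "d \<cdot>\<^sub>m x \<in> L" if "x \<in> L" for d x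
      using that complex_vector.subspace_scale[OF subspace_A_fin]
      by (auto simp: L_def pad_smult1 iota_smult[OF pad1_carrier])
  qed (auto simp: L_def)
  moreover have "alpha n j \<in> L" if "j \<in> {1..3}" for j
    using that iota_alpha_in_A_fin[of j "Suc n"] A_mat_carrier[OF A_mat_alpha] by (simp add: L_def alpha_Suc)
  moreover have "x \<otimes>\<^sub>K beta k j \<in> L" if j: "j \<in> {1..3}" and k: "k \<in> {1..n}" and x: "x \<in> M3 (n - k)" for x k j
  proof -
    define k' where "k' = k - 1"
    have k': "k = Suc k'" using k by (simp add: k'_def)
    have "x \<otimes>\<^sub>K beta k j \<in> A_mat n"
      using A_mat_kron_beta[OF x, of k' j] k by (simp add: k')
    moreover have "\<iota> (Suc (Suc n)) (x \<otimes>\<^sub>K beta (Suc k) j) \<in> A_fin \<iota> (Suc n)"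
      using j k x by (intro iota_beta_in_A_fin) auto
    ultimately show ?thesis
      using kron_beta_Suc[OF x, of k' j] A_mat_carrier by (simp add: L_def k')
  qed
  ultimately have "A_fin \<iota> n \<subseteq> \<iota> (Suc n) ` L"
    unfolding A_fin_def Suc_eq_plus1[symmetric] by (intro complex_vector.span_minimal image_mono) auto
  then obtain c' where "c' \<in> L" "\<iota> (Suc n) c = \<iota> (Suc n) c'" using assms(2) by auto
  moreover have "c = c'"
    using inj_onD[OF inj_iota calculation(2)] A_mat_carrier[OF assms(1)] calculation(1) by (simp add: L_def)
  ultimately show ?thesis by (simp add: L_def)
qed

lemma A_fin_superset: "a \<in> A_mat n \<Longrightarrow> \<iota> (Suc n) a \<in> A_fin \<iota> n"
proof (induction n arbitrary: a)
  case 0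
  then have a0: "a \<in> bdiag 0" by simp
  then have a: "a \<in> M3 (Suc 0)" by (rule bdiag_carrier)
  have off: "a $$ (l, l') = 0" if "l < 3" "l' < 3" "l \<noteq> l'" for l l'
    using index_blk[OF a, of 0 0 l l'] bdiag_blk[OF a0 that] by simp
  have "a = a $$ (0, 0) \<cdot>\<^sub>m alpha 0 1 + (a $$ (1, 1) \<cdot>\<^sub>m alpha 0 2 + a $$ (2, 2) \<cdot>\<^sub>m alpha 0 3)"
    unfolding alpha_def kron_pow.simps kron_one_1
  proof (rule eq_matI)
    fix i j assume "i < dim_row (a $$ (0, 0) \<cdot>\<^sub>m munit 1 1 + (a $$ (1, 1) \<cdot>\<^sub>m munit 2 2 + a $$ (2, 2) \<cdot>\<^sub>m munit 3 3))"
      "j < dim_col (a $$ (0, 0) \<cdot>\<^sub>m munit 1 1 + (a $$ (1, 1) \<cdot>\<^sub>m munit 2 2 + a $$ (2, 2) \<cdot>\<^sub>m munit 3 3))"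
    then have "i < 3" "j < 3" by (auto simp: munit_def)
    then show "a $$ (i, j) = (a $$ (0, 0) \<cdot>\<^sub>m munit 1 1 + (a $$ (1, 1) \<cdot>\<^sub>m munit 2 2 + a $$ (2, 2) \<cdot>\<^sub>m munit 3 3)) $$ (i, j)"
      using off[of i j] by (auto simp: munit_def less_3_iff)
  qed (use a in \<open>auto simp: munit_def power_Suc\<close>)
  moreover have c: "alpha 0 j \<in> M3 (Suc 0)" for j using A_mat_carrier[OF A_mat_alpha] .
  ultimately have "\<iota> (Suc 0) a = a $$ (0, 0) *\<^sub>C \<iota> (Suc 0) (alpha 0 1)
      + (a $$ (1, 1) *\<^sub>C \<iota> (Suc 0) (alpha 0 2) + a $$ (2, 2) *\<^sub>C \<iota> (Suc 0) (alpha 0 3))"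
    using iota_add[of "a $$ (0, 0) \<cdot>\<^sub>m alpha 0 1" "Suc 0" "a $$ (1, 1) \<cdot>\<^sub>m alpha 0 2 + a $$ (2, 2) \<cdot>\<^sub>m alpha 0 3"]
      iota_add[of "a $$ (1, 1) \<cdot>\<^sub>m alpha 0 2" "Suc 0" "a $$ (2, 2) \<cdot>\<^sub>m alpha 0 3"]
    by (metis add_carrier_mat iota_smult smult_carrier_mat)
  then show ?case
    by (simp add: complex_vector.subspace_add[OF subspace_A_fin] complex_vector.subspace_scale[OF subspace_A_fin]
        iota_alpha_in_A_fin del: One_nat_def)
next
  case (Suc n)
  note a = Suc.prems
  have c: "blk 0 0 a \<in> M3 (Suc n)" "slice_last a \<in> A_mat n"
    using slice_last_A_mat[OF a] A_mat_carrier[OF a] by (auto intro: blk_carrier)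
  have x: "blk d d (blk 0 0 a) \<in> M3 n" for d using c(1) by (rule blk_carrier)
  have b: "blk d d (blk 0 0 a) \<otimes>\<^sub>K beta 1 j \<in> M3 (Suc (Suc n))" for d j by (rule kron_beta_1_carrier[OF x])
  have p: "pad1 (slice_last a) \<in> M3 (Suc (Suc n))" by (rule pad1_carrier[OF A_mat_carrier[OF c(2)]])
  have "\<iota> (Suc (Suc n)) a = \<iota> (Suc (Suc n)) (pad1 (slice_last a))
      + (\<iota> (Suc (Suc n)) (blk 0 0 (blk 0 0 a) \<otimes>\<^sub>K beta 1 1)
        + (\<iota> (Suc (Suc n)) (blk 1 1 (blk 0 0 a) \<otimes>\<^sub>K beta 1 2) + \<iota> (Suc (Suc n)) (blk 2 2 (blk 0 0 a) \<otimes>\<^sub>K beta 1 3)))"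
    by (subst A_mat_Suc_decomp[OF a])
      (simp only: iota_add[OF p add_carrier_mat[OF add_carrier_mat[OF b]]] iota_add[OF b add_carrier_mat[OF b]] iota_add[OF b b])
  moreover have "\<iota> (Suc (Suc n)) (blk d d (blk 0 0 a) \<otimes>\<^sub>K beta 1 j) \<in> A_fin \<iota> (Suc n)" if "j \<in> {1..3}" for d j
    using that x by (intro iota_beta_in_A_fin) auto
  moreover have "\<iota> (Suc (Suc n)) (pad1 (slice_last a)) \<in> A_fin \<iota> (Suc n)"
    by (rule A_fin_pad1[OF c(2) Suc.IH[OF c(2)]])
  ultimately show ?case
    by (simp add: complex_vector.subspace_add[OF subspace_A_fin] del: One_nat_def)
qed

lemma A_fin_eq: "A_fin \<iota> n = \<iota> (Suc n) ` A_mat n"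
  using A_fin_subset A_fin_superset by blast

text \<open>Indexed from level n, so that exactly k slices bring \<open>Z k\<close> into
  \<open>A_mat n\<close>, where \<rho>_n takes its values.\<close>

definition approx :: "nat \<Rightarrow> 'a \<Rightarrow> (nat \<Rightarrow> complex mat) \<Rightarrow> bool" where
  "approx n a Z \<longleftrightarrow> (\<forall>k. Z k \<in> A_mat (n + k)) \<and> (\<lambda>k. \<iota> (Suc (n + k)) (Z k)) \<longlonglongrightarrow> a"

lemma approx_carrier: "approx n a Z \<Longrightarrow> Z k \<in> M3 (Suc (n + k))"
  using A_mat_carrier by (auto simp: approx_def)

lemma approx_exists:
  assumes "a \<in> A_inf \<iota>"
  obtains Z where "approx n a Z"
proof -
  obtain X where X: "\<And>m. X m \<in> A_fin \<iota> m" "X \<longlonglongrightarrow> a" using assms by (auto simp: A_inf_def)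
  then have "\<forall>m. \<exists>z. z \<in> A_mat m \<and> X m = \<iota> (Suc m) z" unfolding A_fin_eq by blast
  then obtain Y where Y: "\<And>m. Y m \<in> A_mat m" "\<And>m. X m = \<iota> (Suc m) (Y m)" by metis
  have "(\<lambda>k. \<iota> (Suc (n + k)) (Y (n + k))) \<longlonglongrightarrow> a"
    using LIMSEQ_ignore_initial_segment[OF X(2), of n] by (simp add: Y(2) add.commute)
  then have "approx n a (\<lambda>k. Y (n + k))" using Y(1) by (simp add: approx_def)
  then show ?thesis by (rule that)
qed

lemma approx_imp_A_inf:
  assumes "approx n a Z"
  shows "a \<in> A_inf \<iota>"
proof -
  \<comment> \<open>Below level n the approximating sequence has no terms; 0 belongs to every \<A>_m
    and does not affect the limit.\<close>
  define X where "X m = (if m < n then 0 else \<iota> (Suc m) (Z (m - n)))" for m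
  have "X m \<in> A_fin \<iota> m" for m
  proof (cases "m < n")
    case True
    then show ?thesis using complex_vector.subspace_0[OF subspace_A_fin] by (simp add: X_def)
  next
    case False
    then have "Z (m - n) \<in> A_mat m" using assms by (auto simp: approx_def dest: spec[of _ "m - n"])
    then show ?thesis using False A_fin_superset by (simp add: X_def)
  qed
  moreover have "(\<lambda>k. X (k + n)) \<longlonglongrightarrow> a"
    using assms by (simp add: X_def approx_def add.commute)
  then have "X \<longlonglongrightarrow> a" by (rule LIMSEQ_offset)
  ultimately show ?thesis by (auto simp: A_inf_def)
qed

lemma approx_add:
  assumes "approx n a Y" "approx n b Z"
  shows "approx n (a + b) (\<lambda>k. Y k + Z k)"
  using assms approx_carrier[OF assms(1)] approx_carrier[OF assms(2)]
  unfolding approx_def by (auto simp: iota_add intro: A_mat_add tendsto_add)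

lemma approx_scaleC:
  assumes "approx n a Y"
  shows "approx n (c *\<^sub>C a) (\<lambda>k. c \<cdot>\<^sub>m Y k)"
  using assms approx_carrier[OF assms(1)]
  unfolding approx_def by (auto simp: iota_smult intro: A_mat_smult tendsto_scaleC)

lemma approx_mult:
  assumes "approx n a Y" "approx n b Z"
  shows "approx n (a * b) (\<lambda>k. Y k * Z k)"
  using assms approx_carrier[OF assms(1)] approx_carrier[OF assms(2)]
  unfolding approx_def by (auto simp: iota_mult intro: A_mat_mult tendsto_mult)

lemma approx_star:
  assumes "approx n a Y"
  shows "approx n (star a) (\<lambda>k. mat_adjoint (Y k))"
  using assms approx_carrier[OF assms(1)]
  unfolding approx_def by (auto simp: iota_adjoint intro: A_mat_adjoint tendsto_star)

lemma one_in_A_inf: "1 \<in> A_inf \<iota>"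
proof (rule approx_imp_A_inf)
  show "approx 0 1 (\<lambda>k. 1\<^sub>m (3 ^ Suc k))"
    using A_mat_one iota_one by (simp add: approx_def)
qed

lemma A_inf_iff_infdist: "a \<in> A_inf \<iota> \<longleftrightarrow> (\<lambda>n. infdist a (A_fin \<iota> n)) \<longlonglongrightarrow> 0"
proof
  assume "a \<in> A_inf \<iota>"
  then obtain X where X: "\<And>n. X n \<in> A_fin \<iota> n" "X \<longlonglongrightarrow> a" by (auto simp: A_inf_def)
  have "(\<lambda>n. dist a (X n)) \<longlonglongrightarrow> 0" using tendsto_dist[OF tendsto_const X(2), of a] by simp
  then show "(\<lambda>n. infdist a (A_fin \<iota> n)) \<longlonglongrightarrow> 0"
    by (rule tendsto_sandwich[OF _ _ tendsto_const, rotated 2]) (simp_all add: infdist_nonneg infdist_le[OF X(1)])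
next
  assume lim: "(\<lambda>n. infdist a (A_fin \<iota> n)) \<longlonglongrightarrow> 0"
  have ne: "A_fin \<iota> n \<noteq> {}" for n using complex_vector.subspace_0[OF subspace_A_fin] by auto
  have "\<exists>x\<in>A_fin \<iota> n. dist a x < infdist a (A_fin \<iota> n) + 1 / Suc n" for n
  proof (rule ccontr)
    assume "\<not> (\<exists>x\<in>A_fin \<iota> n. dist a x < infdist a (A_fin \<iota> n) + 1 / Suc n)"
    then have "infdist a (A_fin \<iota> n) + 1 / Suc n \<le> infdist a (A_fin \<iota> n)"
      by (subst (2) infdist_notempty[OF ne]) (intro cINF_greatest[OF ne], auto simp: not_less)
    then show False by simp
  qed
  then obtain X where X: "\<And>n. X n \<in> A_fin \<iota> n" "\<And>n. dist a (X n) < infdist a (A_fin \<iota> n) + 1 / Suc n" by metis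
  have "(\<lambda>n. infdist a (A_fin \<iota> n) + 1 / Suc n) \<longlonglongrightarrow> 0"
    using tendsto_add[OF lim LIMSEQ_inverse_real_of_nat] by (simp add: inverse_eq_divide)
  then have "(\<lambda>n. dist a (X n)) \<longlonglongrightarrow> 0"
    by (rule tendsto_sandwich[OF _ _ tendsto_const, rotated 2]) (simp_all add: less_imp_le[OF X(2), simplified])
  then have "X \<longlonglongrightarrow> a" by (subst tendsto_dist_iff) (simp add: dist_commute)
  then show "a \<in> A_inf \<iota>" using X(1) by (auto simp: A_inf_def)
qed

lemma closed_A_inf: "closed (A_inf \<iota>)"
proof (unfold closed_sequential_limits, intro allI impI, elim conjE)
  fix f l assume f: "\<forall>k. f k \<in> A_inf \<iota>" "f \<longlonglongrightarrow> l"
  show "l \<in> A_inf \<iota>"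
    unfolding A_inf_iff_infdist
  proof (rule LIMSEQ_I)
    fix r :: real assume r: "0 < r"
    obtain k where k: "dist (f k) l < r / 2"
      using metric_LIMSEQ_D[OF f(2), of "r / 2"] r by auto
    have "(\<lambda>n. infdist (f k) (A_fin \<iota> n)) \<longlonglongrightarrow> 0" using f(1) A_inf_iff_infdist by blast
    then obtain N where N: "\<And>n. n \<ge> N \<Longrightarrow> norm (infdist (f k) (A_fin \<iota> n) - 0) < r / 2"
      using LIMSEQ_D[of _ 0 "r / 2"] r by (metis half_gt_zero)
    have "norm (infdist l (A_fin \<iota> n) - 0) < r" if "n \<ge> N" for n
      using N[OF that] k infdist_triangle[of l "A_fin \<iota> n" "f k"] infdist_nonneg[of l "A_fin \<iota> n"]
      by (simp add: dist_commute)
    then show "\<exists>N. \<forall>n\<ge>N. norm (infdist l (A_fin \<iota> n) - 0) < r" by blast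
  qed
qed

lemma cstar_subalgebra_A_inf: "cstar_subalgebra (A_inf \<iota>)"
proof -
  have "0 \<in> A_inf \<iota>"
    using complex_vector.subspace_0[OF subspace_A_fin] by (auto simp: A_inf_def intro!: exI[of _ "\<lambda>_. 0"])
  then show ?thesis
    unfolding cstar_subalgebra_def
    using closed_A_inf approx_imp_A_inf approx_exists[of _ 0]
    by (auto simp: complex_vector.subspace_def) (meson approx_add approx_scaleC approx_mult approx_star)+
qed

section \<open>Convergence and algebraic rules of the slices\<close>

lemma slice_pow_diff_entry_le:
  assumes x: "x \<in> M3 (n + k)" and y: "y \<in> M3 (n + k)" and ij: "i < 3 ^ n" "j < 3 ^ n"
  shows "cmod ((slice_last ^^ k) x $$ (i, j) - (slice_last ^^ k) y $$ (i, j)) \<le> norm (\<iota> (n + k) x - \<iota> (n + k) y)"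
proof -
  have "(slice_last ^^ k) (x + (- 1) \<cdot>\<^sub>m y) $$ (i, j) = (slice_last ^^ k) x $$ (i, j) - (slice_last ^^ k) y $$ (i, j)"
    using slice_pow_add[OF x smult_carrier_mat[OF y, of "- 1"]] slice_pow_smult[OF y, of "- 1"] slice_pow_carrier[OF y] ij
    by auto
  then show ?thesis
    using slice_pow_entry_le[OF add_carrier_mat[OF smult_carrier_mat[OF y, of "- 1"]] ij, of x]
    by (simp add: iota_diff[OF x y])
qed

text \<open>Terms of different levels are compared by embedding the earlier one unitally into the
  later level: \<iota> does not notice the embedding, and slicing undoes it. The factor 1 fits the
  shape of \<open>Cauchy_dominated\<close>.\<close>

lemma slice_pow_Cauchy:
  assumes X: "\<And>k. X k \<in> M3 (n + k)" and ij: "i < 3 ^ n" "j < 3 ^ n"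
  shows "norm ((slice_last ^^ k) (X k) $$ (i, j) - (slice_last ^^ l) (X l) $$ (i, j))
    \<le> norm (\<iota> (n + k) (X k) - \<iota> (n + l) (X l)) * 1"
proof (induction k l rule: linorder_wlog)
  case (le k l)
  have e: "emb (l - k) (X k) \<in> M3 (n + l)" using emb_carrier[OF X[of k], of "l - k"] le by simp
  have "\<iota> (n + l) (emb (l - k) (X k)) = \<iota> (n + k) (X k)"
    using iota_emb[OF X[of k], of "l - k"] le by simp
  moreover have "(slice_last ^^ l) (emb (l - k) (X k)) = (slice_last ^^ k) ((slice_last ^^ (l - k)) (emb (l - k) (X k)))"
    using le by (simp flip: funpow_add[unfolded comp_def fun_eq_iff, rule_format])
  then have "(slice_last ^^ l) (emb (l - k) (X k)) = (slice_last ^^ k) (X k)"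
    by (simp add: slice_pow_emb[OF X])
  ultimately show ?case
    using slice_pow_diff_entry_le[OF e X[of l] ij] by simp
next
  case (sym k l)
  then show ?case by (simp add: norm_minus_commute)
qed

lemma slice_carrier: "slice \<iota> n a \<in> M3 (Suc n)"
  by (simp add: slice_def)

text \<open>The description in the definition of \<^const>\<open>slice\<close> is proper as soon as one approximating
  sequence exists.\<close>

lemma slice_tendsto_entry:
  assumes X: "\<And>k. X k \<in> M3 (Suc n + k)" "(\<lambda>k. \<iota> (Suc n + k) (X k)) \<longlonglongrightarrow> a"
    and ij: "i < 3 ^ Suc n" "j < 3 ^ Suc n"
  shows "(\<lambda>k. (slice_last ^^ k) (X k) $$ (i, j)) \<longlonglongrightarrow> slice \<iota> n a $$ (i, j)"
proof -
  define c where "c k = (slice_last ^^ k) (X k) $$ (i, j)" for k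
  have "Cauchy c"
    unfolding c_def
    by (rule Cauchy_dominated[OF LIMSEQ_imp_Cauchy[OF X(2)]]) (rule slice_pow_Cauchy[OF X(1) ij])
  then obtain z where z: "c \<longlonglongrightarrow> z" using Cauchy_convergent convergent_def by blast
  have "(THE z. \<exists>X. (\<forall>k. X k \<in> M3 (n + 1 + k)) \<and> (\<lambda>k. \<iota> (n + 1 + k) (X k)) \<longlonglongrightarrow> a \<and>
     (\<lambda>k. (slice_last ^^ k) (X k) $$ (i, j)) \<longlonglongrightarrow> z) = z"
  proof (rule the_equality)
    show "\<exists>X. (\<forall>k. X k \<in> M3 (n + 1 + k)) \<and> (\<lambda>k. \<iota> (n + 1 + k) (X k)) \<longlonglongrightarrow> a \<and>
        (\<lambda>k. (slice_last ^^ k) (X k) $$ (i, j)) \<longlonglongrightarrow> z"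
      using X z by (intro exI[of _ X]) (simp add: c_def[abs_def])
  next
    fix w assume "\<exists>X. (\<forall>k. X k \<in> M3 (n + 1 + k)) \<and> (\<lambda>k. \<iota> (n + 1 + k) (X k)) \<longlonglongrightarrow> a \<and>
        (\<lambda>k. (slice_last ^^ k) (X k) $$ (i, j)) \<longlonglongrightarrow> w"
    then obtain Y where Y: "\<And>k. Y k \<in> M3 (Suc n + k)" "(\<lambda>k. \<iota> (Suc n + k) (Y k)) \<longlonglongrightarrow> a"
      "(\<lambda>k. (slice_last ^^ k) (Y k) $$ (i, j)) \<longlonglongrightarrow> w" by auto
    have "(\<lambda>k. norm (\<iota> (Suc n + k) (Y k) - \<iota> (Suc n + k) (X k))) \<longlonglongrightarrow> norm (a - a)"
      by (intro tendsto_intros X Y)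
    then have "(\<lambda>k. (slice_last ^^ k) (Y k) $$ (i, j) - c k) \<longlonglongrightarrow> 0"
      unfolding c_def
      by (intro norm_le_null[OF slice_pow_diff_entry_le[OF Y(1) X(1) ij]]) simp
    moreover have "(\<lambda>k. (slice_last ^^ k) (Y k) $$ (i, j) - c k) \<longlonglongrightarrow> w - z"
      by (intro tendsto_diff Y z)
    ultimately show "w = z" using LIMSEQ_unique by fastforce
  qed
  then show ?thesis using z ij by (simp add: slice_def c_def[abs_def])
qed

lemma slice_tendsto:
  assumes "approx n a Z" "i < 3 ^ Suc n" "j < 3 ^ Suc n"
  shows "(\<lambda>k. (slice_last ^^ k) (Z k) $$ (i, j)) \<longlonglongrightarrow> slice \<iota> n a $$ (i, j)"
  using assms approx_carrier[OF assms(1)] by (intro slice_tendsto_entry) (auto simp: approx_def)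

lemma slice_eqI:
  assumes "B \<in> M3 (Suc n)" "approx n a Z"
    and "\<And>i j. i < 3 ^ Suc n \<Longrightarrow> j < 3 ^ Suc n \<Longrightarrow> (\<lambda>k. (slice_last ^^ k) (Z k) $$ (i, j)) \<longlonglongrightarrow> B $$ (i, j)"
  shows "slice \<iota> n a = B"
  using slice_carrier[of n a] assms(1) LIMSEQ_unique[OF slice_tendsto[OF assms(2)] assms(3)]
  by (intro eq_matI) auto

lemma index_mult_M3:
  "a \<in> M3 n \<Longrightarrow> b \<in> M3 n \<Longrightarrow> i < 3 ^ n \<Longrightarrow> j < 3 ^ n \<Longrightarrow> (a * b) $$ (i, j) = (\<Sum>t<3 ^ n. a $$ (i, t) * b $$ (t, j))"
  by (auto simp: scalar_prod_def lessThan_atLeast0)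

lemma slice_pow_approx_carrier: "approx n a Z \<Longrightarrow> (slice_last ^^ k) (Z k) \<in> M3 (Suc n)"
  using approx_carrier[of n a Z k] by (intro slice_pow_carrier) simp

lemma slice_add:
  assumes "a \<in> A_inf \<iota>" "b \<in> A_inf \<iota>"
  shows "slice \<iota> n (a + b) = slice \<iota> n a + slice \<iota> n b"
proof -
  obtain Y where Y: "approx n a Y" using approx_exists[OF assms(1)] by blast
  obtain Z where Z: "approx n b Z" using approx_exists[OF assms(2)] by blast
  show ?thesis
  proof (rule slice_eqI[OF add_carrier_mat[OF slice_carrier] approx_add[OF Y Z]])
    fix i j :: nat assume ij: "i < 3 ^ Suc n" "j < 3 ^ Suc n"
    have "(slice_last ^^ k) (Y k + Z k) $$ (i, j) = (slice_last ^^ k) (Y k) $$ (i, j) + (slice_last ^^ k) (Z k) $$ (i, j)" for k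
      using slice_pow_add[of "Y k" "Suc n" k "Z k"] approx_carrier[OF Y, of k] approx_carrier[OF Z, of k]
        slice_pow_approx_carrier[OF Z, of k] ij by (simp add: index_add_M3[of _ "Suc n"])
    moreover have "(slice \<iota> n a + slice \<iota> n b) $$ (i, j) = slice \<iota> n a $$ (i, j) + slice \<iota> n b $$ (i, j)"
      by (rule index_add_M3[OF slice_carrier ij])
    ultimately show "(\<lambda>k. (slice_last ^^ k) (Y k + Z k) $$ (i, j)) \<longlonglongrightarrow> (slice \<iota> n a + slice \<iota> n b) $$ (i, j)"
      using tendsto_add[OF slice_tendsto[OF Y ij] slice_tendsto[OF Z ij]] by simp
  qed
qed

lemma slice_scaleC:
  assumes "a \<in> A_inf \<iota>"
  shows "slice \<iota> n (c *\<^sub>C a) = c \<cdot>\<^sub>m slice \<iota> n a"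
proof -
  obtain Y where Y: "approx n a Y" using approx_exists[OF assms(1)] by blast
  show ?thesis
  proof (rule slice_eqI[OF smult_carrier_mat[OF slice_carrier] approx_scaleC[OF Y]])
    fix i j :: nat assume ij: "i < 3 ^ Suc n" "j < 3 ^ Suc n"
    have "(slice_last ^^ k) (c \<cdot>\<^sub>m Y k) $$ (i, j) = c * (slice_last ^^ k) (Y k) $$ (i, j)" for k
      using slice_pow_smult[of "Y k" "Suc n" k c] approx_carrier[OF Y, of k] slice_pow_approx_carrier[OF Y, of k] ij
      by auto
    moreover have "(c \<cdot>\<^sub>m slice \<iota> n a) $$ (i, j) = c * slice \<iota> n a $$ (i, j)"
      using slice_carrier[of n a] ij by auto
    ultimately show "(\<lambda>k. (slice_last ^^ k) (c \<cdot>\<^sub>m Y k) $$ (i, j)) \<longlonglongrightarrow> (c \<cdot>\<^sub>m slice \<iota> n a) $$ (i, j)"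
      using tendsto_mult_left[OF slice_tendsto[OF Y ij], of c] by simp
  qed
qed

lemma slice_mult:
  assumes "a \<in> A_inf \<iota>" "b \<in> A_inf \<iota>"
  shows "slice \<iota> n (a * b) = slice \<iota> n a * slice \<iota> n b"
proof -
  obtain Y where Y: "approx n a Y" using approx_exists[OF assms(1)] by blast
  obtain Z where Z: "approx n b Z" using approx_exists[OF assms(2)] by blast
  show ?thesis
  proof (rule slice_eqI[OF mult_carrier_mat[OF slice_carrier slice_carrier] approx_mult[OF Y Z]])
    fix i j :: nat assume ij: "i < 3 ^ Suc n" "j < 3 ^ Suc n"
    have "(slice_last ^^ k) (Y k * Z k) = (slice_last ^^ k) (Y k) * (slice_last ^^ k) (Z k)" for k
      using Y Z by (intro A_mat_slice_pow_mult) (auto simp: approx_def)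
    then have "(slice_last ^^ k) (Y k * Z k) $$ (i, j)
        = (\<Sum>t<3 ^ Suc n. (slice_last ^^ k) (Y k) $$ (i, t) * (slice_last ^^ k) (Z k) $$ (t, j))" for k
      by (simp only: index_mult_M3[OF slice_pow_approx_carrier[OF Y] slice_pow_approx_carrier[OF Z] ij])
    moreover have "(\<lambda>k. \<Sum>t<3 ^ Suc n. (slice_last ^^ k) (Y k) $$ (i, t) * (slice_last ^^ k) (Z k) $$ (t, j))
        \<longlonglongrightarrow> (\<Sum>t<3 ^ Suc n. slice \<iota> n a $$ (i, t) * slice \<iota> n b $$ (t, j))"
      using ij by (intro tendsto_sum tendsto_mult slice_tendsto[OF Y] slice_tendsto[OF Z]) auto
    ultimately show "(\<lambda>k. (slice_last ^^ k) (Y k * Z k) $$ (i, j)) \<longlonglongrightarrow> (slice \<iota> n a * slice \<iota> n b) $$ (i, j)"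
      by (simp only: index_mult_M3[OF slice_carrier slice_carrier ij])
  qed
qed

lemma slice_star:
  assumes "a \<in> A_inf \<iota>"
  shows "slice \<iota> n (star a) = mat_adjoint (slice \<iota> n a)"
proof -
  obtain Y where Y: "approx n a Y" using approx_exists[OF assms(1)] by blast
  show ?thesis
  proof (rule slice_eqI[OF mat_adjoint_carrier[OF slice_carrier] approx_star[OF Y]])
    fix i j :: nat assume ij: "i < 3 ^ Suc n" "j < 3 ^ Suc n"
    have "(slice_last ^^ k) (mat_adjoint (Y k)) $$ (i, j) = cnj ((slice_last ^^ k) (Y k) $$ (j, i))" for k
      using slice_pow_adjoint[of "Y k" "Suc n" k] approx_carrier[OF Y, of k] slice_pow_approx_carrier[OF Y, of k] ij
      by auto
    moreover have "mat_adjoint (slice \<iota> n a) $$ (i, j) = cnj (slice \<iota> n a $$ (j, i))"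
      using slice_carrier[of n a] ij by auto
    ultimately show "(\<lambda>k. (slice_last ^^ k) (mat_adjoint (Y k)) $$ (i, j)) \<longlonglongrightarrow> mat_adjoint (slice \<iota> n a) $$ (i, j)"
      using tendsto_cnj[OF slice_tendsto[OF Y ij(2,1)]] by simp
  qed
qed

lemma slice_contractive:
  assumes "a \<in> A_inf \<iota>"
  shows "(\<Sum>i<3 ^ Suc n. (cmod (\<Sum>j<3 ^ Suc n. slice \<iota> n a $$ (i, j) * v j))\<^sup>2)
    \<le> (norm a)\<^sup>2 * (\<Sum>i<3 ^ Suc n. (cmod (v i))\<^sup>2)"
proof -
  obtain Y where Y: "approx n a Y" using approx_exists[OF assms(1)] by blast
  show ?thesis
  proof (rule LIMSEQ_le)
    show "(\<lambda>k. \<Sum>i<3 ^ Suc n. (cmod (\<Sum>j<3 ^ Suc n. (slice_last ^^ k) (Y k) $$ (i, j) * v j))\<^sup>2)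
      \<longlonglongrightarrow> (\<Sum>i<3 ^ Suc n. (cmod (\<Sum>j<3 ^ Suc n. slice \<iota> n a $$ (i, j) * v j))\<^sup>2)"
      by (intro tendsto_sum tendsto_power tendsto_norm tendsto_mult_right slice_tendsto[OF Y]) auto
    show "(\<lambda>k. (norm (\<iota> (Suc (n + k)) (Y k)))\<^sup>2 * (\<Sum>i<3 ^ Suc n. (cmod (v i))\<^sup>2))
      \<longlonglongrightarrow> (norm a)\<^sup>2 * (\<Sum>i<3 ^ Suc n. (cmod (v i))\<^sup>2)"
      using Y unfolding approx_def by (intro tendsto_mult_right tendsto_power tendsto_norm) auto
    show "\<exists>N. \<forall>k\<ge>N. (\<Sum>i<3 ^ Suc n. (cmod (\<Sum>j<3 ^ Suc n. (slice_last ^^ k) (Y k) $$ (i, j) * v j))\<^sup>2)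
      \<le> (norm (\<iota> (Suc (n + k)) (Y k)))\<^sup>2 * (\<Sum>i<3 ^ Suc n. (cmod (v i))\<^sup>2)"
      using slice_pow_contractive[of "Y _" "Suc n" _ v] approx_carrier[OF Y] by auto
  qed
qed

lemma slice_entry_le:
  assumes "a \<in> A_inf \<iota>" "i < 3 ^ Suc n" "j < 3 ^ Suc n"
  shows "cmod (slice \<iota> n a $$ (i, j)) \<le> norm a"
proof -
  obtain Y where Y: "approx n a Y" using approx_exists[OF assms(1)] by blast
  have "(\<lambda>k. \<iota> (Suc (n + k)) (Y k)) \<longlonglongrightarrow> a" using Y by (simp add: approx_def)
  then show ?thesis
    using slice_pow_entry_le[of "Y _" "Suc n", OF _ assms(2,3)] approx_carrier[OF Y]
    by (intro LIMSEQ_le[OF tendsto_norm[OF slice_tendsto[OF Y assms(2,3)]] tendsto_norm]) auto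
qed

section \<open>The kernels of the \<rho>_n and their multipliers\<close>

definition ideal :: "nat \<Rightarrow> 'a set" where
  "ideal n = {a \<in> A_inf \<iota>. slice \<iota> n a = 0\<^sub>m (3 ^ Suc n) (3 ^ Suc n)}"

lemma ideal_subset: "ideal n \<subseteq> A_inf \<iota>"
  by (auto simp: ideal_def)

lemma cstar_subalgebra_ideal: "cstar_subalgebra (ideal n)"
proof -
  note A = cstar_subalgebra_A_inf
  have "closed (ideal n)"
  proof (unfold closed_sequential_limits, intro allI impI, elim conjE)
    fix f l assume f: "\<forall>k. f k \<in> ideal n" "f \<longlonglongrightarrow> l"
    have fA: "f k \<in> A_inf \<iota>" for k using f(1) ideal_subset by blast
    then have l: "l \<in> A_inf \<iota>" using closed_sequentially[OF closed_A_inf _ f(2)] by blast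
    have "slice \<iota> n l $$ (i, j) = 0" if ij: "i < 3 ^ Suc n" "j < 3 ^ Suc n" for i j
    proof -
      have "cmod (slice \<iota> n l $$ (i, j)) \<le> norm (l - f k)" for k
      proof -
        have "l - f k \<in> A_inf \<iota>" by (rule cstar_subalgebra_diff[OF A l fA])
        moreover have "slice \<iota> n l = slice \<iota> n (l - f k) + slice \<iota> n (f k)"
          using slice_add[OF calculation fA[of k]] by simp
        then have "slice \<iota> n l $$ (i, j) = slice \<iota> n (l - f k) $$ (i, j)"
          using f(1) index_add_M3[OF slice_carrier ij, of "slice \<iota> n (l - f k)" "f k"] ij by (auto simp: ideal_def)
        ultimately show ?thesis using slice_entry_le[of "l - f k" i n j] ij by simp
      qed
      moreover have "(\<lambda>k. norm (l - f k)) \<longlonglongrightarrow> norm (l - l)" by (intro tendsto_intros f)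
      ultimately have "cmod (slice \<iota> n l $$ (i, j)) \<le> 0"
        by (intro LIMSEQ_le_const) auto
      then show ?thesis by simp
    qed
    then have "slice \<iota> n l = 0\<^sub>m (3 ^ Suc n) (3 ^ Suc n)"
      using slice_carrier[of n l] by (intro eq_matI) auto
    then show "l \<in> ideal n" using l by (simp add: ideal_def)
  qed
  moreover have "slice \<iota> n 0 = 0\<^sub>m (3 ^ Suc n) (3 ^ Suc n)"
    using slice_scaleC[OF cstar_subalgebra_0[OF A], of n 0] zero_smult_M3[OF slice_carrier] by simp
  ultimately show ?thesis
    unfolding cstar_subalgebra_def ideal_def
    using A by (auto simp: complex_vector.subspace_def cstar_subalgebra_0 cstar_subalgebra_add cstar_subalgebra_scaleC
        cstar_subalgebra_mult cstar_subalgebra_star slice_add slice_scaleC slice_mult slice_star mat_adjoint_simps)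
qed

lemma A_inf_subset_multipliers: "A_inf \<iota> \<subseteq> multipliers (ideal n)"
  using cstar_subalgebra_A_inf right_mult_zero_mat[OF slice_carrier]
  by (auto simp: multipliers_def ideal_def slice_mult cstar_subalgebra_mult cstar_subalgebra_star)

text \<open>Take any approximation and subtract the padded slices. Padding keeps them in
  \<open>A_mat (n + k)\<close> without increasing norms. Their entries tend to those of
  \<open>slice \<iota> n a\<close>, which are 0, and since the size of the slices is fixed this is
  convergence in norm. The slice of the difference is exactly zero.\<close>

lemma ideal_approx:
  assumes "a \<in> ideal n"
  obtains Z where "approx n a Z" "\<And>k. (slice_last ^^ k) (Z k) = 0\<^sub>m (3 ^ Suc n) (3 ^ Suc n)"
proof -
  obtain Y where Y: "approx n a Y" using approx_exists ideal_subset assms by blast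
  define c where "c k = (slice_last ^^ k) (Y k)" for k
  define Z where "Z k = Y k + (- 1) \<cdot>\<^sub>m (pad1 ^^ k) (c k)" for k
  have cA: "c k \<in> A_mat n" for k using Y A_mat_slice_pow by (simp add: c_def approx_def)
  have c: "c k \<in> M3 (Suc n)" for k using cA by (rule A_mat_carrier)
  have pc: "(pad1 ^^ k) (c k) \<in> M3 (Suc (n + k))" for k using pad_carrier[OF c, of k k] by simp
  note Yc = approx_carrier[OF Y]
  have "(\<lambda>k. \<iota> (Suc (n + k)) ((pad1 ^^ k) (c k))) \<longlonglongrightarrow> 0"
  proof (rule norm_le_null)
    show "norm (\<iota> (Suc (n + k)) ((pad1 ^^ k) (c k))) \<le> (\<Sum>i<3 ^ Suc n. \<Sum>j<3 ^ Suc n. cmod (c k $$ (i, j)))" for k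
      using order_trans[OF norm_iota_pad_le[OF c, of k k] norm_iota_le_sum[OF c]] by simp
    have "(\<lambda>k. \<Sum>i<3 ^ Suc n. \<Sum>j<3 ^ Suc n. cmod (c k $$ (i, j)))
      \<longlonglongrightarrow> (\<Sum>i<3 ^ Suc n. \<Sum>j<3 ^ Suc n. cmod (slice \<iota> n a $$ (i, j)))"
      unfolding c_def by (intro tendsto_sum tendsto_norm slice_tendsto[OF Y]) auto
    then show "(\<lambda>k. \<Sum>i<3 ^ Suc n. \<Sum>j<3 ^ Suc n. cmod (c k $$ (i, j))) \<longlonglongrightarrow> 0"
      using assms by (simp add: ideal_def)
  qed
  moreover have "(\<lambda>k. \<iota> (Suc (n + k)) (Y k)) \<longlonglongrightarrow> a" using Y by (simp add: approx_def)
  ultimately have "(\<lambda>k. \<iota> (Suc (n + k)) (Y k) - \<iota> (Suc (n + k)) ((pad1 ^^ k) (c k))) \<longlonglongrightarrow> a - 0"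
    by (intro tendsto_diff)
  then have "(\<lambda>k. \<iota> (Suc (n + k)) (Z k)) \<longlonglongrightarrow> a"
    unfolding Z_def iota_diff[OF Yc pc] by simp
  moreover have "Z k \<in> A_mat (n + k)" for k
    unfolding Z_def using Y by (intro A_mat_add A_mat_smult A_mat_pad cA) (simp add: approx_def)
  ultimately have "approx n a Z" by (simp add: approx_def)
  moreover have "(slice_last ^^ k) (Z k) = 0\<^sub>m (3 ^ Suc n) (3 ^ Suc n)" for k
  proof -
    have "(slice_last ^^ k) (Z k) = c k + (- 1) \<cdot>\<^sub>m c k"
      unfolding Z_def using slice_pow_add[of "Y k" "Suc n" k "(- 1) \<cdot>\<^sub>m (pad1 ^^ k) (c k)"] Yc[of k] pc[of k]
        slice_pow_smult[of "(pad1 ^^ k) (c k)" "Suc n" k "- 1"] slice_pow_pad[OF c, of k k]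
      by (simp add: c_def)
    also have "\<dots> = 0\<^sub>m (3 ^ Suc n) (3 ^ Suc n)"
      using c[of k] by (intro eq_matI) auto
    finally show ?thesis .
  qed
  ultimately show ?thesis by (rule that)
qed

lemma iota_mult_ideal:
  assumes x: "x \<in> M3 n" and a: "a \<in> ideal n"
  shows "\<iota> n x * a \<in> ideal n"
proof -
  obtain Z where Z: "approx n a Z" "\<And>k. (slice_last ^^ k) (Z k) = 0\<^sub>m (3 ^ Suc n) (3 ^ Suc n)"
    using ideal_approx[OF a] by blast
  have e: "emb (Suc k) x \<in> M3 (Suc (n + k))" for k using emb_carrier[OF x, of "Suc k"] by simp
  have i: "\<iota> (Suc (n + k)) (emb (Suc k) x * Z k) = \<iota> n x * \<iota> (Suc (n + k)) (Z k)" for k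
    using iota_emb[OF x, of "Suc k"] by (simp add: iota_mult[OF e approx_carrier[OF Z(1)]] del: emb.simps)
  have m: "emb (Suc k) x * Z k \<in> A_mat (n + k)"
    "(slice_last ^^ k) (emb (Suc k) x * Z k) = 0\<^sub>m (3 ^ Suc n) (3 ^ Suc n)" for k
    using emb_mult_A_mat[OF x, of "Z k" k] Z by (auto simp: approx_def simp del: emb.simps)
  have ap: "approx n (\<iota> n x * a) (\<lambda>k. emb (Suc k) x * Z k)"
    unfolding approx_def i using m(1) Z(1) by (auto simp: approx_def intro: tendsto_mult_left simp del: emb.simps)
  moreover have "slice \<iota> n (\<iota> n x * a) = 0\<^sub>m (3 ^ Suc n) (3 ^ Suc n)"
    by (rule slice_eqI[OF _ ap]) (simp_all add: m(2) del: emb.simps)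
  ultimately show ?thesis using approx_imp_A_inf by (simp add: ideal_def)
qed

text \<open>\<rho>_n is \<rho>_(n+1) followed by one more slice, so entry (i, j) at level n is entry
  (3 * i + 1, 3 * j + 1) at level n + 1.\<close>

lemma decseq_ideal: "decseq ideal"
proof (rule decseq_SucI, rule subsetI)
  fix n a assume "a \<in> ideal (Suc n)"
  then have a: "a \<in> A_inf \<iota>" "slice \<iota> (Suc n) a = 0\<^sub>m (3 ^ Suc (Suc n)) (3 ^ Suc (Suc n))"
    by (auto simp: ideal_def)
  obtain Z where Z: "approx n a Z" using approx_exists[OF a(1)] by blast
  \<comment> \<open>Dropping the first term turns an approximation counted from level n into one
    counted from level n + 1.\<close>
  have Z': "approx (Suc n) a (\<lambda>k. Z (Suc k))"
    using Z LIMSEQ_Suc[of "\<lambda>k. \<iota> (Suc (n + k)) (Z k)" a]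
    by (auto simp: approx_def dest: spec[of _ "Suc _"])
  have "slice \<iota> n a = 0\<^sub>m (3 ^ Suc n) (3 ^ Suc n)"
  proof (rule slice_eqI[OF zero_carrier_mat Z])
    fix i j :: nat assume ij: "i < 3 ^ Suc n" "j < 3 ^ Suc n"
    then have ij': "3 * i + 1 < 3 ^ Suc (Suc n)" "3 * j + 1 < 3 ^ Suc (Suc n)"
      by (auto simp: power_Suc)
    have "(slice_last ^^ Suc k) (Z (Suc k)) $$ (i, j) = (slice_last ^^ k) (Z (Suc k)) $$ (3 * i + 1, 3 * j + 1)" for k
      using index_blk[OF slice_pow_approx_carrier[OF Z', of k] ij, of 1 1] by (simp add: slice_last_eq_blk)
    then have "(\<lambda>k. (slice_last ^^ Suc k) (Z (Suc k)) $$ (i, j)) \<longlonglongrightarrow> 0"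
      using slice_tendsto[OF Z' ij'] ij' by (simp add: a(2) del: funpow.simps)
    then have "(\<lambda>k. (slice_last ^^ k) (Z k) $$ (i, j)) \<longlonglongrightarrow> 0" by (rule LIMSEQ_imp_Suc)
    then show "(\<lambda>k. (slice_last ^^ k) (Z k) $$ (i, j)) \<longlonglongrightarrow> 0\<^sub>m (3 ^ Suc n) (3 ^ Suc n) $$ (i, j)"
      using ij by simp
  qed
  then show "a \<in> ideal n" using a by (simp add: ideal_def)
qed

lemma iota_in_multipliers:
  assumes "x \<in> M3 n" "n \<le> m"
  shows "\<iota> n x \<in> multipliers (ideal m)"
proof -
  have e: "emb (m - n) x \<in> M3 m" using emb_carrier[OF assms(1), of "m - n"] assms(2) by simp
  have "\<iota> m (emb (m - n) x) = \<iota> n x" using iota_emb[OF assms(1), of "m - n"] assms(2) by simp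
  then show ?thesis
    unfolding multipliers_def
    using iota_mult_ideal[OF e] iota_mult_ideal[OF mat_adjoint_carrier[OF e]] iota_adjoint[OF e] by auto
qed

lemma dense_multipliers: "closure {y. \<forall>\<^sub>F n in sequentially. y \<in> multipliers (ideal n)} = UNIV"
proof -
  have "(\<Union>n. \<iota> n ` M3 n) \<subseteq> {y. \<forall>\<^sub>F n in sequentially. y \<in> multipliers (ideal n)}"
    using iota_in_multipliers by (auto simp: eventually_sequentially)
  then show ?thesis using closure_mono iota_dense by blast
qed

end

section \<open>Orthonormal bases of spaces of functions on a finite set\<close>

definition ip :: "'i set \<Rightarrow> ('i \<Rightarrow> complex) \<Rightarrow> ('i \<Rightarrow> complex) \<Rightarrow> complex" where
  "ip X f g = (\<Sum>x\<in>X. cnj (f x) * g x)"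

lemma ip_cnj: "cnj (ip X f g) = ip X g f"
  by (simp add: ip_def mult.commute)

lemma ip_self: "ip X f f = complex_of_real (\<Sum>x\<in>X. (cmod (f x))\<^sup>2)"
  by (simp add: ip_def complex_norm_square mult.commute del: of_real_power)

lemma ip_scale_right: "ip X f (\<lambda>x. c * g x) = c * ip X f g"
  by (simp add: ip_def sum_distrib_left mult.left_commute)

lemma ip_diff_right: "ip X f (\<lambda>x. g x - h x) = ip X f g - ip X f h"
  by (simp add: ip_def sum_subtractf right_diff_distrib)

lemma ip_sum_right: "ip X f (\<lambda>x. \<Sum>k\<in>K. c k * g k x) = (\<Sum>k\<in>K. c k * ip X f (g k))"
  unfolding ip_def sum_distrib_left by (subst sum.swap) (simp add: mult.left_commute)

lemma ip_cong: "(\<And>x. x \<in> X \<Longrightarrow> g x = h x) \<Longrightarrow> ip X f g = ip X f h"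
  by (simp add: ip_def)

definition orthonormal :: "'i set \<Rightarrow> nat \<Rightarrow> (nat \<Rightarrow> 'i \<Rightarrow> complex) \<Rightarrow> bool" where
  "orthonormal X d b \<longleftrightarrow> (\<forall>k<d. \<forall>l<d. ip X (b k) (b l) = (if k = l then 1 else 0))"

lemma orthonormal_ip_sum:
  assumes "orthonormal X d b" "l < d"
  shows "ip X (b l) (\<lambda>x. \<Sum>k<d. c k * b k x) = c l"
proof -
  have "ip X (b l) (\<lambda>x. \<Sum>k<d. c k * b k x) = (\<Sum>k<d. if l = k then c k else 0)"
    unfolding ip_sum_right using assms by (intro sum.cong) (auto simp: orthonormal_def)
  then show ?thesis using assms(2) by simp
qed

lemma orthonormal_residual:
  assumes b: "orthonormal X d b"
  defines "r \<equiv> \<lambda>u x. u x - (\<Sum>k<d. ip X (b k) u * b k x)"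
  shows "l < d \<Longrightarrow> ip X (b l) (r u) = 0"
    and "ip X (r u) (r u) = ip X u u - (\<Sum>k<d. complex_of_real ((cmod (ip X (b k) u))\<^sup>2))"
proof -
  show 1: "ip X (b l) (r u) = 0" if "l < d" for l
    unfolding r_def ip_diff_right orthonormal_ip_sum[OF b that] by simp
  have 2: "ip X (r u) (b l) = 0" if "l < d" for l
    using 1[OF that] ip_cnj[of X "b l" "r u"] by simp
  have "ip X (r u) (r u) = ip X (r u) u"
    unfolding r_def ip_diff_right ip_sum_right using 2 by (simp add: r_def)
  also have "\<dots> = cnj (ip X u (r u))" by (simp add: ip_cnj)
  also have "ip X u (r u) = ip X u u - (\<Sum>k<d. ip X (b k) u * ip X u (b k))"
    unfolding r_def ip_diff_right ip_sum_right ..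
  also have "(\<Sum>k<d. ip X (b k) u * ip X u (b k)) = (\<Sum>k<d. complex_of_real ((cmod (ip X (b k) u))\<^sup>2))"
    by (simp add: complex_norm_square ip_cnj del: of_real_power)
  finally show "ip X (r u) (r u) = ip X u u - (\<Sum>k<d. complex_of_real ((cmod (ip X (b k) u))\<^sup>2))"
    by (simp add: ip_cnj)
qed

text \<open>Bessel's inequality for the unit vectors, summed over \<open>X\<close>.\<close>

lemma orthonormal_card_le:
  assumes X: "finite X" and b: "orthonormal X d b"
  shows "d \<le> card X"
proof -
  have "(\<Sum>k<d. (cmod (b k x))\<^sup>2) \<le> 1" if x: "x \<in> X" for x
  proof -
    define u :: "'a \<Rightarrow> complex" where "u = (\<lambda>y. if y = x then 1 else 0)"
    have u: "ip X f u = cnj (f x)" for f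
      using X x by (simp add: ip_def u_def if_distrib cong: if_cong)
    have "ip X (\<lambda>x. u x - (\<Sum>k<d. ip X (b k) u * b k x)) (\<lambda>x. u x - (\<Sum>k<d. ip X (b k) u * b k x))
        = complex_of_real (1 - (\<Sum>k<d. (cmod (b k x))\<^sup>2))"
      unfolding orthonormal_residual(2)[OF b] by (simp add: u) (simp add: u_def)
    then have "(\<Sum>y\<in>X. (cmod (u y - (\<Sum>k<d. ip X (b k) u * b k y)))\<^sup>2) = 1 - (\<Sum>k<d. (cmod (b k x))\<^sup>2)"
      unfolding ip_self by (simp only: of_real_eq_iff)
    moreover have "0 \<le> (\<Sum>y\<in>X. (cmod (u y - (\<Sum>k<d. ip X (b k) u * b k y)))\<^sup>2)"
      by (intro sum_nonneg) simp
    ultimately show ?thesis by simp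
  qed
  then have "(\<Sum>x\<in>X. \<Sum>k<d. (cmod (b k x))\<^sup>2) \<le> (\<Sum>x\<in>X. 1)" by (rule sum_mono)
  moreover have "(\<Sum>x\<in>X. (cmod (b k x))\<^sup>2) = 1" if "k < d" for k
  proof -
    have "complex_of_real (\<Sum>x\<in>X. (cmod (b k x))\<^sup>2) = complex_of_real 1"
      using b that unfolding ip_self[symmetric] by (simp add: orthonormal_def)
    then show ?thesis by (simp only: of_real_eq_iff)
  qed
  then have "(\<Sum>x\<in>X. \<Sum>k<d. (cmod (b k x))\<^sup>2) = real d" by (subst sum.swap) simp
  ultimately show ?thesis by simp
qed

text \<open>An orthonormal system in F of greatest length, which exists since the lengths are
  bounded by \<open>card X\<close>. If some f in F differed from its expansion at a point of X, the
  normalised remainder, again in F, would prolong the system. Functions count only through their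
  values on X.\<close>

lemma orthonormal_basis_exists:
  fixes F :: "('i \<Rightarrow> complex) set"
  assumes X: "finite X" and F: "\<And>f g. f \<in> F \<Longrightarrow> g \<in> F \<Longrightarrow> (\<lambda>x. f x + g x) \<in> F"
    "\<And>c f. f \<in> F \<Longrightarrow> (\<lambda>x. c * f x) \<in> F"
  obtains d b where "orthonormal X d b" "\<And>k. k < d \<Longrightarrow> b k \<in> F"
    "\<And>f x. f \<in> F \<Longrightarrow> x \<in> X \<Longrightarrow> f x = (\<Sum>k<d. ip X (b k) f * b k x)"
proof -
  define P where "P d \<longleftrightarrow> (\<exists>b. orthonormal X d b \<and> (\<forall>k<d. b k \<in> F))" for d
  have "P 0" by (auto simp: P_def orthonormal_def)
  moreover have bound: "\<forall>d. P d \<longrightarrow> d \<le> card X" using orthonormal_card_le[OF X] by (auto simp: P_def)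
  ultimately have "P (GREATEST d. P d)" using GreatestI_nat[of P 0 "card X"] by auto
  moreover have greatest: "d \<le> (GREATEST d. P d)" if "P d" for d
    using that bound Greatest_le_nat[of P d "card X"] by auto
  moreover define d where "d = (GREATEST d. P d)"
  ultimately have "P d" and max: "\<not> P (Suc d)" by force+
  then obtain b where b: "orthonormal X d b" "\<And>k. k < d \<Longrightarrow> b k \<in> F" unfolding P_def by blast
  have "f x = (\<Sum>k<d. ip X (b k) f * b k x)" if f: "f \<in> F" and x: "x \<in> X" for f x
  proof (rule ccontr)
    assume ne: "f x \<noteq> (\<Sum>k<d. ip X (b k) f * b k x)"
    define r where "r = (\<lambda>x. f x - (\<Sum>k<d. ip X (b k) f * b k x))"
    have rF: "(\<lambda>x. f x - (\<Sum>k<m. c k * b k x)) \<in> F" if "m \<le> d" for m c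
      using that
    proof (induction m)
      case (Suc m)
      have "(\<lambda>x. (f x - (\<Sum>k<m. c k * b k x)) + (- c m) * b m x) \<in> F"
        using Suc b(2) by (intro F) auto
      then show ?case by (simp add: algebra_simps)
    qed (use f in simp)
    define s where "s = (\<Sum>x\<in>X. (cmod (r x))\<^sup>2)"
    have "0 < (cmod (r x))\<^sup>2" using ne by (simp add: r_def)
    also have "\<dots> \<le> s" unfolding s_def using X x by (intro member_le_sum) auto
    finally have s: "0 < s" .
    define q where "q = (\<lambda>x. complex_of_real (1 / sqrt s) * r x)"
    have q: "q \<in> F" unfolding q_def r_def by (intro F rF) simp
    have qb: "ip X (b l) q = 0" if "l < d" for l
      using orthonormal_residual(1)[OF b(1) that, of f] unfolding q_def ip_scale_right r_def by simp
    have nq: "(cmod (q x))\<^sup>2 = (1 / sqrt s)\<^sup>2 * (cmod (r x))\<^sup>2" for x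
      unfolding q_def norm_mult power_mult_distrib norm_of_real power2_abs by (rule refl)
    have "ip X q q = complex_of_real ((1 / sqrt s)\<^sup>2 * s)"
      unfolding ip_self nq sum_distrib_left[symmetric] s_def[symmetric] by (rule refl)
    also have "(1 / sqrt s)\<^sup>2 * s = 1" using s by (simp add: power_divide)
    finally have qq: "ip X q q = 1" by simp
    have "orthonormal X (Suc d) (b(d := q))"
      unfolding orthonormal_def
    proof (intro allI impI)
      fix k l assume "k < Suc d" "l < Suc d"
      then show "ip X ((b(d := q)) k) ((b(d := q)) l) = (if k = l then 1 else 0)"
        using b(1) qq qb[of k] qb[of l] ip_cnj[of X "b l" q] by (auto simp: orthonormal_def less_Suc_eq)
    qed
    then have "P (Suc d)" unfolding P_def using b(2) q by (intro exI[of _ "b(d := q)"]) (auto simp: less_Suc_eq)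
    then show False using max by simp
  qed
  then show ?thesis using that b by blast
qed

section \<open>The representations \<open>\<rho>\<^sub>m\<close>\<close>

definition fin_vec :: "nat \<Rightarrow> (nat \<Rightarrow> complex) \<Rightarrow> nat ell2" where
  "fin_vec N g = Abs_ell2 (\<lambda>i. if i < N then g i else 0)"

lemma finite_support_summable:
  fixes g :: "'i \<Rightarrow> real"
  assumes "finite S" "\<And>i. i \<notin> S \<Longrightarrow> g i = 0"
  shows "g summable_on UNIV" "infsum g UNIV = sum g S"
proof -
  show "g summable_on UNIV"
    using summable_on_cong_neutral[of UNIV S g g] assms by auto
  show "infsum g UNIV = sum g S"
    using infsum_cong_neutral[of UNIV S g g] assms by auto
qed

lemma Rep_fin_vec: "Rep_ell2 (fin_vec N g) = (\<lambda>i. if i < N then g i else 0)"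
  unfolding fin_vec_def
  by (rule Abs_ell2_inverse, rule CollectI, rule finite_support_summable(1)[of "{..<N}"]) auto

lemma norm_fin_vec: "(norm (fin_vec N g))\<^sup>2 = (\<Sum>i<N. (cmod (g i))\<^sup>2)"
  using finite_support_summable(2)[of "{..<N}" "\<lambda>i. (cmod (if i < N then g i else 0))\<^sup>2"]
  by (simp add: norm_ell2.rep_eq Rep_fin_vec sum_nonneg)

lemma ell2_eqI: "(\<And>i. Rep_ell2 f i = Rep_ell2 g i) \<Longrightarrow> f = g"
  by (metis Rep_ell2_inject ext)

lemma Rep_ell2_sum: "Rep_ell2 (sum f K) i = (\<Sum>k\<in>K. Rep_ell2 (f k) i)"
  by (induction K rule: infinite_finite_induct) (auto simp: zero_ell2.rep_eq plus_ell2.rep_eq)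

context uhf3
begin

lemma rho_eq_fin_vec:
  "rho \<iota> m a f = fin_vec (3 ^ Suc m) (\<lambda>i. \<Sum>j<3 ^ Suc m. slice \<iota> m a $$ (i, j) * Rep_ell2 f j)"
proof -
  have "(slice \<iota> m a *\<^sub>v vec (3 ^ Suc m) (Rep_ell2 f)) $ i = (\<Sum>j<3 ^ Suc m. slice \<iota> m a $$ (i, j) * Rep_ell2 f j)"
    if "i < 3 ^ Suc m" for i
    using that slice_carrier[of m a] by (auto simp: scalar_prod_def lessThan_atLeast0)
  then show ?thesis
    unfolding rho_def fin_vec_def Suc_eq_plus1[symmetric] by (intro arg_cong[where f = Abs_ell2] ext) simp
qed

lemma rho_sum: "rho \<iota> m a (\<Sum>k\<in>K. c k *\<^sub>C f k) = (\<Sum>k\<in>K. c k *\<^sub>C rho \<iota> m a (f k))"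
proof (rule ell2_eqI)
  fix i
  have "(\<Sum>j<3 ^ Suc m. slice \<iota> m a $$ (i, j) * (\<Sum>k\<in>K. c k * Rep_ell2 (f k) j))
      = (\<Sum>k\<in>K. c k * (\<Sum>j<3 ^ Suc m. slice \<iota> m a $$ (i, j) * Rep_ell2 (f k) j))"
    unfolding sum_distrib_left by (subst sum.swap) (simp add: mult.left_commute)
  then show "Rep_ell2 (rho \<iota> m a (\<Sum>k\<in>K. c k *\<^sub>C f k)) i = Rep_ell2 (\<Sum>k\<in>K. c k *\<^sub>C rho \<iota> m a (f k)) i"
    by (simp add: rho_eq_fin_vec Rep_fin_vec Rep_ell2_sum scaleC_ell2.rep_eq)
qed

lemma norm_rho_le:
  assumes "a \<in> A_inf \<iota>"
  shows "norm (rho \<iota> m a f) \<le> norm a * norm f"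
proof -
  have "(norm (rho \<iota> m a f))\<^sup>2 \<le> (norm a)\<^sup>2 * (\<Sum>i<3 ^ Suc m. (cmod (Rep_ell2 f i))\<^sup>2)"
    unfolding rho_eq_fin_vec norm_fin_vec by (rule slice_contractive[OF assms])
  also have "\<dots> \<le> (norm a)\<^sup>2 * (norm f)\<^sup>2"
    using L2_set_le_norm_ell2[of f "{..<3 ^ Suc m}"]
    by (intro mult_left_mono) (auto simp: L2_set_def intro: sqrt_le_D)
  finally show ?thesis by (intro power2_le_imp_le[of "norm (rho \<iota> m a f)"]) (simp_all add: power_mult_distrib)
qed

text \<open>\<rho>_n(a) as a function on index pairs, so that the finite-dimensional algebra
  \<rho>_n(A_inf) becomes a space of functions on a finite set. There \<open>ip\<close> is the
  unnormalised trace inner product tr(b* d).\<close>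

definition entries :: "nat \<Rightarrow> 'a \<Rightarrow> nat \<times> nat \<Rightarrow> complex" where
  "entries n a = (\<lambda>(r, c). if r < 3 ^ Suc n \<and> c < 3 ^ Suc n then slice \<iota> n a $$ (r, c) else 0)"

lemma entries_add:
  "a \<in> A_inf \<iota> \<Longrightarrow> b \<in> A_inf \<iota> \<Longrightarrow> entries n (a + b) = (\<lambda>x. entries n a x + entries n b x)"
  by (auto simp: entries_def slice_add index_add_M3[OF slice_carrier])

lemma entries_scaleC: "a \<in> A_inf \<iota> \<Longrightarrow> entries n (c *\<^sub>C a) = (\<lambda>x. c * entries n a x)"
  using slice_carrier[of n a] by (auto simp: entries_def slice_scaleC)

lemma entries_mult:
  assumes "a \<in> A_inf \<iota>" "b \<in> A_inf \<iota>" "r < 3 ^ Suc n" "c < 3 ^ Suc n"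
  shows "entries n (a * b) (r, c) = (\<Sum>t<3 ^ Suc n. slice \<iota> n a $$ (r, t) * entries n b (t, c))"
  using assms(3,4) by (simp add: entries_def slice_mult[OF assms(1,2)] index_mult_M3[OF slice_carrier slice_carrier])

lemma entries_sum:
  assumes "finite K" "\<And>k. k \<in> K \<Longrightarrow> a k \<in> A_inf \<iota>"
  shows "entries n (\<Sum>k\<in>K. c k *\<^sub>C a k) = (\<lambda>x. \<Sum>k\<in>K. c k * entries n (a k) x)"
  using assms
proof (induction K rule: finite_induct)
  case empty
  show ?case
    using entries_scaleC[OF cstar_subalgebra_0[OF cstar_subalgebra_A_inf], of n 0] by simp
next
  case (insert k K)
  then have "(\<Sum>k\<in>K. c k *\<^sub>C a k) \<in> A_inf \<iota>" "c k *\<^sub>C a k \<in> A_inf \<iota>"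
    by (auto intro!: cstar_subalgebra_sum cstar_subalgebra_scaleC cstar_subalgebra_A_inf)
  then show ?case using insert by (simp add: entries_add entries_scaleC)
qed

lemma ideal_iff_entries:
  "a \<in> ideal n \<longleftrightarrow> a \<in> A_inf \<iota> \<and> (\<forall>r<3 ^ Suc n. \<forall>c<3 ^ Suc n. entries n a (r, c) = 0)"
proof -
  have "slice \<iota> n a = 0\<^sub>m (3 ^ Suc n) (3 ^ Suc n)
      \<longleftrightarrow> (\<forall>r<3 ^ Suc n. \<forall>c<3 ^ Suc n. slice \<iota> n a $$ (r, c) = 0)"
    using slice_carrier[of n a] by (auto intro!: eq_matI)
  then show ?thesis by (auto simp: ideal_def entries_def)
qed

text \<open>Both sides are the trace of \<rho>_n(b)* \<rho>_n(a) \<rho>_n(d): left multiplication by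
  a* is the adjoint of left multiplication by a. This is the invariance that makes the Casimir
  construction intertwine.\<close>

lemma ip_entries_adjoint:
  fixes n :: nat
  assumes "a \<in> A_inf \<iota>" "b \<in> A_inf \<iota>" "d \<in> A_inf \<iota>"
  defines "X \<equiv> {..<3 ^ Suc n} \<times> {..<3 ^ Suc n}"
  shows "ip X (entries n (star a * b)) (entries n d) = ip X (entries n b) (entries n (a * d))"
proof -
  let ?N = "3 ^ Suc n :: nat" and ?s = "\<lambda>r t. slice \<iota> n a $$ (r, t)"
  have star: "star a \<in> A_inf \<iota>" using cstar_subalgebra_star[OF cstar_subalgebra_A_inf assms(1)] .
  have "slice \<iota> n (star a) $$ (r, t) = cnj (?s t r)" if "r < ?N" "t < ?N" for r t
    using that slice_carrier[of n a] by (auto simp: slice_star[OF assms(1)])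
  then have "cnj (entries n (star a * b) (r, c)) * entries n d (r, c)
      = (\<Sum>t<?N. ?s t r * cnj (entries n b (t, c)) * entries n d (r, c))" if "r < ?N" "c < ?N" for r c
    using that by (simp add: entries_mult[OF star assms(2)] sum_distrib_right)
  then have "ip X (entries n (star a * b)) (entries n d)
      = (\<Sum>r<?N. \<Sum>c<?N. \<Sum>t<?N. ?s t r * cnj (entries n b (t, c)) * entries n d (r, c))"
    unfolding ip_def X_def sum.cartesian_product' by (intro sum.cong refl) simp
  also have "\<dots> = (\<Sum>c<?N. \<Sum>r<?N. \<Sum>t<?N. ?s t r * cnj (entries n b (t, c)) * entries n d (r, c))"
    by (rule sum.swap)
  also have "\<dots> = (\<Sum>c<?N. \<Sum>t<?N. \<Sum>r<?N. ?s t r * cnj (entries n b (t, c)) * entries n d (r, c))"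
    by (intro sum.cong refl sum.swap)
  also have "\<dots> = (\<Sum>t<?N. \<Sum>c<?N. \<Sum>r<?N. ?s t r * cnj (entries n b (t, c)) * entries n d (r, c))"
    by (rule sum.swap)
  also have "\<dots> = ip X (entries n b) (entries n (a * d))"
    unfolding ip_def X_def sum.cartesian_product'
    by (intro sum.cong refl) (simp add: entries_mult[OF assms(1,3)] sum_distrib_left ac_simps)
  finally show ?thesis .
qed

text \<open>If \<open>ideal n\<close> acts degenerately then some nonzero \<open>z\<close> is annihilated by \<open>ideal n\<close>. For
  \<open>b\<^sub>1, \<dots>, b\<^sub>d\<close> lifting a basis of \<open>\<rho>\<^sub>n(\<A>\<^sub>\<infinity>)\<close> orthonormal with respect to the trace, the Casimir element
  \<open>\<Sum>\<^sub>k \<rho>\<^sub>n(b\<^sub>k) \<otimes> b\<^sub>k\<^sup>*\<close> turns the rank one operators \<open>w \<mapsto> \<langle>z, w\<rangle> \<delta>\<^sub>c\<close> into intertwiners,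
  not all of which vanish.\<close>

lemma ideal_nondegenerate:
  fixes \<pi> :: "'a \<Rightarrow> 'h::chilbert_space \<Rightarrow> 'h"
  assumes rep: "star_rep (A_inf \<iota>) \<pi>" and orth: "orthogonal_reps (A_inf \<iota>) \<pi> (rho_space n) (rho \<iota> n)"
  shows "closure (cspan {\<pi> a x | a x. a \<in> ideal n}) = UNIV"
proof (rule ccontr)
  note A = cstar_subalgebra_A_inf and I = cstar_subalgebra_ideal[of n]
  define N :: nat where "N = 3 ^ Suc n"
  define X where "X = {..<N} \<times> {..<N}"
  assume "closure (cspan {\<pi> a x | a x. a \<in> ideal n}) \<noteq> UNIV"
  then obtain z where z: "z \<noteq> 0" "\<And>m. m \<in> closure (cspan {\<pi> a x | a x. a \<in> ideal n}) \<Longrightarrow> cinner z m = 0"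
    using orthogonal_vector_exists[OF subspace_closure[OF complex_vector.subspace_span] closed_closure] by blast
  \<comment> \<open>The vector z is orthogonal to \<open>\<pi> (star i) (\<pi> i z)\<close>, which
    says that the squared norm of \<open>\<pi> i z\<close> is 0.\<close>
  have kill: "\<pi> i z = 0" if i: "i \<in> ideal n" for i
  proof -
    have "\<pi> (star i) (\<pi> i z) \<in> closure (cspan {\<pi> a x | a x. a \<in> ideal n})"
      using cstar_subalgebra_star[OF I i] by (intro subsetD[OF closure_subset] complex_vector.span_base) blast
    then have "cinner z (\<pi> (star i) (\<pi> i z)) = 0" by (rule z(2))
    moreover have "cinner (\<pi> (star (star i)) z) (\<pi> i z) = cinner z (\<pi> (star i) (\<pi> i z))"
      using cstar_subalgebra_star[OF A] i ideal_subset by (intro star_rep_adjoint[OF rep]) blast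
    ultimately show ?thesis by (simp add: star_star cinner_self)
  qed
  have "finite X" by (simp add: X_def)
  have Fadd: "(\<lambda>x. f x + g x) \<in> entries n ` A_inf \<iota>" if fg: "f \<in> entries n ` A_inf \<iota>" "g \<in> entries n ` A_inf \<iota>" for f g
  proof -
    obtain u v where "u \<in> A_inf \<iota>" "v \<in> A_inf \<iota>" "f = entries n u" "g = entries n v"
      using fg by blast
    then show ?thesis
      using entries_add[of u v n] cstar_subalgebra_add[OF A, of u v] by (intro image_eqI[of _ _ "u + v"]) simp_all
  qed
  have Fscale: "(\<lambda>x. c * f x) \<in> entries n ` A_inf \<iota>" if f: "f \<in> entries n ` A_inf \<iota>" for c f
  proof -
    obtain u where "u \<in> A_inf \<iota>" "f = entries n u" using f by blast
    then show ?thesis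
      using entries_scaleC[of u n c] cstar_subalgebra_scaleC[OF A, of u c] by (intro image_eqI[of _ _ "c *\<^sub>C u"]) simp_all
  qed
  obtain d b where b: "orthonormal X d b" "\<And>k. k < d \<Longrightarrow> b k \<in> entries n ` A_inf \<iota>"
    "\<And>f x. f \<in> entries n ` A_inf \<iota> \<Longrightarrow> x \<in> X \<Longrightarrow> f x = (\<Sum>k<d. ip X (b k) f * b k x)"
    by (rule orthonormal_basis_exists[OF \<open>finite X\<close> Fadd Fscale]) auto
  from b(2) have "\<forall>k. \<exists>a. k < d \<longrightarrow> a \<in> A_inf \<iota> \<and> b k = entries n a" by blast
  then obtain a where a: "\<And>k. k < d \<Longrightarrow> a k \<in> A_inf \<iota>" "\<And>k. k < d \<Longrightarrow> b k = entries n (a k)" by metis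
  \<comment> \<open>As z is killed by the kernel of \<rho>_n, the vector \<open>\<pi> y z\<close>
    depends on \<rho>_n(y) only, so the expansion of \<rho>_n(y) in the basis carries over to
    it.\<close>
  have expand: "\<pi> y z = (\<Sum>k<d. ip X (b k) (entries n y) *\<^sub>C \<pi> (a k) z)" if y: "y \<in> A_inf \<iota>" for y
  proof -
    define s where "s = (\<Sum>k<d. ip X (b k) (entries n y) *\<^sub>C a k)"
    have s: "s \<in> A_inf \<iota>" unfolding s_def using a(1)
      by (intro cstar_subalgebra_sum[OF A] cstar_subalgebra_scaleC[OF A]) auto
    have ys: "y - s \<in> A_inf \<iota>" by (rule cstar_subalgebra_diff[OF A y s])
    have "entries n y = (\<lambda>x. entries n (y - s) x + entries n s x)"
      using entries_add[OF ys s, of n] by simp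
    moreover have "entries n s x = (\<Sum>k<d. ip X (b k) (entries n y) * b k x)" for x
      unfolding s_def using a by (subst entries_sum) auto
    ultimately have "entries n (y - s) x = 0" if "x \<in> X" for x
      using b(3)[OF imageI[OF y] that] by (metis add_cancel_left_left)
    then have "y - s \<in> ideal n" using ys by (auto simp: ideal_iff_entries X_def N_def)
    then have "\<pi> y z = \<pi> s z"
      using kill[of "y - s"] star_rep_diff[OF rep A y s] by simp
    also have "\<dots> = (\<Sum>k<d. ip X (b k) (entries n y) *\<^sub>C \<pi> (a k) z)"
      unfolding s_def using a(1)
      by (subst star_rep_sum[OF rep A]) (auto simp: star_rep_scaleC[OF rep] intro: cstar_subalgebra_scaleC[OF A])
    finally show ?thesis .
  qed
  \<comment> \<open>\<open>F k c\<close> is \<rho>_n(a_k) applied to the unit vector \<delta>_c,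
    that is, column c. In \<open>T\<close> the adjoint of \<open>\<pi> (a k)\<close> has been moved
    to the side of z.\<close>
  define F where "F k c = fin_vec N (\<lambda>r. b k (r, c))" for k c
  define T where "T c w = (\<Sum>k<d. cinner (\<pi> (a k) z) w *\<^sub>C F k c)" for c w
  have T0: "T c = (\<lambda>_. 0)" if c: "c < N" for c
  proof -
    have "bounded_clinear (T c)"
    proof (rule bounded_clinearI)
      fix x y s
      show "T c (x + y) = T c x + T c y"
        by (simp add: T_def cinner_add_right scaleC_add_left sum.distrib)
      show "T c (s *\<^sub>C x) = s *\<^sub>C T c x"
        by (simp add: T_def cinner_scaleC_right complex_vector.scale_sum_right scaleC_scaleC)
      have "norm (T c x) \<le> (\<Sum>k<d. norm (\<pi> (a k) z) * norm x * norm (F k c))"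
        unfolding T_def by (rule sum_norm_le) (simp add: norm_scaleC mult_right_mono cauchy_schwarz)
      then show "norm (T c x) \<le> (\<Sum>k<d. norm (\<pi> (a k) z) * norm (F k c)) * norm x"
        unfolding sum_distrib_right by (simp only: mult_ac)
    qed
    moreover have "range (T c) \<subseteq> rho_space n"
      by (auto simp: rho_space_def T_def Rep_ell2_sum scaleC_ell2.rep_eq F_def Rep_fin_vec N_def)
    moreover have "T c (\<pi> y w) = rho \<iota> n y (T c w)" if y: "y \<in> A_inf \<iota>" for y w
    proof -
      \<comment> \<open>The matrix of left multiplication by y in the basis b. It governs y acting
        on the columns \<open>F l c\<close>, and by \<open>ip_entries_adjoint\<close> also star y
        acting on the vectors \<open>\<pi> (a k) z\<close>; these two occurrences agree, hence T
        intertwines.\<close>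
      define C where "C k l = ip X (b k) (entries n (y * a l))" for k l
      have ys: "star y \<in> A_inf \<iota>" using cstar_subalgebra_star[OF A y] .
      have coeff: "cinner (\<pi> (a k) z) (\<pi> y w) = (\<Sum>l<d. C k l * cinner (\<pi> (a l) z) w)" if k: "k < d" for k
      proof -
        have "cinner (\<pi> (a k) z) (\<pi> y w) = cinner (\<pi> (star y * a k) z) w"
          using star_rep_adjoint[OF rep y] star_rep_mult[OF rep ys a(1)[OF k]] by simp
        also have "\<dots> = (\<Sum>l<d. cnj (ip X (b l) (entries n (star y * a k))) * cinner (\<pi> (a l) z) w)"
          using expand[OF cstar_subalgebra_mult[OF A ys a(1)[OF k]]]
          by (simp add: cinner_sum_left cinner_scaleC_left)
        also have "\<dots> = (\<Sum>l<d. C k l * cinner (\<pi> (a l) z) w)"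
          using a k y by (intro sum.cong refl)
            (simp add: ip_cnj C_def ip_entries_adjoint X_def N_def)
        finally show ?thesis .
      qed
      have "rho \<iota> n y (F l c) = (\<Sum>k<d. C k l *\<^sub>C F k c)" if l: "l < d" for l
      proof (rule ell2_eqI)
        fix r
        have "(\<Sum>j<N. slice \<iota> n y $$ (r, j) * b l (j, c)) = (\<Sum>k<d. C k l * b k (r, c))" if r: "r < N"
        proof -
          have "(\<Sum>j<N. slice \<iota> n y $$ (r, j) * b l (j, c)) = entries n (y * a l) (r, c)"
            using entries_mult[OF y a(1)[OF l]] r c a(2)[OF l] by (simp add: N_def)
          then show ?thesis
            using b(3)[OF imageI[OF cstar_subalgebra_mult[OF A y a(1)[OF l]]], of "(r, c)"] r c
            by (simp add: C_def X_def)
        qed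
        then show "Rep_ell2 (rho \<iota> n y (F l c)) r = Rep_ell2 (\<Sum>k<d. C k l *\<^sub>C F k c) r"
          by (simp add: rho_eq_fin_vec Rep_fin_vec Rep_ell2_sum scaleC_ell2.rep_eq F_def N_def)
      qed
      then have "rho \<iota> n y (T c w) = (\<Sum>l<d. cinner (\<pi> (a l) z) w *\<^sub>C (\<Sum>k<d. C k l *\<^sub>C F k c))"
        unfolding T_def rho_sum by (intro sum.cong refl) simp
      also have "\<dots> = (\<Sum>k<d. (\<Sum>l<d. C k l * cinner (\<pi> (a l) z) w) *\<^sub>C F k c)"
        unfolding complex_vector.scale_sum_right complex_vector.scale_sum_left
        by (subst sum.swap) (simp add: scaleC_scaleC mult.commute)
      also have "\<dots> = T c (\<pi> y w)" unfolding T_def using coeff by (intro sum.cong refl) simp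
      finally show ?thesis ..
    qed
    ultimately show ?thesis using orth[unfolded orthogonal_reps_def, THEN spec, of "T c"] by simp
  qed
  have Tb: "(\<Sum>k<d. cinner (\<pi> (a k) z) w * b k x) = 0" if x: "x \<in> X" for x w
  proof -
    obtain r c where rc: "x = (r, c)" "r < N" "c < N" using x by (auto simp: X_def)
    have "Rep_ell2 (T c w) r = 0" using T0[OF rc(3)] by (simp add: zero_ell2.rep_eq)
    then show ?thesis
      using rc by (simp add: T_def Rep_ell2_sum scaleC_ell2.rep_eq F_def Rep_fin_vec)
  qed
  \<comment> \<open>The numbers \<open>cinner (\<pi> (a k) z) w\<close> are coefficients of the zero
    function in an orthonormal system and so vanish; take w = \<open>\<pi> (a l) z\<close>. By
    \<open>expand\<close> all of A_inf then kills z, against nondegeneracy of \<pi>.\<close>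
  have "\<pi> (a l) z = 0" if l: "l < d" for l
  proof -
    define w where "w = \<pi> (a l) z"
    have "cinner (\<pi> (a l) z) w = ip X (b l) (\<lambda>x. \<Sum>k<d. cinner (\<pi> (a k) z) w * b k x)"
      by (rule orthonormal_ip_sum[OF b(1) l, symmetric])
    also have "\<dots> = ip X (b l) (\<lambda>x. 0)" using Tb by (intro ip_cong) auto
    finally show ?thesis by (simp add: ip_def w_def cinner_self)
  qed
  then have "\<pi> y z = 0" if "y \<in> A_inf \<iota>" for y using expand[OF that] by simp
  then have "z = 0" by (rule separating[OF rep A])
  then show False using z(1) by simp
qed

end

section \<open>Orthogonality to a direct sum\<close>

lemma summable_Rep_ell2: "(\<lambda>i. (cmod (Rep_ell2 f i))\<^sup>2) summable_on A"
  using Rep_ell2[of f] by (auto intro: summable_on_subset_banach)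

lemma Rep_component: "Rep_ell2 (component k f) i = Rep_ell2 f (k, i)"
proof -
  have "((\<lambda>p. (cmod (Rep_ell2 f p))\<^sup>2) \<circ> Pair k) summable_on UNIV"
    using summable_Rep_ell2[of f "Pair k ` UNIV"]
    by (subst summable_on_reindex[symmetric]) (simp_all add: inj_on_def)
  then show ?thesis unfolding component_def by (subst Abs_ell2_inverse) (simp_all add: comp_def)
qed

lemma norm_component: "(norm (component k f))\<^sup>2 = (\<Sum>\<^sub>\<infinity>p\<in>Pair k ` UNIV. (cmod (Rep_ell2 f p))\<^sup>2)"
  by (subst infsum_reindex) (simp_all add: inj_on_def norm_ell2.rep_eq Rep_component comp_def infsum_nonneg)

lemma sum_norm_component_le:
  assumes "finite K"
  shows "(\<Sum>k\<in>K. (norm (component k f))\<^sup>2) \<le> (norm f)\<^sup>2"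
proof -
  have "(\<Sum>k\<in>K. (norm (component k f))\<^sup>2) = (\<Sum>\<^sub>\<infinity>p\<in>(\<Union>k\<in>K. Pair k ` UNIV). (cmod (Rep_ell2 f p))\<^sup>2)"
    unfolding norm_component by (rule sum_infsum[OF assms summable_Rep_ell2]) auto
  also have "\<dots> \<le> (\<Sum>\<^sub>\<infinity>p. (cmod (Rep_ell2 f p))\<^sup>2)"
    by (intro infsum_mono2 summable_Rep_ell2) auto
  also have "\<dots> = (norm f)\<^sup>2" by (simp add: norm_ell2.rep_eq infsum_nonneg)
  finally show ?thesis .
qed

lemma norm_component_le: "norm (component k f) \<le> norm f"
  using sum_norm_component_le[of "{k}" f] by (intro power2_le_imp_le[of "norm (component k f)" "norm f"]) simp_all

text \<open>The bound uniform in k is what makes the function below \<open>Abs_ell2\<close> in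
  \<open>direct_sum_op\<close> square-summable; without that the components could not be read
  off.\<close>

lemma component_direct_sum_op:
  assumes "\<And>k g. norm (T k g) \<le> C * norm g" "0 \<le> C"
  shows "component k (direct_sum_op T f) = T k (component k f)"
proof -
  let ?h = "\<lambda>(k, i). Rep_ell2 (T k (component k f)) i"
  have "(\<lambda>p. (cmod (?h p))\<^sup>2) summable_on UNIV"
  proof (intro nonneg_bdd_above_summable_on bdd_aboveI)
    fix s assume "s \<in> sum (\<lambda>p. (cmod (?h p))\<^sup>2) ` {F. F \<subseteq> UNIV \<and> finite F}"
    then obtain F where F: "finite F" "s = (\<Sum>p\<in>F. (cmod (?h p))\<^sup>2)" by auto
    \<comment> \<open>The finite index set is enlarged to a rectangle, so that the sum can be taken
      component by component.\<close>
    have "s \<le> (\<Sum>p\<in>fst ` F \<times> snd ` F. (cmod (?h p))\<^sup>2)"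
      unfolding F(2) using F(1) by (intro sum_mono2) force+
    also have "\<dots> = (\<Sum>k\<in>fst ` F. \<Sum>i\<in>snd ` F. (cmod (Rep_ell2 (T k (component k f)) i))\<^sup>2)"
      by (simp add: sum.cartesian_product')
    also have "\<dots> \<le> (\<Sum>k\<in>fst ` F. (C * norm (component k f))\<^sup>2)"
    proof (rule sum_mono)
      fix k
      have "(\<Sum>i\<in>snd ` F. (cmod (Rep_ell2 (T k (component k f)) i))\<^sup>2) \<le> (norm (T k (component k f)))\<^sup>2"
        using L2_set_le_norm_ell2[of "T k (component k f)" "snd ` F"] by (auto simp: L2_set_def intro: sqrt_le_D)
      also have "\<dots> \<le> (C * norm (component k f))\<^sup>2" using assms(1) by (intro power_mono) auto
      finally show "(\<Sum>i\<in>snd ` F. (cmod (Rep_ell2 (T k (component k f)) i))\<^sup>2) \<le> (C * norm (component k f))\<^sup>2" .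
    qed
    also have "\<dots> \<le> C\<^sup>2 * (norm f)\<^sup>2"
      unfolding power_mult_distrib sum_distrib_left[symmetric]
      using F(1) by (intro mult_left_mono sum_norm_component_le) auto
    finally show "s \<le> C\<^sup>2 * (norm f)\<^sup>2" .
  qed auto
  then have "Rep_ell2 (direct_sum_op T f) = ?h"
    unfolding direct_sum_op_def by (intro Abs_ell2_inverse) simp
  then show ?thesis by (intro ell2_eqI) (simp add: Rep_component)
qed

definition summand :: "'k \<Rightarrow> 'i ell2 \<Rightarrow> ('k \<times> 'i) ell2" where
  "summand m f = Abs_ell2 (\<lambda>(k, i). if k = m then Rep_ell2 f i else 0)"

lemma Rep_summand: "Rep_ell2 (summand m f) = (\<lambda>(k, i). if k = m then Rep_ell2 f i else 0)"
  unfolding summand_def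
proof (rule Abs_ell2_inverse, rule CollectI)
  let ?h = "\<lambda>p. (cmod (case p of (k, i) \<Rightarrow> if k = m then Rep_ell2 f i else 0))\<^sup>2"
  have "?h summable_on Pair m ` UNIV"
    using summable_Rep_ell2[of f UNIV] by (subst summable_on_reindex) (simp_all add: inj_on_def comp_def)
  then show "?h summable_on UNIV"
    by (subst summable_on_cong_neutral[where T = "Pair m ` UNIV" and g = ?h]) auto
qed

lemma norm_summand: "norm (summand m f) = norm f"
proof -
  let ?h = "\<lambda>p. (cmod (Rep_ell2 (summand m f) p))\<^sup>2"
  have "(\<Sum>\<^sub>\<infinity>p. ?h p) = (\<Sum>\<^sub>\<infinity>p\<in>Pair m ` UNIV. ?h p)"
    by (rule infsum_cong_neutral) (auto simp: Rep_summand)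
  also have "\<dots> = (\<Sum>\<^sub>\<infinity>i. (cmod (Rep_ell2 f i))\<^sup>2)"
    by (subst infsum_reindex) (simp_all add: inj_on_def comp_def Rep_summand)
  finally show ?thesis by (simp add: norm_ell2.rep_eq)
qed

lemma component_summand: "component k (summand m f) = (if k = m then f else 0)"
  by (rule ell2_eqI) (simp add: Rep_component Rep_summand zero_ell2.rep_eq)

context uhf3
begin

lemma component_rho_inf:
  assumes "a \<in> A_inf \<iota>"
  shows "component m (rho_inf \<iota> a f) = rho \<iota> m a (component m f)"
  unfolding rho_inf_def using norm_rho_le[OF assms] by (rule component_direct_sum_op) simp

text \<open>A nonzero intertwiner into the sum has a nonzero component, which intertwines with that
  \<rho>_m; conversely an intertwiner into one \<rho>_m stays one, of the same norm, after the
  isometric inclusion \<open>summand m\<close>.\<close>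

lemma orthogonal_rho_inf_iff:
  fixes \<pi> :: "'a \<Rightarrow> 'h::chilbert_space \<Rightarrow> 'h"
  shows "(\<forall>m. orthogonal_reps (A_inf \<iota>) \<pi> (rho_space m) (rho \<iota> m))
    \<longleftrightarrow> orthogonal_reps (A_inf \<iota>) \<pi> rho_inf_space (rho_inf \<iota>)"
proof
  assume orth: "\<forall>m. orthogonal_reps (A_inf \<iota>) \<pi> (rho_space m) (rho \<iota> m)"
  show "orthogonal_reps (A_inf \<iota>) \<pi> rho_inf_space (rho_inf \<iota>)"
    unfolding orthogonal_reps_def
  proof (intro allI impI, elim conjE)
    fix T :: "'h \<Rightarrow> (nat \<times> nat) ell2"
    assume T: "bounded_clinear T" "range T \<subseteq> rho_inf_space" "\<forall>a\<in>A_inf \<iota>. \<forall>x. T (\<pi> a x) = rho_inf \<iota> a (T x)"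
    have comp0: "(\<lambda>x. component m (T x)) = (\<lambda>_. 0)" for m
    proof -
      obtain K where K: "\<And>x. norm (T x) \<le> norm x * K" using bounded_clinear_bound[OF T(1)] by blast
      have "bounded_clinear (\<lambda>x. component m (T x))"
      proof (rule bounded_clinearI)
        show "component m (T (x + y)) = component m (T x) + component m (T y)" for x y
          by (rule ell2_eqI) (simp add: bounded_clinear_add[OF T(1)] Rep_component plus_ell2.rep_eq)
        show "component m (T (c *\<^sub>C x)) = c *\<^sub>C component m (T x)" for c x
          by (rule ell2_eqI) (simp add: bounded_clinear_scaleC[OF T(1)] Rep_component scaleC_ell2.rep_eq)
        show "norm (component m (T x)) \<le> K * norm x" for x
          using order_trans[OF norm_component_le K] by (simp add: mult.commute)
      qed
      moreover have "range (\<lambda>x. component m (T x)) \<subseteq> rho_space m"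
        using T(2) by (auto simp: rho_inf_space_def direct_sum_space_def)
      ultimately show ?thesis
        using orth[THEN spec, of m, unfolded orthogonal_reps_def, THEN spec, of "\<lambda>x. component m (T x)"] T(3)
        by (simp add: component_rho_inf)
    qed
    show "T = (\<lambda>_. 0)"
    proof
      fix x
      show "T x = 0"
      proof (rule ell2_eqI)
        fix p :: "nat \<times> nat"
        have "Rep_ell2 (component (fst p) (T x)) (snd p) = 0"
          using fun_cong[OF comp0, of "fst p" x] by (simp add: zero_ell2.rep_eq)
        then show "Rep_ell2 (T x) p = Rep_ell2 0 p" by (simp add: Rep_component zero_ell2.rep_eq)
      qed
    qed
  qed
next
  assume orth: "orthogonal_reps (A_inf \<iota>) \<pi> rho_inf_space (rho_inf \<iota>)"
  show "\<forall>m. orthogonal_reps (A_inf \<iota>) \<pi> (rho_space m) (rho \<iota> m)"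
    unfolding orthogonal_reps_def
  proof (intro allI impI, elim conjE)
    fix m and T :: "'h \<Rightarrow> nat ell2"
    assume T: "bounded_clinear T" "range T \<subseteq> rho_space m" "\<forall>a\<in>A_inf \<iota>. \<forall>x. T (\<pi> a x) = rho \<iota> m a (T x)"
    obtain K where K: "\<And>x. norm (T x) \<le> norm x * K" using bounded_clinear_bound[OF T(1)] by blast
    have "bounded_clinear (\<lambda>x. summand m (T x))"
    proof (rule bounded_clinearI)
      show "summand m (T (x + y)) = summand m (T x) + summand m (T y)" for x y
        by (rule ell2_eqI) (auto simp: bounded_clinear_add[OF T(1)] Rep_summand plus_ell2.rep_eq)
      show "summand m (T (c *\<^sub>C x)) = c *\<^sub>C summand m (T x)" for c x
        by (rule ell2_eqI) (auto simp: bounded_clinear_scaleC[OF T(1)] Rep_summand scaleC_ell2.rep_eq)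
      show "norm (summand m (T x)) \<le> K * norm x" for x
        using K by (simp add: norm_summand mult.commute)
    qed
    moreover have "range (\<lambda>x. summand m (T x)) \<subseteq> rho_inf_space"
    proof -
      have "T x \<in> rho_space m" "0 \<in> rho_space k" for x k
        using subsetD[OF T(2) rangeI] by (simp_all add: rho_space_def zero_ell2.rep_eq)
      then show ?thesis by (auto simp: rho_inf_space_def direct_sum_space_def component_summand)
    qed
    moreover have "summand m (T (\<pi> a x)) = rho_inf \<iota> a (summand m (T x))" if a: "a \<in> A_inf \<iota>" for a x
    proof (rule ell2_eqI)
      fix p :: "nat \<times> nat"
      have "component (fst p) (rho_inf \<iota> a (summand m (T x))) = component (fst p) (summand m (T (\<pi> a x)))"
        \<comment> \<open>The bound at the vector 0 gives \<open>rho \<iota> k a 0 = 0\<close>,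
          needed in the components other than m.\<close>
        using T(3) a norm_rho_le[OF a, of "fst p" 0]
        by (simp add: component_rho_inf component_summand)
      from arg_cong[OF this, of "\<lambda>f. Rep_ell2 f (snd p)"]
      show "Rep_ell2 (summand m (T (\<pi> a x))) p = Rep_ell2 (rho_inf \<iota> a (summand m (T x))) p"
        by (simp add: Rep_component)
    qed
    ultimately have "(\<lambda>x. summand m (T x)) = (\<lambda>_. 0)"
      using orth[unfolded orthogonal_reps_def, THEN spec, of "\<lambda>x. summand m (T x)"] by simp
    then have "norm (T x) = 0" for x
      using norm_summand[of m "T x"] by (simp add: fun_eq_iff)
    then show "T = (\<lambda>_. 0)" by (simp add: fun_eq_iff)
  qed
qed

section \<open>Faithfulness\<close>

text \<open>For v in the range of \<pi>(e_jj), compressing x by e_ii and e_jj gives x_ij \<pi>(e_ij)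
  v, and \<pi>(e_ij) preserves the norm of v since both e_ij and e_ji act contractively. So c bounds
  every entry, and the constant is the number of entries.\<close>

lemma norm_le_if_image_bounded:
  fixes \<pi> :: "'a \<Rightarrow> 'h::chilbert_space \<Rightarrow> 'h"
  assumes rep: "star_rep UNIV \<pi>" and contr: "\<And>y z. norm (\<pi> y z) \<le> norm y * norm z"
    and x: "x \<in> M3 n" and bound: "\<And>z. norm (\<pi> (\<iota> n x) z) \<le> c * norm z"
  shows "norm (\<iota> n x) \<le> (3 ^ n * 3 ^ n) * c"
proof -
  have mult: "\<pi> (a * b) z = \<pi> a (\<pi> b z)" for a b z using star_rep_mult[OF rep] by simp
  have uu: "\<iota> n (unit_mat n i j) * \<iota> n (unit_mat n j k) = \<iota> n (unit_mat n i k)"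
    if "i < 3 ^ n" "j < 3 ^ n" "k < 3 ^ n" for i j k
    using that iota_mult[OF unit_mat_carrier unit_mat_carrier] by (simp add: unit_mat_mult flip: iota_mult)
  have "cmod (x $$ (i, j)) \<le> c" if ij: "i < 3 ^ n" "j < 3 ^ n" for i j
  proof -
    \<comment> \<open>If e_jj acted as zero, so would every e_kk = e_kj e_jj e_jk and hence their
      sum 1.\<close>
    have "\<exists>w. \<pi> (\<iota> n (unit_mat n j j)) w \<noteq> 0"
    proof (rule ccontr)
      assume "\<not> (\<exists>w. \<pi> (\<iota> n (unit_mat n j j)) w \<noteq> 0)"
      then have 0: "\<pi> (\<iota> n (unit_mat n j j)) w = 0" for w by blast
      have k: "\<pi> (\<iota> n (unit_mat n k k)) w = 0" if "k < 3 ^ n" for k w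
      proof -
        have "\<iota> n (unit_mat n k k) = \<iota> n (unit_mat n k j) * (\<iota> n (unit_mat n j j) * \<iota> n (unit_mat n j k))"
          using that ij by (simp add: uu)
        then show ?thesis
          using bounded_clinear_zero[OF star_rep_bounded[OF rep]] by (simp add: mult 0)
      qed
      have "cstar_subalgebra (UNIV :: 'a set)" by (auto simp: cstar_subalgebra_def complex_vector.subspace_def)
      from star_rep_sum[OF rep this, of "{..<3 ^ n}" "\<lambda>k. \<iota> n (unit_mat n k k)"]
      have "\<pi> 1 w = 0" for w by (simp add: sum_iota_unit_mat k)
      then have zero: "\<pi> a w = 0" for a w using mult[of 1 a w] by simp
      have "w = 0" for w :: 'h by (rule separating[OF rep \<open>cstar_subalgebra UNIV\<close> zero])
      then show False using star_rep_nonzero[OF rep] by blast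
    qed
    then obtain w where w: "\<pi> (\<iota> n (unit_mat n j j)) w \<noteq> 0" by blast
    define v where "v = \<pi> (\<iota> n (unit_mat n j j)) w"
    have v: "\<pi> (\<iota> n (unit_mat n j j)) v = v" "v \<noteq> 0"
      using w ij by (simp_all add: v_def uu flip: mult)
    have unit_le: "norm (\<pi> (\<iota> n (unit_mat n k l)) u) \<le> norm u" if "k < 3 ^ n" "l < 3 ^ n" for k l u
      using contr[of "\<iota> n (unit_mat n k l)" u] norm_iota_unit_mat_le[OF that]
        mult_right_mono[of "norm (\<iota> n (unit_mat n k l))" 1 "norm u"] by simp
    have "\<iota> n (unit_mat n i i) * \<iota> n x * \<iota> n (unit_mat n j j) = x $$ (i, j) *\<^sub>C \<iota> n (unit_mat n i j)"
      using unit_mat_compress[OF x ij]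
      by (simp only: iota_mult[OF mult_carrier_mat[OF unit_mat_carrier x] unit_mat_carrier, symmetric]
          iota_mult[OF unit_mat_carrier x, symmetric] iota_smult[OF unit_mat_carrier])
    then have "\<pi> (x $$ (i, j) *\<^sub>C \<iota> n (unit_mat n i j)) v
        = \<pi> (\<iota> n (unit_mat n i i) * \<iota> n x * \<iota> n (unit_mat n j j)) v" by simp
    then have "x $$ (i, j) *\<^sub>C \<pi> (\<iota> n (unit_mat n i j)) v = \<pi> (\<iota> n (unit_mat n i i)) (\<pi> (\<iota> n x) v)"
      by (simp add: star_rep_scaleC[OF rep] mult v(1))
    then have "cmod (x $$ (i, j)) * norm (\<pi> (\<iota> n (unit_mat n i j)) v) \<le> norm (\<pi> (\<iota> n x) v)"
      using unit_le[OF ij(1) ij(1), of "\<pi> (\<iota> n x) v"] by (simp flip: norm_scaleC)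
    also have "\<dots> \<le> c * norm v" by (rule bound)
    finally have "cmod (x $$ (i, j)) * norm (\<pi> (\<iota> n (unit_mat n i j)) v) \<le> c * norm v" .
    moreover have "norm v \<le> norm (\<pi> (\<iota> n (unit_mat n i j)) v)"
      using unit_le[OF ij(2,1), of "\<pi> (\<iota> n (unit_mat n i j)) v"] v(1) ij by (simp add: uu flip: mult)
    then have "cmod (x $$ (i, j)) * norm v \<le> cmod (x $$ (i, j)) * norm (\<pi> (\<iota> n (unit_mat n i j)) v)"
      by (rule mult_left_mono) simp
    ultimately have "cmod (x $$ (i, j)) * norm v \<le> c * norm v" by linarith
    then show ?thesis using v(2) by simp
  qed
  then have "(\<Sum>i<3 ^ n. \<Sum>j<3 ^ n. cmod (x $$ (i, j))) \<le> (\<Sum>i<(3::nat) ^ n. \<Sum>j<(3::nat) ^ n. c)"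
    by (intro sum_mono) auto
  then show ?thesis using norm_iota_le_sum[OF x] by simp
qed

text \<open>The dimension dependent constant is removed by passing to the powers \<open>x\<^bsup>2^k\<^esup>\<close>.\<close>

lemma norm_self_adjoint_le:
  fixes \<pi> :: "'a \<Rightarrow> 'h::chilbert_space \<Rightarrow> 'h"
  assumes rep: "star_rep UNIV \<pi>" and contr: "\<And>y z. norm (\<pi> y z) \<le> norm y * norm z"
    and x: "x \<in> M3 n" "star (\<iota> n x) = \<iota> n x" and bound: "\<And>z. norm (\<pi> (\<iota> n x) z) \<le> c * norm z" and c: "0 < c"
  shows "norm (\<iota> n x) \<le> c"
proof (rule ccontr)
  assume "\<not> norm (\<iota> n x) \<le> c"
  then have q: "1 < norm (\<iota> n x) / c" using c by simp
  have "\<exists>y\<in>M3 n. star (\<iota> n y) = \<iota> n y \<and> norm (\<iota> n y) = norm (\<iota> n x) ^ (2 ^ k)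
      \<and> (\<forall>z. norm (\<pi> (\<iota> n y) z) \<le> c ^ (2 ^ k) * norm z)" for k
  proof (induction k)
    case 0
    then show ?case using x bound by auto
  next
    case (Suc k)
    then obtain y where y: "y \<in> M3 n" "star (\<iota> n y) = \<iota> n y" "norm (\<iota> n y) = norm (\<iota> n x) ^ (2 ^ k)"
      "\<And>z. norm (\<pi> (\<iota> n y) z) \<le> c ^ (2 ^ k) * norm z" by auto
    have yy: "\<iota> n (y * y) = \<iota> n y * \<iota> n y" by (rule iota_mult[OF y(1,1)])
    have two: "(2::nat) ^ Suc k = 2 ^ k * 2" by (simp add: power_Suc)
    have "norm (\<pi> (\<iota> n (y * y)) z) \<le> c ^ (2 ^ Suc k) * norm z" for z
    proof -
      have "norm (\<pi> (\<iota> n (y * y)) z) \<le> c ^ (2 ^ k) * norm (\<pi> (\<iota> n y) z)"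
        using y(4) star_rep_mult[OF rep] by (simp add: yy)
      also have "\<dots> \<le> c ^ (2 ^ k) * (c ^ (2 ^ k) * norm z)"
        using c by (intro mult_left_mono y(4)) simp
      finally show ?thesis by (simp add: two power_mult power2_eq_square mult.assoc)
    qed
    moreover have "norm (\<iota> n (y * y)) = norm (\<iota> n x) ^ (2 ^ Suc k)"
      using norm_star_mult_self[of "\<iota> n y"] by (simp add: yy y(2,3) two power_mult)
    moreover have "star (\<iota> n (y * y)) = \<iota> n (y * y)" by (simp add: yy star_mult y(2))
    ultimately show ?case using mult_carrier_mat[OF y(1,1)] by blast
  qed
  then have le: "norm (\<iota> n x) ^ (2 ^ k) \<le> (3 ^ n * 3 ^ n) * c ^ (2 ^ k)" for k
    using norm_le_if_image_bounded[OF rep contr] by metis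
  obtain m where m: "3 ^ n * 3 ^ n < (norm (\<iota> n x) / c) ^ m"
    using real_arch_pow[OF q] by blast
  also have "(norm (\<iota> n x) / c) ^ m \<le> (norm (\<iota> n x) / c) ^ (2 ^ m)"
    using q by (intro power_increasing) (auto simp: less_exp less_imp_le)
  also have "\<dots> \<le> 3 ^ n * 3 ^ n"
    using le[of m] c by (simp add: power_divide pos_divide_le_eq)
  finally show False by simp
qed

text \<open>Approximate h = y* y by g_k = f_k* f_k, self-adjoint and in the matrix algebras. As
  \<pi>(h) = 0, the operators \<pi>(g_k) = \<pi>(g_k - h) are small, and
  \<open>norm_self_adjoint_le\<close> makes g_k itself small. The summand e provides the strictly
  positive bound which that lemma asks for.\<close>

lemma star_rep_faithful:
  fixes \<pi> :: "'a \<Rightarrow> 'h::chilbert_space \<Rightarrow> 'h"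
  assumes rep: "star_rep UNIV \<pi>" and contr: "\<And>y z. norm (\<pi> y z) \<le> norm y * norm z"
    and zero: "\<And>z. \<pi> y z = 0"
  shows "y = 0"
proof -
  define h where "h = star y * y"
  have h0: "\<pi> h z = 0" for z
    using star_rep_mult[OF rep, of "star y" y z] bounded_clinear_zero[OF star_rep_bounded[OF rep]] zero
    by (simp add: h_def)
  have "y \<in> closure (\<Union>n. \<iota> n ` M3 n)" using iota_dense by simp
  then obtain f where f: "\<And>k. f k \<in> (\<Union>n. \<iota> n ` M3 n)" "f \<longlonglongrightarrow> y"
    unfolding closure_sequential by blast
  define g where "g k = star (f k) * f k" for k
  have g: "g \<longlonglongrightarrow> h" unfolding g_def[abs_def] h_def by (intro tendsto_mult tendsto_star f)
  have "norm (g k) \<le> norm (g k - h)" for k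
  proof (rule field_le_epsilon)
    fix e :: real assume e: "0 < e"
    obtain n u where u: "u \<in> M3 n" "f k = \<iota> n u" using f(1)[of k] by blast
    have gu: "g k = \<iota> n (mat_adjoint u * u)"
      using u by (simp add: g_def iota_mult[OF mat_adjoint_carrier] iota_adjoint)
    have "norm (\<pi> (g k) z) \<le> (norm (g k - h) + e) * norm z" for z
    proof -
      have "\<pi> (g k) z = \<pi> (g k - h) z + \<pi> h z"
        using star_rep_add[OF rep, of "g k - h" h z] by simp
      then have "norm (\<pi> (g k) z) \<le> norm (g k - h) * norm z" using contr[of "g k - h" z] h0 by simp
      also have "\<dots> \<le> (norm (g k - h) + e) * norm z" using e by (intro mult_right_mono) auto
      finally show ?thesis .
    qed
    moreover have "star (g k) = g k" by (simp add: g_def star_mult star_star)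
    moreover have "0 < norm (g k - h) + e" using e by (intro add_nonneg_pos) auto
    ultimately show "norm (g k) \<le> norm (g k - h) + e"
      unfolding gu using u by (intro norm_self_adjoint_le[OF rep contr]) (auto intro!: mult_carrier_mat mat_adjoint_carrier)
  qed
  moreover have "(\<lambda>k. norm (g k - h)) \<longlonglongrightarrow> norm (h - h)" by (intro tendsto_intros g)
  ultimately have "norm h \<le> norm (h - h)" by (intro LIMSEQ_le[OF tendsto_norm[OF g]]) auto
  then have "(norm y)\<^sup>2 = 0" unfolding h_def by (simp add: norm_star_mult_self)
  then show ?thesis by simp
qed

section \<open>Application to A_inf and its ideals\<close>

lemma multiplier_tower_ideal:
  fixes \<pi> :: "'a \<Rightarrow> 'h::chilbert_space \<Rightarrow> 'h"
  assumes "star_rep (A_inf \<iota>) \<pi>" "\<forall>m. orthogonal_reps (A_inf \<iota>) \<pi> (rho_space m) (rho \<iota> m)"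
  shows "multiplier_tower (A_inf \<iota>) ideal \<pi>"
  using assms
  by (intro multiplier_tower.intro cstar_subalgebra_ideal decseq_ideal ideal_subset A_inf_subset_multipliers
      ideal_nondegenerate dense_multipliers) auto

text \<open>Nondegeneracy survives the restriction because A_inf contains the unit.\<close>

lemma star_rep_restrict_A_inf:
  fixes \<pi> :: "'a \<Rightarrow> 'h::chilbert_space \<Rightarrow> 'h"
  assumes rep: "star_rep UNIV \<pi>"
  shows "star_rep (A_inf \<iota>) \<pi>"
proof (rule star_rep_subset[OF rep subset_UNIV])
  have "\<pi> a x = \<pi> 1 (\<pi> a x)" for a x using star_rep_mult[OF rep, of 1 a x] by simp
  then have "{\<pi> a x | a x. a \<in> UNIV} \<subseteq> {\<pi> a x | a x. a \<in> A_inf \<iota>}" using one_in_A_inf by blast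
  then show "closure (cspan {\<pi> a x | a x. a \<in> A_inf \<iota>}) = UNIV"
    using star_rep_nondegenerate[OF rep] closure_mono[OF complex_vector.span_mono] by blast
qed

lemma extension:
  fixes \<pi> :: "'a \<Rightarrow> 'h::chilbert_space \<Rightarrow> 'h"
  assumes rep: "star_rep (A_inf \<iota>) \<pi>" and orth: "\<forall>m. orthogonal_reps (A_inf \<iota>) \<pi> (rho_space m) (rho \<iota> m)"
  shows "inj_on \<pi> (A_inf \<iota>)"
    and "\<exists>\<pi>' :: 'a \<Rightarrow> 'h \<Rightarrow> 'h. star_rep UNIV \<pi>' \<and> (\<forall>a\<in>A_inf \<iota>. \<pi>' a = \<pi> a) \<and>
           bicommutant (\<pi> ` A_inf \<iota>) = bicommutant (range \<pi>')"
    and "star_rep UNIV \<pi> \<Longrightarrow> bicommutant (\<pi> ` A_inf \<iota>) = bicommutant (range \<pi>)"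
proof -
  interpret multiplier_tower "A_inf \<iota>" ideal \<pi> by (rule multiplier_tower_ideal[OF rep orth])
  have bi: "bicommutant (\<pi> ` A_inf \<iota>) = bicommutant (range ext)"
    unfolding bicommutant_def commutant_eq ..
  show "inj_on \<pi> (A_inf \<iota>)"
  proof (rule inj_onI)
    fix a b assume ab: "a \<in> A_inf \<iota>" "b \<in> A_inf \<iota>" "\<pi> a = \<pi> b"
    have "a - b \<in> A_inf \<iota>" using cstar_subalgebra_diff[OF cstar_subalgebra_A_inf ab(1,2)] .
    then have "ext (a - b) z = 0" for z
      using star_rep_diff[OF rep cstar_subalgebra_A_inf ab(1,2), of z] ab(3) by (simp add: ext_on_A)
    then have "a - b = 0" by (rule star_rep_faithful[OF star_rep_ext ext_norm_le])
    then show "a = b" by simp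
  qed
  show "\<exists>\<pi>' :: 'a \<Rightarrow> 'h \<Rightarrow> 'h. star_rep UNIV \<pi>' \<and> (\<forall>a\<in>A_inf \<iota>. \<pi>' a = \<pi> a) \<and>
      bicommutant (\<pi> ` A_inf \<iota>) = bicommutant (range \<pi>')"
    using star_rep_ext ext_on_A bi by blast
  show "bicommutant (\<pi> ` A_inf \<iota>) = bicommutant (range \<pi>)" if "star_rep UNIV \<pi>"
    using bi ext_unique[OF that] by simp
qed

end

theorem proposition3p8:
  fixes \<iota> :: "nat \<Rightarrow> complex mat \<Rightarrow> 'a::cstar_algebra"
  assumes "is_UHF3 \<iota>"
  shows
    "(\<forall>\<pi> :: 'a \<Rightarrow> 'h::chilbert_space \<Rightarrow> 'h. star_rep (A_inf \<iota>) \<pi> \<longrightarrow>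
        ((\<forall>m. orthogonal_reps (A_inf \<iota>) \<pi> (rho_space m) (rho \<iota> m)) \<longleftrightarrow>
          orthogonal_reps (A_inf \<iota>) \<pi> rho_inf_space (rho_inf \<iota>)) \<and>
        ((\<forall>m. orthogonal_reps (A_inf \<iota>) \<pi> (rho_space m) (rho \<iota> m)) \<longrightarrow>
          inj_on \<pi> (A_inf \<iota>) \<and>
          (\<exists>\<pi>' :: 'a \<Rightarrow> 'h \<Rightarrow> 'h. star_rep UNIV \<pi>' \<and> (\<forall>a\<in>A_inf \<iota>. \<pi>' a = \<pi> a) \<and>
             bicommutant (\<pi> ` A_inf \<iota>) = bicommutant (range \<pi>'))))
     \<and> (\<forall>\<pi> :: 'a \<Rightarrow> 'h \<Rightarrow> 'h. star_rep UNIV \<pi> \<longrightarrow>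
        orthogonal_reps (A_inf \<iota>) \<pi> rho_inf_space (rho_inf \<iota>) \<longrightarrow>
        bicommutant (\<pi> ` A_inf \<iota>) = bicommutant (range \<pi>))"
proof -
  interpret uhf3 \<iota> by unfold_locales (rule assms)
  show ?thesis
  proof (intro conjI allI impI)
    fix \<pi> :: "'a \<Rightarrow> 'h \<Rightarrow> 'h"
    assume rep: "star_rep (A_inf \<iota>) \<pi>"
    show "(\<forall>m. orthogonal_reps (A_inf \<iota>) \<pi> (rho_space m) (rho \<iota> m)) \<longleftrightarrow>
        orthogonal_reps (A_inf \<iota>) \<pi> rho_inf_space (rho_inf \<iota>)"
      by (rule orthogonal_rho_inf_iff)
    assume orth: "\<forall>m. orthogonal_reps (A_inf \<iota>) \<pi> (rho_space m) (rho \<iota> m)"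
    show "inj_on \<pi> (A_inf \<iota>)" by (rule extension(1)[OF rep orth])
    show "\<exists>\<pi>' :: 'a \<Rightarrow> 'h \<Rightarrow> 'h. star_rep UNIV \<pi>' \<and> (\<forall>a\<in>A_inf \<iota>. \<pi>' a = \<pi> a) \<and>
        bicommutant (\<pi> ` A_inf \<iota>) = bicommutant (range \<pi>')"
      by (rule extension(2)[OF rep orth])
  next
    fix \<pi> :: "'a \<Rightarrow> 'h \<Rightarrow> 'h"
    assume rep: "star_rep UNIV \<pi>" and "orthogonal_reps (A_inf \<iota>) \<pi> rho_inf_space (rho_inf \<iota>)"
    then have "\<forall>m. orthogonal_reps (A_inf \<iota>) \<pi> (rho_space m) (rho \<iota> m)"
      using orthogonal_rho_inf_iff by blast
    then show "bicommutant (\<pi> ` A_inf \<iota>) = bicommutant (range \<pi>)"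
      by (rule extension(3)[OF star_rep_restrict_A_inf[OF rep] _ rep])
  qed
qed

end
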